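(* Let $E/F$ be a separable quadratic extension of global fields and let $n\ge 1$. Equip the adèle ring $\mathbb{A}_E=E\otimes_F\mathbb{A}_F$ with the involution induced by the non-trivial element of $\mathrm{Gal}(E/F)$, and the ring of matrices $A=\mathrm{M}(n,\mathbb{A}_E)$ with the involution $(a_{ij})^*=(a_{ji}^* )$. Then $A$ is $*$-Euclidean of decomposition length $1$.
   Context: A global field is a number field or a function field in one variable over a finite field. The involution on $\mathbb{A}_E=E\otimes_F\mathbb{A}_F$ is $\alpha\otimes\mathrm{id}$, with $\alpha$ the non-trivial element of $\mathrm{Gal}(E/F)$; at a place $v$ of $F$ it acts on $E_v=E\otimes_FF_v$ as the non-trivial Galois automorphism if $E_v$ is a field, and as the flip on $E_v\simeq F_v\times F_v$ otherwise. For a ring with involution $(A,* )$: $A^\times$ is the group of units and $A^{\mathrm{sym}}=\{a\in A: a^*=a\}$. $(A,* )$ is $*$-Euclidean if for all $a,c\in A$ with $Aa+Ac=A$ and $a^*c\in A^{\mathrm{sym}}$, setting $r_{-1}=a$, $r_0=c$, there exist an integer $m\ge1$ and elements $s_0,\dots,s_{m-1}\in A^{\mathrm{sym}}$, $r_1,\dots,r_{m-1}\in A$, $r_m\in A^\times$ such that $r_{i-1}=s_ir_i+r_{i+1}$ for $i=0,\dots,m-1$; $m$ is then a decomposition length of $(a,c)$, and the decomposition length of $A$ is the minimum $m$ valid for all such pairs. Thus decomposition length $1$ means: for every such pair $(a,c)$ there are $s\in A^{\mathrm{sym}}$ and $r\in A^\times$ with $a=sc+r$. *)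

theory Defs
  imports
    "HOL-Algebra.Algebra"
    "HOL-Algebra.Algebraic_Closure_Type"
    "HOL-Library.Poly_Mapping"
begin

text \<open>
  The base fields are types of class \<open>field\<close>, viewed as records through
  \<open>ring_of_type_algebra\<close>; all rings built from them (completions, adeles, tensor products,
  matrices) are HOL-Algebra rings.
\<close>

section \<open>Global fields and separable quadratic extensions\<close>

text \<open>\<open>generate_field _ {}\<close> is the prime field, in characteristic 0 a copy of the rationals.\<close>

definition number_field :: "'a::field itself \<Rightarrow> bool" where
  "number_field _ \<longleftrightarrow>
     CHAR('a) = 0 \<and>
     ring.finite_dimension (ring_of_type_algebra :: 'a ring)
       (generate_field ring_of_type_algebra {}) UNIV"

text \<open>Finite extensions of \<open>k(t)\<close>, with \<open>k\<close> a finite field and \<open>t\<close> transcendental over \<open>k\<close>.\<close>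

definition global_function_field :: "'a::field itself \<Rightarrow> bool" where
  "global_function_field _ \<longleftrightarrow>
     (\<exists>k t. subfield k (ring_of_type_algebra :: 'a ring) \<and> finite k \<and>
        ring.transcendental (ring_of_type_algebra :: 'a ring) k t \<and>
        ring.finite_dimension (ring_of_type_algebra :: 'a ring)
          (generate_field ring_of_type_algebra (insert t k)) UNIV)"

definition global_field :: "'a::field itself \<Rightarrow> bool" where
  "global_field T \<longleftrightarrow> number_field T \<or> global_function_field T"

text \<open>A field extension is given by its embedding \<open>\<iota> :: 'f \<Rightarrow> 'e\<close>.\<close>

definition field_extension :: "('f::field \<Rightarrow> 'e::field) \<Rightarrow> bool" where
  "field_extension \<iota> \<longleftrightarrow> \<iota> \<in> ring_hom ring_of_type_algebra ring_of_type_algebra"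

definition separable_extension :: "('f::field \<Rightarrow> 'e::field) \<Rightarrow> bool" where
  "separable_extension \<iota> \<longleftrightarrow>
     (\<forall>x. \<exists>p :: 'f poly. Factorial_Ring.irreducible p \<and>
        poly (map_poly \<iota> p) x = 0 \<and> coprime p (pderiv p))"

definition separable_quadratic_extension :: "('f::field \<Rightarrow> 'e::field) \<Rightarrow> bool" where
  "separable_quadratic_extension \<iota> \<longleftrightarrow>
     field_extension \<iota> \<and> separable_extension \<iota> \<and>
     ring.dimension (ring_of_type_algebra :: 'e ring) 2 (range \<iota>) UNIV"

definition galois_group :: "('f::field \<Rightarrow> 'e::field) \<Rightarrow> ('e \<Rightarrow> 'e) set" where
  "galois_group \<iota> =
     {\<sigma> \<in> ring_iso ring_of_type_algebra ring_of_type_algebra. \<forall>c. \<sigma> (\<iota> c) = \<iota> c}"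


section \<open>Places and completions\<close>

definition absolute_value :: "('a::field \<Rightarrow> real) \<Rightarrow> bool" where
  "absolute_value v \<longleftrightarrow>
     (\<forall>x. 0 \<le> v x) \<and> (\<forall>x. v x = 0 \<longleftrightarrow> x = 0) \<and>
     (\<forall>x y. v (x * y) = v x * v y) \<and> (\<forall>x y. v (x + y) \<le> v x + v y)"

definition nontrivial_absolute_values :: "('a::field \<Rightarrow> real) set" where
  "nontrivial_absolute_values = {v. absolute_value v \<and> (\<exists>x. x \<noteq> 0 \<and> v x \<noteq> 1)}"

definition abs_equiv :: "(('a::field \<Rightarrow> real) \<times> ('a \<Rightarrow> real)) set" where
  "abs_equiv = {(v, w) \<in> nontrivial_absolute_values \<times> nontrivial_absolute_values.
     \<exists>s>0. \<forall>x. w x = v x powr s}"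

definition places :: "('a::field \<Rightarrow> real) set set" where
  "places = nontrivial_absolute_values // abs_equiv"

text \<open>
  The completion at a place, its ring of integers and being nonarchimedean do not depend on the
  absolute value chosen in the class.
\<close>

definition place_abs :: "('a::field \<Rightarrow> real) set \<Rightarrow> 'a \<Rightarrow> real" where
  "place_abs P = (SOME v. v \<in> P)"

definition nonarchimedean :: "('a::field \<Rightarrow> real) set \<Rightarrow> bool" where
  "nonarchimedean P \<longleftrightarrow> (\<forall>x y. place_abs P (x + y) \<le> max (place_abs P x) (place_abs P y))"

definition cauchy_ring :: "('a::field \<Rightarrow> real) \<Rightarrow> (nat \<Rightarrow> 'a) ring" where
  "cauchy_ring v =
     \<lparr>carrier = {x. \<forall>e>0. \<exists>N. \<forall>m\<ge>N. \<forall>n\<ge>N. v (x m - x n) < e},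
      monoid.mult = (\<lambda>x y n. x n * y n), one = (\<lambda>_. 1),
      ring.zero = (\<lambda>_. 0), add = (\<lambda>x y n. x n + y n)\<rparr>"

definition null_sequences :: "('a::field \<Rightarrow> real) \<Rightarrow> (nat \<Rightarrow> 'a) set" where
  "null_sequences v = {x. (\<lambda>n. v (x n)) \<longlonglongrightarrow> 0}"

definition completion :: "('a::field \<Rightarrow> real) set \<Rightarrow> (nat \<Rightarrow> 'a) set ring" where
  "completion P = cauchy_ring (place_abs P) Quot null_sequences (place_abs P)"

definition completion_embed :: "('a::field \<Rightarrow> real) set \<Rightarrow> 'a \<Rightarrow> (nat \<Rightarrow> 'a) set" where
  "completion_embed P a =
     null_sequences (place_abs P) +>\<^bsub>cauchy_ring (place_abs P)\<^esub> (\<lambda>_. a)"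

definition completion_abs :: "('a::field \<Rightarrow> real) set \<Rightarrow> (nat \<Rightarrow> 'a) set \<Rightarrow> real" where
  "completion_abs P \<xi> = (THE r. \<forall>x\<in>\<xi>. (\<lambda>n. place_abs P (x n)) \<longlonglongrightarrow> r)"

definition local_integers :: "('a::field \<Rightarrow> real) set \<Rightarrow> (nat \<Rightarrow> 'a) set set" where
  "local_integers P = {\<xi> \<in> carrier (completion P). completion_abs P \<xi> \<le> 1}"


section \<open>The adele ring\<close>

text \<open>No integrality is imposed at the archimedean places.\<close>

definition adele_ring :: "(('a::field \<Rightarrow> real) set \<Rightarrow> (nat \<Rightarrow> 'a) set) ring" where
  "adele_ring =
     \<lparr>carrier = {x \<in> (\<Pi>\<^sub>E P\<in>places. carrier (completion P)).
        finite {P \<in> places. nonarchimedean P \<and> x P \<notin> local_integers P}},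
      monoid.mult = (\<lambda>x y. \<lambda>P\<in>places. x P \<otimes>\<^bsub>completion P\<^esub> y P),
      one = (\<lambda>P\<in>places. \<one>\<^bsub>completion P\<^esub>),
      ring.zero = (\<lambda>P\<in>places. \<zero>\<^bsub>completion P\<^esub>),
      add = (\<lambda>x y. \<lambda>P\<in>places. x P \<oplus>\<^bsub>completion P\<^esub> y P)\<rparr>"

definition adele_embed :: "'a::field \<Rightarrow> ('a \<Rightarrow> real) set \<Rightarrow> (nat \<Rightarrow> 'a) set" where
  "adele_embed a = (\<lambda>P\<in>places. completion_embed P a)"


section \<open>Tensor products of commutative algebras\<close>

text \<open>
  \<open>R \<otimes>\<^sub>K S\<close>, for \<open>K\<close>-algebras with structure maps \<open>i : K \<rightarrow> R\<close> and \<open>j : K \<rightarrow> S\<close>, is the free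
  abelian group on \<open>R \<times> S\<close> modulo the bilinearity relations. The free abelian group carries the
  product extending \<open>(x, y)(x', y') = (xx', yy')\<close> biadditively. The subgroup generated by the
  relations is stable under multiplication by generators, hence equal to the ideal they generate.
\<close>

definition free_ring_on_pairs ::
  "('r, 'm) ring_scheme \<Rightarrow> ('s, 'k) ring_scheme \<Rightarrow> (('r \<times> 's) \<Rightarrow>\<^sub>0 int) ring" where
  "free_ring_on_pairs R S =
     \<lparr>carrier = {f. Poly_Mapping.keys f \<subseteq> carrier R \<times> carrier S},
      monoid.mult = (\<lambda>f g. frag_extend (\<lambda>(x, y).
        frag_extend (\<lambda>(x', y'). frag_of (x \<otimes>\<^bsub>R\<^esub> x', y \<otimes>\<^bsub>S\<^esub> y')) g) f),
      one = frag_of (\<one>\<^bsub>R\<^esub>, \<one>\<^bsub>S\<^esub>), ring.zero = 0, add = (+)\<rparr>"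

definition tensor_ideal ::
  "('c, 'l) ring_scheme \<Rightarrow> ('r, 'm) ring_scheme \<Rightarrow> ('s, 'k) ring_scheme \<Rightarrow>
   ('c \<Rightarrow> 'r) \<Rightarrow> ('c \<Rightarrow> 's) \<Rightarrow> (('r \<times> 's) \<Rightarrow>\<^sub>0 int) set" where
  "tensor_ideal K R S i j = Idl\<^bsub>free_ring_on_pairs R S\<^esub>
    ({frag_of (x \<oplus>\<^bsub>R\<^esub> x', y) - frag_of (x, y) - frag_of (x', y) | x x' y.
        x \<in> carrier R \<and> x' \<in> carrier R \<and> y \<in> carrier S} \<union>
     {frag_of (x, y \<oplus>\<^bsub>S\<^esub> y') - frag_of (x, y) - frag_of (x, y') | x y y'.
        x \<in> carrier R \<and> y \<in> carrier S \<and> y' \<in> carrier S} \<union>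
     {frag_of (i c \<otimes>\<^bsub>R\<^esub> x, y) - frag_of (x, j c \<otimes>\<^bsub>S\<^esub> y) | c x y.
        c \<in> carrier K \<and> x \<in> carrier R \<and> y \<in> carrier S})"

definition tensor_ring ::
  "('c, 'l) ring_scheme \<Rightarrow> ('r, 'm) ring_scheme \<Rightarrow> ('s, 'k) ring_scheme \<Rightarrow>
   ('c \<Rightarrow> 'r) \<Rightarrow> ('c \<Rightarrow> 's) \<Rightarrow> (('r \<times> 's) \<Rightarrow>\<^sub>0 int) set ring" where
  "tensor_ring K R S i j = free_ring_on_pairs R S Quot tensor_ideal K R S i j"

text \<open>
  The endomorphism \<open>\<phi> \<otimes> \<psi>\<close>. For \<open>K\<close>-linear \<open>\<phi>\<close>, \<open>\<psi>\<close> the cosets in the union coincide.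
\<close>

definition tensor_map ::
  "('c, 'l) ring_scheme \<Rightarrow> ('r, 'm) ring_scheme \<Rightarrow> ('s, 'k) ring_scheme \<Rightarrow>
   ('c \<Rightarrow> 'r) \<Rightarrow> ('c \<Rightarrow> 's) \<Rightarrow> ('r \<Rightarrow> 'r) \<Rightarrow> ('s \<Rightarrow> 's) \<Rightarrow>
   (('r \<times> 's) \<Rightarrow>\<^sub>0 int) set \<Rightarrow> (('r \<times> 's) \<Rightarrow>\<^sub>0 int) set" where
  "tensor_map K R S i j \<phi> \<psi> C =
     (\<Union>f\<in>C. tensor_ideal K R S i j +>\<^bsub>free_ring_on_pairs R S\<^esub>
       frag_extend (\<lambda>(x, y). frag_of (\<phi> x, \<psi> y)) f)"

text \<open>\<open>\<bbbA>\<^sub>E = E \<otimes>\<^sub>F \<bbbA>\<^sub>F\<close> with the involution \<open>\<alpha> \<otimes> id\<close>.\<close>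

definition extended_adele_ring ::
  "('f::field \<Rightarrow> 'e::field) \<Rightarrow>
   (('e \<times> (('f \<Rightarrow> real) set \<Rightarrow> (nat \<Rightarrow> 'f) set)) \<Rightarrow>\<^sub>0 int) set ring" where
  "extended_adele_ring \<iota> =
     tensor_ring ring_of_type_algebra ring_of_type_algebra adele_ring \<iota> adele_embed"

definition adele_involution ::
  "('f::field \<Rightarrow> 'e::field) \<Rightarrow> ('e \<Rightarrow> 'e) \<Rightarrow>
   (('e \<times> (('f \<Rightarrow> real) set \<Rightarrow> (nat \<Rightarrow> 'f) set)) \<Rightarrow>\<^sub>0 int) set \<Rightarrow>
   (('e \<times> (('f \<Rightarrow> real) set \<Rightarrow> (nat \<Rightarrow> 'f) set)) \<Rightarrow>\<^sub>0 int) set" where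
  "adele_involution \<iota> \<alpha> =
     tensor_map ring_of_type_algebra ring_of_type_algebra adele_ring \<iota> adele_embed \<alpha> id"


section \<open>Matrix rings\<close>

definition matrix_ring :: "nat \<Rightarrow> ('r, 'm) ring_scheme \<Rightarrow> (nat \<times> nat \<Rightarrow> 'r) ring" where
  "matrix_ring n R =
     \<lparr>carrier = {..<n} \<times> {..<n} \<rightarrow>\<^sub>E carrier R,
      monoid.mult = (\<lambda>a b. \<lambda>(i, j)\<in>{..<n} \<times> {..<n}. \<Oplus>\<^bsub>R\<^esub>k\<in>{..<n}. a (i, k) \<otimes>\<^bsub>R\<^esub> b (k, j)),
      one = (\<lambda>(i, j)\<in>{..<n} \<times> {..<n}. if i = j then \<one>\<^bsub>R\<^esub> else \<zero>\<^bsub>R\<^esub>),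
      ring.zero = (\<lambda>(i, j)\<in>{..<n} \<times> {..<n}. \<zero>\<^bsub>R\<^esub>),
      add = (\<lambda>a b. \<lambda>(i, j)\<in>{..<n} \<times> {..<n}. a (i, j) \<oplus>\<^bsub>R\<^esub> b (i, j))\<rparr>"

definition matrix_star :: "nat \<Rightarrow> ('r \<Rightarrow> 'r) \<Rightarrow> (nat \<times> nat \<Rightarrow> 'r) \<Rightarrow> nat \<times> nat \<Rightarrow> 'r" where
  "matrix_star n star a = (\<lambda>(i, j)\<in>{..<n} \<times> {..<n}. star (a (j, i)))"


section \<open>Star-Euclidean rings\<close>

locale ring_with_involution = ring A for A (structure) +
  fixes star :: "'a \<Rightarrow> 'a"
  assumes star_closed: "a \<in> carrier A \<Longrightarrow> star a \<in> carrier A"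
    and star_add: "\<lbrakk>a \<in> carrier A; b \<in> carrier A\<rbrakk> \<Longrightarrow> star (a \<oplus> b) = star a \<oplus> star b"
    and star_mult: "\<lbrakk>a \<in> carrier A; b \<in> carrier A\<rbrakk> \<Longrightarrow> star (a \<otimes> b) = star b \<otimes> star a"
    and star_star: "a \<in> carrier A \<Longrightarrow> star (star a) = a"

definition sym_elements :: "('a, 'm) ring_scheme \<Rightarrow> ('a \<Rightarrow> 'a) \<Rightarrow> 'a set" where
  "sym_elements A star = {a \<in> carrier A. star a = a}"

definition coprime_sym_pair :: "('a, 'm) ring_scheme \<Rightarrow> ('a \<Rightarrow> 'a) \<Rightarrow> 'a \<Rightarrow> 'a \<Rightarrow> bool" where
  "coprime_sym_pair A star a c \<longleftrightarrow>
     a \<in> carrier A \<and> c \<in> carrier A \<and>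
     {x \<otimes>\<^bsub>A\<^esub> a \<oplus>\<^bsub>A\<^esub> y \<otimes>\<^bsub>A\<^esub> c | x y. x \<in> carrier A \<and> y \<in> carrier A} = carrier A \<and>
     star a \<otimes>\<^bsub>A\<^esub> c \<in> sym_elements A star"

definition is_pair_decomposition_length ::
  "('a, 'm) ring_scheme \<Rightarrow> ('a \<Rightarrow> 'a) \<Rightarrow> 'a \<Rightarrow> 'a \<Rightarrow> nat \<Rightarrow> bool" where
  "is_pair_decomposition_length A star a c m \<longleftrightarrow>
     1 \<le> m \<and>
     (\<exists>(s :: nat \<Rightarrow> 'a) (r :: int \<Rightarrow> 'a).
        r (-1) = a \<and> r 0 = c \<and>
        (\<forall>i<m. s i \<in> sym_elements A star) \<and>
        (\<forall>i. 1 \<le> i \<and> i < int m \<longrightarrow> r i \<in> carrier A) \<and>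
        r (int m) \<in> Units A \<and>
        (\<forall>i<m. r (int i - 1) = s i \<otimes>\<^bsub>A\<^esub> r (int i) \<oplus>\<^bsub>A\<^esub> r (int i + 1)))"

definition star_euclidean :: "('a, 'm) ring_scheme \<Rightarrow> ('a \<Rightarrow> 'a) \<Rightarrow> bool" where
  "star_euclidean A star \<longleftrightarrow>
     ring_with_involution A star \<and>
     (\<forall>a c. coprime_sym_pair A star a c \<longrightarrow> (\<exists>m. is_pair_decomposition_length A star a c m))"

definition is_uniform_decomposition_length ::
  "('a, 'm) ring_scheme \<Rightarrow> ('a \<Rightarrow> 'a) \<Rightarrow> nat \<Rightarrow> bool" where
  "is_uniform_decomposition_length A star m \<longleftrightarrow>
     1 \<le> m \<and> (\<forall>a c. coprime_sym_pair A star a c \<longrightarrow> is_pair_decomposition_length A star a c m)"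

definition has_decomposition_length :: "('a, 'm) ring_scheme \<Rightarrow> ('a \<Rightarrow> 'a) \<Rightarrow> nat \<Rightarrow> bool" where
  "has_decomposition_length A star m \<longleftrightarrow>
     is_uniform_decomposition_length A star m \<and>
     (\<forall>k. is_uniform_decomposition_length A star k \<longrightarrow> m \<le> k)"

end

theory Submission
  imports Defs "Jordan_Normal_Form.Determinant"
begin

text \<open>
  Write \<open>R\<close> for the adele ring of \<open>F\<close>, \<open>B = E \<otimes> R\<close>, and \<open>N b = b b\<^sup>*\<close>. Since \<open>E = F + F \<theta>\<close> with
  \<open>\<theta> + \<theta>\<^sup>*\<close> and \<open>\<theta> \<theta>\<^sup>*\<close> in \<open>F\<close>, every norm \<open>N b\<close> lies in \<open>R\<close>. Let \<open>(a, c)\<close> be an admissible pair of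
  matrices, \<open>x a + y c = 1\<close> and \<open>a\<^sup>* c\<close> hermitian, and put \<open>f(s) = det (a - s c)\<close>. A hermitian \<open>s\<close> with
  \<open>f(s)\<close> invertible is what decomposition length \<open>1\<close> asks for, and \<open>f(s)\<close> is invertible as soon as
  \<open>N f(s)\<close> is.

  Adeles can be glued place by place. Given \<open>p\<close> and \<open>q\<close> in \<open>R\<close>, let the idempotent \<open>z\<close> be \<open>1\<close> at the
  places where \<open>|p|\<close> is at least \<open>|q|\<close> and \<open>0\<close> elsewhere; then \<open>z p + (1 - z) q\<close> divides both \<open>p\<close> and \<open>q\<close>,
  with quotients of absolute value at most \<open>1\<close> everywhere (\<open>adele_patching\<close>). Gluing hermitian
  matrices along \<open>z\<close> glues the values of \<open>N f\<close>. Hence the elements that are divisible by some \<open>N f(s)\<close>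
  form an ideal \<open>J\<close> of \<open>B\<close>, and it suffices to see that the radical of \<open>J\<close> contains \<open>1\<close>.

  This is algebra over any commutative ring with involution (\<open>hermitian_shift_norm_dvd\<close>). First,
  the symmetry of \<open>a\<^sup>* c\<close> makes \<open>f(s)\<^sup>*\<close> a divisor of a power of \<open>f(s)\<close> (\<open>star_det_dvd_power\<close>), so
  that \<open>f(s)\<close> is in the radical of \<open>J\<close>. Second, all \<open>f(s)\<close> together generate the unit ideal
  (\<open>det_hermitian_shifts_generate\<close>): comparing \<open>f\<close> at \<open>s\<close> and at \<open>s + \<lambda> E\<^sub>i\<^sub>k + \<lambda>\<^sup>* E\<^sub>k\<^sub>i\<close> for
  \<open>\<lambda> = 1, \<kappa>, \<theta>\<close>, with \<open>\<kappa>\<close> in \<open>F\<close> different from \<open>0\<close> and \<open>1\<close>, puts the determinants in which some rows of \<open>a\<close> are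
  replaced by rows of \<open>c\<close> into the ideal, hence all maximal minors of the matrix with rows \<open>a\<close> and \<open>c\<close>,
  of which \<open>det (x a + y c) = 1\<close> is a combination.

  Two further ingredients connect this with the actual rings. Determinants exist for types of
  class \<open>comm_ring_1\<close>, whereas \<open>B\<close> is a ring on a carrier set; therefore \<open>B\<close> is exhibited as a factor
  of one big ring that is a type (\<open>cring_product\<close>), and the algebra is done there. And \<open>F\<close> maps to \<open>R\<close>
  only because an element of a global field has finitely many poles
  (\<open>global_field_finite_poles\<close>). The main point there is that an absolute value of \<open>\<rat>\<close> or \<open>k(t)\<close> has, up to
  equivalence, at most \<open>m\<close> extensions to a field of degree \<open>m\<close>: elements that separate inequivalent
  extensions from each other are linearly independent over the base.
\<close>

section \<open>Determinants and ideals\<close>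

text \<open>
  A matrix is given by its rows as functions, so that rows are replaced by function update.
\<close>

definition row_det :: "nat \<Rightarrow> (nat \<Rightarrow> nat \<Rightarrow> 'a::comm_ring_1) \<Rightarrow> 'a" where
  "row_det n R = det (mat n n (\<lambda>(i, j). R i j))"

lemma row_det_cong: "(\<And>i j. i < n \<Longrightarrow> j < n \<Longrightarrow> R i j = S i j) \<Longrightarrow> row_det n R = row_det n S"
  unfolding row_det_def by (rule arg_cong[where f = det], rule eq_matI) auto

lemma row_det_linear:
  assumes "i < n"
  shows "row_det n (R(i := (\<lambda>j. u j - l * w j))) = row_det n (R(i := u)) - l * row_det n (R(i := w))"
proof -
  have expand: "row_det n (R(i := v)) = (\<Sum>j<n. v j * cofactor (mat n n (\<lambda>(i, j). R i j)) i j)" for v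
  proof -
    let ?M = "mat n n (\<lambda>(p, q). (R(i := v)) p q)"
    have "row_det n (R(i := v)) = (\<Sum>j<n. ?M $$ (i, j) * cofactor ?M i j)"
      unfolding row_det_def by (rule laplace_expansion_row) (use assms in auto)
    also have "\<dots> = (\<Sum>j<n. v j * cofactor (mat n n (\<lambda>(i, j). R i j)) i j)"
    proof (rule sum.cong[OF refl])
      fix j assume "j \<in> {..<n}"
      have "mat_delete ?M i j = mat_delete (mat n n (\<lambda>(i, j). R i j)) i j"
        unfolding mat_delete_def by (rule eq_matI) (use assms in \<open>auto split: if_splits\<close>)
      then show "?M $$ (i, j) * cofactor ?M i j = v j * cofactor (mat n n (\<lambda>(i, j). R i j)) i j"
        using \<open>j \<in> {..<n}\<close> assms by (simp add: cofactor_def)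
    qed
    finally show ?thesis .
  qed
  show ?thesis
    unfolding expand by (simp add: algebra_simps sum_subtractf sum_distrib_left)
qed

lemma row_det_equal_rows:
  assumes "i < n" "k < n" "i \<noteq> k" "\<And>j. j < n \<Longrightarrow> R i j = R k j"
  shows "row_det n R = 0"
  unfolding row_det_def
  by (rule det_identical_rows[of _ n i k]) (use assms in \<open>auto intro!: eq_vecI\<close>)

lemma row_det_swap:
  assumes "i < n" "k < n" "i \<noteq> k"
  shows "row_det n (R(i := R k, k := R i)) = - row_det n R"
proof -
  have "mat n n (\<lambda>(p, q). (R(i := R k, k := R i)) p q) = swaprows i k (mat n n (\<lambda>(p, q). R p q))"
    by (rule eq_matI) (use assms in auto)
  then show ?thesis
    unfolding row_det_def using det_swaprows[of i n k "mat n n (\<lambda>(p, q). R p q)"] assms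
    by (simp del: fun_upd_apply)
qed

locale ring_type_ideal =
  fixes J :: "'a::comm_ring_1 set"
  assumes zero_mem: "0 \<in> J"
    and add_mem: "x \<in> J \<Longrightarrow> y \<in> J \<Longrightarrow> x + y \<in> J"
    and mult_mem: "x \<in> J \<Longrightarrow> r * x \<in> J"
begin

lemma minus_mem: "x \<in> J \<Longrightarrow> - x \<in> J"
  using mult_mem[of x "- 1"] by simp

lemma diff_mem: "x \<in> J \<Longrightarrow> y \<in> J \<Longrightarrow> x - y \<in> J"
  using add_mem[of x "- y"] minus_mem by simp

lemma sum_mem: "(\<And>i. i \<in> I \<Longrightarrow> f i \<in> J) \<Longrightarrow> sum f I \<in> J"
  by (induction I rule: infinite_finite_induct) (auto intro: zero_mem add_mem)

lemma power_add_mem: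
  assumes "x ^ k \<in> J" "y ^ l \<in> J"
  shows "(x + y) ^ (k + l) \<in> J"
proof -
  have "of_nat (k + l choose i) * x ^ i * y ^ (k + l - i) \<in> J" if "i \<le> k + l" for i
  proof (cases "k \<le> i")
    case True
    then have "x ^ i = x ^ (i - k) * x ^ k"
      by (simp flip: power_add)
    then have "of_nat (k + l choose i) * x ^ i * y ^ (k + l - i)
        = of_nat (k + l choose i) * x ^ (i - k) * y ^ (k + l - i) * x ^ k"
      by (simp add: ac_simps)
    then show ?thesis using mult_mem[OF assms(1)] by simp
  next
    case False
    then have "y ^ (k + l - i) = y ^ (k - i) * y ^ l"
      by (simp flip: power_add)
    then show ?thesis using mult_mem[OF assms(2)] by (simp add: mult.assoc[symmetric])
  qed
  then show ?thesis
    unfolding binomial_ring by (intro sum_mem) auto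
qed

lemma radical_ideal: "ring_type_ideal {x. \<exists>k. x ^ k \<in> J}"
proof
  show "0 \<in> {x. \<exists>k. x ^ k \<in> J}"
    using zero_mem by (auto intro: exI[of _ 1])
  show "x + y \<in> {x. \<exists>k. x ^ k \<in> J}" if "x \<in> {x. \<exists>k. x ^ k \<in> J}" "y \<in> {x. \<exists>k. x ^ k \<in> J}" for x y
    using that power_add_mem by blast
  show "r * x \<in> {x. \<exists>k. x ^ k \<in> J}" if "x \<in> {x. \<exists>k. x ^ k \<in> J}" for r x
    using that mult_mem by (auto simp: power_mult_distrib)
qed

text \<open>
  Up to sign a minor of the stacked matrix has each of its \<open>a\<close>-rows in the position that it has in
  \<open>a\<close>: an \<open>a\<close>-row in a wrong position is either repeated, and the minor vanishes, or it can be swapped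
  into its own position, which leaves fewer misplaced rows.
\<close>

lemma stacked_minors_mem:
  fixes a c :: "nat \<Rightarrow> nat \<Rightarrow> 'a" and n :: nat
  defines "stack k \<equiv> if k < n then a k else c (k - n)"
  assumes mixed: "\<And>\<rho>. (\<And>i k. i < n \<Longrightarrow> \<rho> i = Some k \<Longrightarrow> k < n) \<Longrightarrow>
      row_det n (\<lambda>i. case \<rho> i of None \<Rightarrow> a i | Some k \<Rightarrow> c k) \<in> J"
    and \<rho>: "\<And>i. i < n \<Longrightarrow> \<rho> i < 2 * n"
  shows "row_det n (\<lambda>i. stack (\<rho> i)) \<in> J"
  using \<rho>
proof (induction "card {i. i < n \<and> \<rho> i < n \<and> \<rho> i \<noteq> i}" arbitrary: \<rho> rule: less_induct)
  case less
  show ?case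
  proof (cases "\<exists>i<n. \<rho> i < n \<and> \<rho> i \<noteq> i")
    case False
    have "row_det n (\<lambda>i. stack (\<rho> i)) =
        row_det n (\<lambda>i. case (if \<rho> i < n then None else Some (\<rho> i - n)) of None \<Rightarrow> a i | Some k \<Rightarrow> c k)"
      by (rule row_det_cong) (use False in \<open>auto simp: stack_def\<close>)
    also have "\<dots> \<in> J"
      by (rule mixed) (use less.prems in \<open>fastforce split: if_splits\<close>)
    finally show ?thesis .
  next
    case True
    then obtain i where i: "i < n" "\<rho> i < n" "\<rho> i \<noteq> i" by blast
    define k where "k = \<rho> i"
    show ?thesis
    proof (cases "\<rho> k = k")
      case True
      then have "row_det n (\<lambda>i. stack (\<rho> i)) = 0"
        by (intro row_det_equal_rows[of i n k]) (use i in \<open>auto simp: k_def\<close>)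
      then show ?thesis using zero_mem by simp
    next
      case False
      define \<rho>' where "\<rho>' = \<rho>(i := \<rho> k, k := \<rho> i)"
      let ?bad = "\<lambda>\<rho>. {i. i < n \<and> \<rho> i < n \<and> \<rho> i \<noteq> i}"
      have "?bad \<rho>' \<subseteq> (if \<rho> k < n then ?bad \<rho> - {k} else ?bad \<rho> - {i})" and "k < n"
        using i False by (auto simp: \<rho>'_def k_def split: if_splits)
      moreover have "i \<in> ?bad \<rho>" "\<rho> k < n \<Longrightarrow> k \<in> ?bad \<rho>"
        using i False by (auto simp: k_def)
      ultimately have "?bad \<rho>' \<subset> ?bad \<rho>"
        by (auto split: if_splits)
      then have "card (?bad \<rho>') < card (?bad \<rho>)"
        by (intro psubset_card_mono) auto
      then have "row_det n (\<lambda>i. stack (\<rho>' i)) \<in> J"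
        by (rule less.hyps) (use less.prems i \<open>k < n\<close> in \<open>auto simp: \<rho>'_def\<close>)
      moreover have "(\<lambda>i. stack (\<rho>' i)) = (\<lambda>i. stack (\<rho> i))(i := stack (\<rho> k), k := stack (\<rho> i))"
        by (auto simp: \<rho>'_def)
      ultimately have "- row_det n (\<lambda>i. stack (\<rho> i)) \<in> J"
        using row_det_swap[of i n k "\<lambda>i. stack (\<rho> i)"] i \<open>k < n\<close> by (simp add: k_def)
      then show ?thesis using minus_mem by fastforce
    qed
  qed
qed

text \<open>
  One half of the Cauchy--Binet formula, in the form needed for ideals.
\<close>

lemma det_mem_of_stacked_minors:
  fixes R :: "nat \<Rightarrow> nat \<Rightarrow> 'a"
  assumes minors: "\<And>\<rho>. (\<And>i. i < n \<Longrightarrow> \<rho> i < m) \<Longrightarrow> row_det n (\<lambda>i. R (\<rho> i)) \<in> J"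
  shows "row_det n (\<lambda>i j. \<Sum>k<m. x i k * R k j) \<in> J"
proof -
  let ?v = "\<lambda>i k. x i k \<cdot>\<^sub>v vec n (R k)"
  have "mat n n (\<lambda>(i, j). \<Sum>k<m. x i k * R k j) = mat\<^sub>r n n (\<lambda>i. finsum_vec TYPE('a) n (?v i) {..<m})"
    by (rule eq_matI) (auto simp: index_finsum_vec)
  then have "row_det n (\<lambda>i j. \<Sum>k<m. x i k * R k j) =
      (\<Sum>f | (\<forall>i\<in>{0..<n}. f i \<in> {..<m}) \<and> (\<forall>i. i \<notin> {0..<n} \<longrightarrow> f i = i).
        det (mat\<^sub>r n n (\<lambda>i. ?v i (f i))))"
    unfolding row_det_def by (simp only:) (rule det_linear_rows_sum; auto)
  also have "\<dots> \<in> J"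
  proof (rule sum_mem)
    fix f assume f: "f \<in> {f. (\<forall>i\<in>{0..<n}. f i \<in> {..<m}) \<and> (\<forall>i. i \<notin> {0..<n} \<longrightarrow> f i = i)}"
    have "det (mat\<^sub>r n n (\<lambda>i. ?v i (f i))) =
        (\<Prod>i\<in>{0..<n}. x i (f i)) * det (mat\<^sub>r n n (\<lambda>i. vec n (R (f i))))"
      by (rule det_rows_mul) auto
    also have "mat\<^sub>r n n (\<lambda>i. vec n (R (f i))) = mat n n (\<lambda>(i, j). R (f i) j)"
      by (rule eq_matI) auto
    finally show "det (mat\<^sub>r n n (\<lambda>i. ?v i (f i))) \<in> J"
      using mult_mem[OF minors[of f]] f by (simp add: row_det_def)
  qed
  finally show ?thesis .
qed

end

locale star_type =
  fixes star :: "'a::comm_ring_1 \<Rightarrow> 'a"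
  assumes star_add: "star (x + y) = star x + star y"
    and star_mult: "star (x * y) = star x * star y"
    and star_star: "star (star x) = x"
begin

lemma star_one: "star 1 = 1"
  by (metis mult.right_neutral mult.left_neutral star_mult star_star)

lemma star_zero: "star 0 = 0"
  by (metis add_cancel_right_right star_add)

sublocale star_hom: comm_ring_hom star
  by unfold_locales (simp_all add: star_add star_mult star_one star_zero)

definition adjoint :: "'a mat \<Rightarrow> 'a mat" where
  "adjoint A = map_mat star (transpose_mat A)"

lemma adjoint_carrier [simp]: "A \<in> carrier_mat n m \<Longrightarrow> adjoint A \<in> carrier_mat m n"
  by (simp add: adjoint_def)

lemma adjoint_mult:
  "A \<in> carrier_mat n m \<Longrightarrow> B \<in> carrier_mat m k \<Longrightarrow> adjoint (A * B) = adjoint B * adjoint A"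
  unfolding adjoint_def by (simp add: transpose_mult star_hom.mat_hom_mult[of _ k m _ n])

lemma adjoint_adjoint [simp]: "adjoint (adjoint A) = A"
  by (rule eq_matI) (auto simp: adjoint_def star_star)

lemma adjoint_minus:
  "A \<in> carrier_mat n m \<Longrightarrow> B \<in> carrier_mat n m \<Longrightarrow> adjoint (A - B) = adjoint A - adjoint B"
  by (rule eq_matI) (auto simp: adjoint_def star_hom.hom_minus)

lemma adjoint_add:
  "A \<in> carrier_mat n m \<Longrightarrow> B \<in> carrier_mat n m \<Longrightarrow> adjoint (A + B) = adjoint A + adjoint B"
  by (rule eq_matI) (auto simp: adjoint_def star_add)

lemma adjoint_one [simp]: "adjoint (1\<^sub>m n) = 1\<^sub>m n"
  by (rule eq_matI) (auto simp: adjoint_def star_one star_zero)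

lemma det_adjoint: "A \<in> carrier_mat n n \<Longrightarrow> det (adjoint A) = star (det A)"
  by (simp add: adjoint_def det_transpose)

definition hermitian :: "nat \<Rightarrow> 'a mat \<Rightarrow> bool" where
  "hermitian n S \<longleftrightarrow> S \<in> carrier_mat n n \<and> adjoint S = S"

lemma hermitian_entry: "hermitian n S \<Longrightarrow> i < n \<Longrightarrow> j < n \<Longrightarrow> star (S $$ (i, j)) = S $$ (j, i)"
  unfolding hermitian_def adjoint_def
  by (metis carrier_matD index_map_mat(1) index_transpose_mat(1,2,3))

lemma hermitian_matI:
  "(\<And>i j. i < n \<Longrightarrow> j < n \<Longrightarrow> star (f j i) = f i j) \<Longrightarrow> hermitian n (mat n n (\<lambda>(i, j). f i j))"
  unfolding hermitian_def adjoint_def by (auto intro!: eq_matI)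

text \<open>
  The entries of a hermitian matrix are not independent, so a shift \<open>s + l E\<^sub>i\<^sub>k + l\<^sup>* E\<^sub>k\<^sub>i\<close> changes the rows
  \<open>i\<close> and \<open>k\<close> at the same time and the determinant by \<open>- l D\<^sub>i - l\<^sup>* D\<^sub>k + l l\<^sup>* D\<^sub>i\<^sub>k\<close>, where the indices tell
  which rows have become rows of \<open>c\<close>. The values at \<open>l = 1, \<kappa>, \<theta>\<close> determine \<open>D\<^sub>i\<close> up to the factors
  \<open>\<kappa>\<^sup>2 - \<kappa>\<close> and \<open>\<theta>\<^sup>* - \<theta>\<close>, which may be cancelled modulo \<open>J\<close>. So rows of \<open>a\<close> can be turned into rows of \<open>c\<close>
  one by one. When row \<open>k\<close> is already a row of \<open>c\<close>, or \<open>k = i\<close>, only row \<open>i\<close> changes.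
\<close>

lemma mixed_minors_mem:
  fixes a c :: "nat \<Rightarrow> nat \<Rightarrow> 'a" and n :: nat
  assumes "ring_type_ideal J"
    and \<kappa>: "star \<kappa> = \<kappa>" "\<And>w. (\<kappa> * \<kappa> - \<kappa>) * w \<in> J \<Longrightarrow> w \<in> J"
    and \<theta>: "\<And>w. (star \<theta> - \<theta>) * w \<in> J \<Longrightarrow> w \<in> J"
    and shifts: "\<And>s. (\<And>i j. star (s j i) = s i j) \<Longrightarrow>
      row_det n (\<lambda>i j. a i j - (\<Sum>k<n. s i k * c k j)) \<in> J"
    and \<rho>: "\<And>i k. i < n \<Longrightarrow> \<rho> i = Some k \<Longrightarrow> k < n"
    and s: "\<And>i j. star (s j i) = s i j"
  shows "row_det n (\<lambda>i. case \<rho> i of None \<Rightarrow> (\<lambda>j. a i j - (\<Sum>k<n. s i k * c k j)) | Some k \<Rightarrow> c k) \<in> J"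
  using \<rho> s
proof (induction "card {i. i < n \<and> \<rho> i \<noteq> None}" arbitrary: \<rho> s rule: less_induct)
  case less
  interpret ring_type_ideal J by fact
  define rows where
    "rows \<rho> s = (\<lambda>i. case \<rho> i of None \<Rightarrow> (\<lambda>j. a i j - (\<Sum>k<n. s i k * c k j)) | Some k \<Rightarrow> c k)"
    for \<rho> :: "nat \<Rightarrow> nat option" and s
  show ?case
  proof (cases "\<exists>i<n. \<rho> i \<noteq> None")
    case False
    then have "row_det n (rows \<rho> s) = row_det n (\<lambda>i j. a i j - (\<Sum>k<n. s i k * c k j))"
      by (intro row_det_cong) (auto simp: rows_def)
    then show ?thesis using shifts[OF less.prems(2)] by (simp add: rows_def)
  next
    case True
    then obtain i k where i: "i < n" "\<rho> i = Some k" by blast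
    then have k: "k < n" using less.prems by blast
    define \<rho>' where "\<rho>' = \<rho>(i := None)"
    have "{p. p < n \<and> \<rho>' p \<noteq> None} \<subset> {p. p < n \<and> \<rho> p \<noteq> None}"
      using i by (auto simp: \<rho>'_def)
    then have "card {p. p < n \<and> \<rho>' p \<noteq> None} < card {p. p < n \<and> \<rho> p \<noteq> None}"
      by (intro psubset_card_mono) auto
    then have IH: "row_det n (rows \<rho>' s') \<in> J" if "\<And>i j. star (s' j i) = s' i j" for s'
      unfolding rows_def
      by (rule less.hyps) (use less.prems that in \<open>auto simp: \<rho>'_def split: if_splits\<close>)
    define R where "R = rows \<rho>' s"
    have R: "row_det n R \<in> J" using IH[OF less.prems(2)] by (simp add: R_def)
    have target: "rows \<rho> s = R(i := c k)"
      using i by (auto simp: R_def rows_def \<rho>'_def)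
    have "row_det n (R(i := c k)) \<in> J"
    proof (cases "k = i \<or> \<rho>' k \<noteq> None")
      case True
      define s' where "s' p q = s p q + (if p = i \<and> q = k \<or> p = k \<and> q = i then 1 else 0)" for p q
      have "star (s' q p) = s' p q" for p q
        using less.prems(2) by (auto simp: s'_def star_add star_one star_zero)
      then have "row_det n (rows \<rho>' s') \<in> J" by (rule IH)
      moreover have "rows \<rho>' s' = R(i := (\<lambda>j. R i j - 1 * c k j))"
      proof (intro ext)
        fix p j
        have *: "(\<Sum>q<n. s' p q * c q j) = (\<Sum>q<n. s p q * c q j) + c k j" if "p = i"
        proof -
          have "(\<Sum>q<n. s' p q * c q j) = (\<Sum>q<n. s p q * c q j + (if q = k then c q j else 0))"
            by (rule sum.cong) (use that in \<open>auto simp: s'_def algebra_simps\<close>)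
          then show ?thesis using k by (simp add: sum.distrib)
        qed
        have **: "(\<Sum>q<n. s' p q * c q j) = (\<Sum>q<n. s p q * c q j)" if "p \<noteq> i" "p \<noteq> k"
          by (rule sum.cong) (use that in \<open>auto simp: s'_def\<close>)
        show "rows \<rho>' s' p j = (R(i := (\<lambda>j. R i j - 1 * c k j))) p j"
          using True * ** by (cases "p = k") (auto simp: rows_def R_def \<rho>'_def split: option.splits)
      qed
      ultimately have "row_det n (R(i := R i)) - 1 * row_det n (R(i := c k)) \<in> J"
        using row_det_linear[OF i(1), of R "R i" 1 "c k"] by simp
      then have "row_det n R - row_det n (R(i := c k)) \<in> J" by simp
      from diff_mem[OF R this] show ?thesis by simp
    next
      case False
      then have ki: "k \<noteq> i" "\<rho>' k = None" by auto
      define Di Dk Dik where "Di = row_det n (R(i := c k))" and "Dk = row_det n (R(k := c i))"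
        and "Dik = row_det n (R(i := c k, k := c i))"
      have shift: "l * Di + star l * Dk - l * star l * Dik \<in> J" for l
      proof -
        define s' where "s' p q = s p q + (if p = i \<and> q = k then l else 0)
            + (if p = k \<and> q = i then star l else 0)" for p q
        have "star (s' q p) = s' p q" for p q
          using ki(1) by (cases "p = i"; cases "q = k"; cases "p = k"; cases "q = i")
            (simp_all add: s'_def star_add star_star less.prems(2))
        then have "row_det n (rows \<rho>' s') \<in> J" by (rule IH)
        moreover have "rows \<rho>' s' = R(i := (\<lambda>j. R i j - l * c k j), k := (\<lambda>j. R k j - star l * c i j))"
        proof (intro ext)
          fix p j
          have row_i: "(\<Sum>q<n. s' p q * c q j) = (\<Sum>q<n. s p q * c q j) + l * c k j" if "p = i"
          proof -
            have "(\<Sum>q<n. s' p q * c q j) = (\<Sum>q<n. s p q * c q j + (if q = k then l * c q j else 0))"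
              by (rule sum.cong) (use that ki in \<open>simp_all add: s'_def distrib_right\<close>)
            then show ?thesis using k by (simp add: sum.distrib)
          qed
          have row_k: "(\<Sum>q<n. s' p q * c q j) = (\<Sum>q<n. s p q * c q j) + star l * c i j" if "p = k"
          proof -
            have "(\<Sum>q<n. s' p q * c q j) = (\<Sum>q<n. s p q * c q j + (if q = i then star l * c q j else 0))"
              by (rule sum.cong) (use that ki in \<open>simp_all add: s'_def distrib_right\<close>)
            then show ?thesis using i by (simp add: sum.distrib)
          qed
          have row_other: "(\<Sum>q<n. s' p q * c q j) = (\<Sum>q<n. s p q * c q j)" if "p \<noteq> i" "p \<noteq> k"
            by (rule sum.cong) (use that in \<open>auto simp: s'_def\<close>)
          show "rows \<rho>' s' p j = (R(i := (\<lambda>j. R i j - l * c k j), k := (\<lambda>j. R k j - star l * c i j))) p j"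
          proof -
            consider "p = i" | "p = k" | "p \<noteq> i" "p \<noteq> k" by blast
            then show ?thesis
            proof cases
              case 1
              show ?thesis
                using ki row_i[OF 1] 1 by (simp add: rows_def R_def \<rho>'_def diff_diff_add)
            next
              case 2
              show ?thesis
                using ki row_k[OF 2] 2 by (simp add: rows_def R_def \<rho>'_def diff_diff_add)
            next
              case 3
              show ?thesis
                using row_other[OF 3] 3 by (simp add: rows_def R_def \<rho>'_def split: option.splits)
            qed
          qed
        qed
        moreover have "row_det n (R(i := (\<lambda>j. R i j - l * c k j), k := (\<lambda>j. R k j - star l * c i j)))
            = row_det n R - l * Di - star l * Dk + l * star l * Dik"
        proof -
          have "row_det n (R(i := (\<lambda>j. R i j - l * c k j), k := (\<lambda>j. R k j - star l * c i j)))
              = row_det n (R(i := (\<lambda>j. R i j - l * c k j), k := R k))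
                - star l * row_det n (R(i := (\<lambda>j. R i j - l * c k j), k := c i))"
            using row_det_linear[OF k] by blast
          also have "R(i := (\<lambda>j. R i j - l * c k j), k := R k) = R(i := (\<lambda>j. R i j - l * c k j))"
            using ki by auto
          also have "row_det n \<dots> = row_det n (R(i := R i)) - l * Di"
            unfolding Di_def using row_det_linear[OF i(1)] by blast
          also have "R(i := (\<lambda>j. R i j - l * c k j), k := c i) = R(k := c i, i := (\<lambda>j. R i j - l * c k j))"
            using ki by auto
          also have "row_det n \<dots> = row_det n (R(k := c i, i := R i)) - l * row_det n (R(k := c i, i := c k))"
            using row_det_linear[OF i(1)] by blast
          also have "R(k := c i, i := R i) = R(k := c i)" using ki by auto
          also have "R(k := c i, i := c k) = R(i := c k, k := c i)" using ki by auto
          finally show ?thesis by (simp add: Dk_def Dik_def algebra_simps del: fun_upd_apply)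
        qed
        ultimately have "row_det n R - (row_det n R - l * Di - star l * Dk + l * star l * Dik) \<in> J"
          using diff_mem[OF R] by metis
        then show ?thesis by (simp add: algebra_simps)
      qed
      have "\<kappa> * (1 * Di + star 1 * Dk - 1 * star 1 * Dik) - (\<kappa> * Di + star \<kappa> * Dk - \<kappa> * star \<kappa> * Dik) \<in> J"
        by (intro diff_mem mult_mem shift)
      then have "(\<kappa> * \<kappa> - \<kappa>) * Dik \<in> J"
        by (simp add: star_one \<kappa>(1) algebra_simps)
      then have Dik: "Dik \<in> J" by (rule \<kappa>(2))
      have lin: "l * Di + star l * Dk \<in> J" for l
        using add_mem[OF shift[of l] mult_mem[OF Dik, of "l * star l"]] by simp
      have "star \<theta> * (1 * Di + star 1 * Dk) - (\<theta> * Di + star \<theta> * Dk) \<in> J"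
        by (intro diff_mem mult_mem lin)
      then have "(star \<theta> - \<theta>) * Di \<in> J"
        by (simp add: star_one algebra_simps)
      then show ?thesis unfolding Di_def by (rule \<theta>)
    qed
    then show ?thesis by (simp add: target[unfolded rows_def])
  qed
qed

lemma det_hermitian_shifts_generate:
  assumes "ring_type_ideal J"
    and \<kappa>: "star \<kappa> = \<kappa>" "\<And>w. (\<kappa> * \<kappa> - \<kappa>) * w \<in> J \<Longrightarrow> w \<in> J"
    and \<theta>: "\<And>w. (star \<theta> - \<theta>) * w \<in> J \<Longrightarrow> w \<in> J"
    and carrier: "A \<in> carrier_mat n n" "C \<in> carrier_mat n n" "P \<in> carrier_mat n n" "Q \<in> carrier_mat n n"
    and bezout: "P * A + Q * C = 1\<^sub>m n"
    and shifts: "\<And>S. hermitian n S \<Longrightarrow> det (A - S * C) \<in> J"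
  shows "1 \<in> J"
proof -
  interpret ring_type_ideal J by fact
  define a c where "a i j = A $$ (i, j)" and "c i j = C $$ (i, j)" for i j
  have shifts': "row_det n (\<lambda>i j. a i j - (\<Sum>k<n. s i k * c k j)) \<in> J"
    if s: "\<And>i j. star (s j i) = s i j" for s
  proof -
    have "mat n n (\<lambda>(i, j). a i j - (\<Sum>k<n. s i k * c k j)) = A - mat n n (\<lambda>(i, j). s i j) * C"
      by (rule eq_matI) (use carrier in \<open>auto simp: a_def c_def scalar_prod_def lessThan_atLeast0\<close>)
    then show ?thesis
      unfolding row_det_def using shifts[OF hermitian_matI[of n s]] s by simp
  qed
  have mixed: "row_det n (\<lambda>i. case \<rho> i of None \<Rightarrow> a i | Some k \<Rightarrow> c k) \<in> J"
    if "\<And>i k. i < n \<Longrightarrow> \<rho> i = Some k \<Longrightarrow> k < n" for \<rho>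
  proof -
    have "row_det n (\<lambda>i. case \<rho> i of
        None \<Rightarrow> (\<lambda>j. a i j - (\<Sum>k<n. (\<lambda>_ _. 0) i k * c k j)) | Some k \<Rightarrow> c k) \<in> J"
      by (rule mixed_minors_mem[where \<kappa> = \<kappa> and \<theta> = \<theta> and a = a and c = c and n = n and \<rho> = \<rho>,
            OF assms(1) \<kappa> \<theta> shifts' that]) (simp_all only: star_zero)
    then show ?thesis by (simp cong: option.case_cong)
  qed
  define x where "x i k = (if k < n then P $$ (i, k) else Q $$ (i, k - n))" for i k
  have "row_det n (\<lambda>i j. \<Sum>k<2 * n. x i k * (if k < n then a k else c (k - n)) j) \<in> J"
    by (rule det_mem_of_stacked_minors[OF stacked_minors_mem[OF mixed]])
  moreover have "mat n n (\<lambda>(i, j). \<Sum>k<2 * n. x i k * (if k < n then a k else c (k - n)) j) = 1\<^sub>m n"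
  proof -
    have "(\<Sum>k<2 * n. x i k * (if k < n then a k else c (k - n)) j) = (P * A + Q * C) $$ (i, j)"
      if "i < n" "j < n" for i j
    proof -
      have "(\<Sum>k<2 * n. x i k * (if k < n then a k else c (k - n)) j) =
          (\<Sum>k<n. x i k * a k j) + (\<Sum>k<n. x i (k + n) * c k j)"
        using sum.atLeastLessThan_concat[of 0 n "2 * n" "\<lambda>k. x i k * (if k < n then a k else c (k - n)) j"]
          sum.shift_bounds_nat_ivl[of "\<lambda>k. x i k * (if k < n then a k else c (k - n)) j" 0 n n]
        by (simp add: lessThan_atLeast0 mult_2)
      then show ?thesis
        using that carrier by (simp add: x_def a_def c_def scalar_prod_def lessThan_atLeast0)
    qed
    then show ?thesis unfolding bezout by (intro eq_matI) auto
  qed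
  ultimately show ?thesis by (simp add: row_det_def)
qed

text \<open>
  With \<open>V\<close> the adjugate of \<open>U\<close>, multiplying \<open>C\<^sup>* U = U\<^sup>* C\<close> by \<open>V\<close> on the right gives \<open>det U C\<^sup>* = U\<^sup>* C V\<close>. Together
  with the adjoint \<open>1 = U\<^sup>* P\<^sup>* + C\<^sup>* Q\<^sup>*\<close> of the Bezout identity this shows that \<open>U\<^sup>*\<close> divides the scalar
  matrix \<open>det U\<close>; it remains to take determinants.
\<close>

lemma star_det_dvd_power:
  assumes carrier: "U \<in> carrier_mat n n" "C \<in> carrier_mat n n" "P \<in> carrier_mat n n" "Q \<in> carrier_mat n n"
    and bezout: "P * U + Q * C = 1\<^sub>m n"
    and sym: "adjoint U * C = adjoint C * U"
  shows "star (det U) dvd det U ^ n"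
proof -
  let ?f = "det U" and ?V = "adj_mat U"
  note V = adj_mat[OF carrier(1)]
  have adj: "adjoint U \<in> carrier_mat n n" "adjoint C \<in> carrier_mat n n"
    "adjoint P \<in> carrier_mat n n" "adjoint Q \<in> carrier_mat n n"
    using carrier by auto
  have "adjoint U * C * ?V = adjoint C * (U * ?V)"
    using sym V(1) carrier adj by (simp add: assoc_mult_mat[of _ n n _ n _ n])
  also have "\<dots> = ?f \<cdot>\<^sub>m adjoint C"
    unfolding V(2) using adj by (simp add: mult_smult_distrib[of _ n n _ n])
  finally have UCV: "adjoint U * C * ?V = ?f \<cdot>\<^sub>m adjoint C" .
  have "1\<^sub>m n = adjoint (P * U + Q * C)" by (simp add: bezout)
  also have "\<dots> = adjoint U * adjoint P + adjoint C * adjoint Q"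
    using carrier by (simp add: adjoint_add[of _ n n] adjoint_mult[of _ n n _ n])
  finally have "?f \<cdot>\<^sub>m 1\<^sub>m n = ?f \<cdot>\<^sub>m (adjoint U * adjoint P) + (?f \<cdot>\<^sub>m adjoint C) * adjoint Q"
    using adj by (simp add: add_smult_distrib_left_mat[of _ n n] mult_smult_assoc_mat[of _ n n _ n])
  also have "\<dots> = adjoint U * (?f \<cdot>\<^sub>m adjoint P + C * ?V * adjoint Q)"
    using adj carrier V(1) unfolding UCV[symmetric]
    by (simp add: mult_add_distrib_mat[of _ n n _ n] mult_smult_distrib[of _ n n _ n] assoc_mult_mat[of _ n n _ n _ n])
  finally have "det (?f \<cdot>\<^sub>m 1\<^sub>m n) = det (adjoint U * (?f \<cdot>\<^sub>m adjoint P + C * ?V * adjoint Q))"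
    by (rule arg_cong)
  also have "\<dots> = det (adjoint U) * det (?f \<cdot>\<^sub>m adjoint P + C * ?V * adjoint Q)"
    by (rule det_mult[where n = n])
      (use adj carrier V(1) in \<open>auto intro!: add_carrier_mat mult_carrier_mat[of _ n n]\<close>)
  finally have "det (?f \<cdot>\<^sub>m 1\<^sub>m n) = det (adjoint U) * det (?f \<cdot>\<^sub>m adjoint P + C * ?V * adjoint Q)" .
  then show ?thesis
    using carrier by (simp add: det_adjoint)
qed

text \<open>
  With an idempotent \<open>z\<close>: the determinant is computed separately on each factor of the ring.
\<close>

lemma det_patch:
  assumes "U \<in> carrier_mat n n" "V \<in> carrier_mat n n"
    and "\<And>i j. i < n \<Longrightarrow> j < n \<Longrightarrow> z * U $$ (i, j) = z * V $$ (i, j)"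
  shows "z * det U = z * det V"
proof -
  have prod: "z * (\<Prod>i\<in>I. U $$ (i, p i)) = z * (\<Prod>i\<in>I. V $$ (i, p i))"
    if "finite I" "I \<subseteq> {0..<n}" "p permutes {0..<n}" for I p
    using that
  proof (induction I)
    case (insert i I)
    have "p i < n" "i < n"
      using insert.prems permutes_in_image[of p "{0..<n}" i] by auto
    then have "z * U $$ (i, p i) = z * V $$ (i, p i)" using assms(3) by blast
    then have "z * (U $$ (i, p i) * (\<Prod>i\<in>I. U $$ (i, p i))) = z * V $$ (i, p i) * (\<Prod>i\<in>I. U $$ (i, p i))"
      by (simp only: mult.assoc[symmetric])
    also have "\<dots> = V $$ (i, p i) * (z * (\<Prod>i\<in>I. U $$ (i, p i)))"
      by (simp only: ac_simps)
    also have "\<dots> = V $$ (i, p i) * (z * (\<Prod>i\<in>I. V $$ (i, p i)))"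
      using insert by simp
    also have "\<dots> = z * (V $$ (i, p i) * (\<Prod>i\<in>I. V $$ (i, p i)))"
      by (simp only: ac_simps)
    finally show ?case
      using insert.hyps by simp
  qed simp
  show ?thesis
    unfolding det_def'[OF assms(1)] det_def'[OF assms(2)] sum_distrib_left
  proof (rule sum.cong[OF refl])
    fix p assume "p \<in> {p. p permutes {0..<n}}"
    then have "z * (\<Prod>i = 0..<n. U $$ (i, p i)) = z * (\<Prod>i = 0..<n. V $$ (i, p i))"
      by (intro prod) auto
    then show "z * (signof p * (\<Prod>i = 0..<n. U $$ (i, p i))) = z * (signof p * (\<Prod>i = 0..<n. V $$ (i, p i)))"
      by (simp only: mult.left_commute[of z])
  qed
qed

text \<open>
  The idempotent \<open>e\<close> singles out a factor of the ring. All divisibility conditions are imposed on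
  that factor only; for \<open>e = 1\<close> the conclusion is that the norm of some \<open>det (A - S C)\<close> is invertible.
\<close>

theorem hermitian_shift_norm_dvd:
  assumes e: "e * e = e"
    and patch: "\<And>f g. \<exists>z. z * z = z \<and> star z = z \<and>
        z * (f * star f) + (1 - z) * (g * star g) dvd e * (f * star f) \<and>
        z * (f * star f) + (1 - z) * (g * star g) dvd e * (g * star g)"
    and \<kappa>: "star \<kappa> = \<kappa>" "\<kappa> * \<kappa> - \<kappa> dvd e"
    and \<theta>: "star \<theta> - \<theta> dvd e"
    and carrier: "A \<in> carrier_mat n n" "C \<in> carrier_mat n n" "P \<in> carrier_mat n n" "Q \<in> carrier_mat n n"
    and bezout: "P * A + Q * C = 1\<^sub>m n"
    and sym: "hermitian n (adjoint A * C)"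
  shows "\<exists>S. hermitian n S \<and> det (A - S * C) * star (det (A - S * C)) dvd e"
proof -
  define N where "N S = det (A - S * C) * star (det (A - S * C))" for S
  \<comment> \<open>closed under addition because two shifts can be glued along an idempotent \<open>z\<close>\<close>
  define J where "J = {w. \<exists>S. hermitian n S \<and> N S dvd e * w}"
  have hermD: "S \<in> carrier_mat n n" "adjoint S = S" if "hermitian n S" for S
    using that by (auto simp: hermitian_def)
  interpret J: ring_type_ideal J
  proof
    show "0 \<in> J"
      by (auto simp: J_def intro!: exI[of _ "mat n n (\<lambda>(i, j). 0)"] hermitian_matI star_zero)
    show "r * w \<in> J" if "w \<in> J" for r w
      using that by (auto simp: J_def mult.left_commute[of e r] intro: dvd_mult)
    show "v + w \<in> J" if vw: "v \<in> J" "w \<in> J" for v w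
    proof -
      obtain S T where S: "hermitian n S" "N S dvd e * v" and T: "hermitian n T" "N T dvd e * w"
        using vw by (auto simp: J_def)
      obtain z where z: "z * z = z" "star z = z"
        and dvd: "z * N S + (1 - z) * N T dvd e * N S" "z * N S + (1 - z) * N T dvd e * N T"
        using patch[of "det (A - S * C)" "det (A - T * C)"] by (auto simp: N_def)
      define M where "M = mat n n (\<lambda>(i, j). z * S $$ (i, j) + (1 - z) * T $$ (i, j))"
      have "hermitian n M"
        unfolding M_def by (rule hermitian_matI)
          (use hermitian_entry[OF S(1)] hermitian_entry[OF T(1)] in
            \<open>auto simp: star_add star_mult z star_hom.hom_minus star_one\<close>)
      have entry: "(A - M * C) $$ (i, j) = z * (A - S * C) $$ (i, j) + (1 - z) * (A - T * C) $$ (i, j)"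
        if "i < n" "j < n" for i j
      proof -
        have "(\<Sum>k<n. (z * S $$ (i, k) + (1 - z) * T $$ (i, k)) * C $$ (k, j)) =
            z * (\<Sum>k<n. S $$ (i, k) * C $$ (k, j)) + (1 - z) * (\<Sum>k<n. T $$ (i, k) * C $$ (k, j))"
          by (simp add: sum_distrib_left sum.distrib[symmetric] distrib_right mult.assoc)
        then show ?thesis
          using that carrier hermD[OF S(1)] hermD[OF T(1)]
          by (simp add: M_def scalar_prod_def lessThan_atLeast0 algebra_simps)
      qed
      have M: "A - M * C \<in> carrier_mat n n" "A - S * C \<in> carrier_mat n n" "A - T * C \<in> carrier_mat n n"
        using carrier hermD[OF S(1)] hermD[OF T(1)] by (auto simp: M_def)
      have zz: "z * (1 - z) = 0" "(1 - z) * z = 0" "(1 - z) * (1 - z) = 1 - z"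
        using z by (simp_all add: algebra_simps)
      have "z * det (A - M * C) = z * det (A - S * C)"
        by (rule det_patch[OF M(1,2)]) (simp add: entry distrib_left mult.assoc[symmetric] z zz)
      moreover have "(1 - z) * det (A - M * C) = (1 - z) * det (A - T * C)"
        by (rule det_patch[OF M(1,3)]) (simp add: entry distrib_left mult.assoc[symmetric] z zz)
      ultimately have "det (A - M * C) = z * det (A - S * C) + (1 - z) * det (A - T * C)"
        by (metis add.commute diff_add_cancel mult_1 ring_class.ring_distribs(2))
      then have "N M = (z * det (A - S * C) + (1 - z) * det (A - T * C))
          * (z * star (det (A - S * C)) + (1 - z) * star (det (A - T * C)))"
        by (simp add: N_def star_add star_mult z star_hom.hom_minus star_one)
      also have "\<dots> = (z * z) * N S + ((1 - z) * (1 - z)) * N T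
          + (z * (1 - z)) * (det (A - S * C) * star (det (A - T * C)) + det (A - T * C) * star (det (A - S * C)))"
        unfolding N_def by (simp only: algebra_simps)
      finally have "N M = z * N S + (1 - z) * N T"
        by (simp add: zz z)
      moreover have "N M dvd e * v" if "N M dvd e * D" "D dvd e * v" for D v
        using that by (metis e dvd_trans mult.assoc mult_dvd_mono dvd_refl)
      ultimately have "N M dvd e * v + e * w"
        using dvd S(2) T(2) by (metis dvd_add)
      then show ?thesis
        using \<open>hermitian n M\<close> by (auto simp: J_def distrib_left)
    qed
  qed
  define K where "K = {w. \<exists>k. w ^ k \<in> J}"
  have "ring_type_ideal K" unfolding K_def by (rule J.radical_ideal)
  have saturated: "w \<in> K" if d: "d dvd e" and "d * w \<in> K" for d w
  proof -
    obtain k where "(d * w) ^ k \<in> J" using \<open>d * w \<in> K\<close> by (auto simp: K_def)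
    then obtain S where S: "hermitian n S" "N S dvd e * (d ^ k * w ^ k)"
      by (auto simp: J_def power_mult_distrib)
    obtain b where b: "e = d * b" using d by blast
    have "e * e ^ k = e" by (induction k) (use e in \<open>simp_all add: mult.assoc[symmetric]\<close>)
    then have "e * w ^ k = b ^ k * (e * (d ^ k * w ^ k))"
      by (metis b mult.assoc mult.commute power_mult_distrib)
    then have "w ^ k \<in> J" using S by (auto simp: J_def)
    then show ?thesis by (auto simp: K_def)
  qed
  have "det (A - S * C) \<in> K" if S: "hermitian n S" for S
  proof -
    let ?U = "A - S * C"
    note S' = hermD[OF S]
    have U: "?U \<in> carrier_mat n n" using carrier S' by auto
    have "adjoint ?U = adjoint A - adjoint C * S"
      using carrier S' by (simp add: adjoint_minus[of _ n n] adjoint_mult[of _ n n _ n])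
    then have "adjoint ?U * C = (adjoint A - adjoint C * S) * C"
      by (rule arg_cong)
    also have "\<dots> = adjoint A * C - adjoint C * S * C"
      by (rule minus_mult_distrib_mat[of _ n n _ _ n])
        (use carrier S' in \<open>auto intro!: mult_carrier_mat[of _ n n]\<close>)
    also have "adjoint A * C = adjoint C * A"
      using sym carrier by (simp add: hermitian_def adjoint_mult[of _ n n _ n])
    also have "adjoint C * A - adjoint C * S * C = adjoint C * ?U"
      using carrier S' by (simp add: mult_minus_distrib_mat[of _ n n _ n] assoc_mult_mat[of _ n n _ n _ n])
    finally have symU: "adjoint ?U * C = adjoint C * ?U" .
    have "P * ?U + (Q + P * S) * C = P * A - P * S * C + (Q * C + P * S * C)"
      using carrier S' by (simp add: mult_minus_distrib_mat[of _ n n _ n] assoc_mult_mat[of _ n n _ n _ n]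
          add_mult_distrib_mat[of _ n n _ _ n])
    also have "\<dots> = P * A + Q * C"
      by (rule eq_matI) (use carrier S' in auto)
    finally have "P * ?U + (Q + P * S) * C = 1\<^sub>m n" by (simp add: bezout)
    then have "star (det ?U) dvd det ?U ^ n"
      using star_det_dvd_power[OF U carrier(2,3) _ _ symU, of "Q + P * S"] carrier S' by auto
    then have "N S dvd det ?U ^ Suc n"
      by (simp add: N_def mult_dvd_mono)
    then have "det ?U ^ Suc n \<in> J" using S by (auto simp: J_def)
    then show ?thesis unfolding K_def by blast
  qed
  then have "1 \<in> K"
    by (intro det_hermitian_shifts_generate[OF \<open>ring_type_ideal K\<close> \<kappa>(1) _ _ carrier bezout])
      (use saturated \<kappa>(2) \<theta> in blast)+
  then show ?thesis by (auto simp: K_def J_def N_def)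
qed

end

section \<open>Commutative rings on a carrier as factors of a type\<close>

text \<open>
  The product of all commutative rings with elements in \<open>'b\<close>. It is itself a type of class
  \<open>comm_ring_1\<close> and every commutative ring \<open>R :: 'b ring\<close> is a factor of it, so that results about
  types apply to \<open>R\<close>. The additional factor \<open>int\<close> guarantees \<open>0 \<noteq> 1\<close>.
\<close>

typedef 'b cring_product =
  "{h :: int \<times> ('b ring \<Rightarrow> 'b). \<forall>R. if cring R then snd h R \<in> carrier R else snd h R = undefined}"
proof -
  have "(0, \<lambda>R. if cring R then \<zero>\<^bsub>R\<^esub> else undefined) \<in>
      {h :: int \<times> ('b ring \<Rightarrow> 'b). \<forall>R. if cring R then snd h R \<in> carrier R else snd h R = undefined}"
    by (simp add: cring.cring_simprules)
  then show ?thesis by blast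
qed

definition component :: "'b cring_product \<Rightarrow> 'b ring \<Rightarrow> 'b" where
  "component x = snd (Rep_cring_product x)"

definition int_component :: "'b cring_product \<Rightarrow> int" where
  "int_component x = fst (Rep_cring_product x)"

definition tuple :: "int \<Rightarrow> ('b ring \<Rightarrow> 'b) \<Rightarrow> 'b cring_product" where
  "tuple k f = Abs_cring_product (k, \<lambda>R. if cring R then f R else undefined)"

lemma component_carrier: "cring R \<Longrightarrow> component x R \<in> carrier R"
  using Rep_cring_product[of x] unfolding component_def by (auto dest: spec[of _ R])

lemma
  assumes "\<And>R. cring R \<Longrightarrow> f R \<in> carrier R"
  shows component_tuple: "cring R \<Longrightarrow> component (tuple k f) R = f R"
    and int_component_tuple: "int_component (tuple k f) = k"
  unfolding component_def int_component_def tuple_def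
  by (subst Abs_cring_product_inverse; use assms in simp)+

lemma cring_product_eqI:
  assumes "int_component x = int_component y"
    and "\<And>R. cring R \<Longrightarrow> component x R = component y R"
  shows "x = y"
proof -
  have "component x R = component y R" for R
    using assms(2)[of R] Rep_cring_product[of x] Rep_cring_product[of y]
    unfolding component_def by (cases "cring R") (auto dest!: spec[of _ R])
  then have "Rep_cring_product x = Rep_cring_product y"
    using assms(1) by (auto simp: component_def int_component_def prod_eq_iff)
  then show ?thesis by (simp add: Rep_cring_product_inject)
qed

instantiation cring_product :: (type) comm_ring_1
begin

definition "0 = tuple 0 (\<lambda>R. \<zero>\<^bsub>R\<^esub>)"
definition "1 = tuple 1 (\<lambda>R. \<one>\<^bsub>R\<^esub>)"
definition "x + y = tuple (int_component x + int_component y) (\<lambda>R. component x R \<oplus>\<^bsub>R\<^esub> component y R)"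
definition "x * y = tuple (int_component x * int_component y) (\<lambda>R. component x R \<otimes>\<^bsub>R\<^esub> component y R)"
definition "- x = tuple (- int_component x) (\<lambda>R. \<ominus>\<^bsub>R\<^esub> component x R)"
definition "(x::'a cring_product) - y = x + - y"

lemma component_simps:
  assumes "cring R"
  shows "component 0 R = \<zero>\<^bsub>R\<^esub>" "component 1 R = \<one>\<^bsub>R\<^esub>"
    "component (x + y) R = component x R \<oplus>\<^bsub>R\<^esub> component y R"
    "component (x * y) R = component x R \<otimes>\<^bsub>R\<^esub> component y R"
    "component (- x) R = \<ominus>\<^bsub>R\<^esub> component x R"
    "component (x - y) R = component x R \<ominus>\<^bsub>R\<^esub> component y R"
  using assms
  by (simp_all add: zero_cring_product_def one_cring_product_def plus_cring_product_def
      times_cring_product_def uminus_cring_product_def minus_cring_product_def component_tuple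
      component_carrier cring.cring_simprules)

lemma int_component_simps:
  "int_component 0 = 0" "int_component 1 = 1"
  "int_component (x + y) = int_component x + int_component y"
  "int_component (x * y) = int_component x * int_component y"
  "int_component (- x) = - int_component x"
  "int_component (x - y) = int_component x - int_component y"
  by (simp_all add: zero_cring_product_def one_cring_product_def plus_cring_product_def
      times_cring_product_def uminus_cring_product_def minus_cring_product_def int_component_tuple
      component_carrier cring.cring_simprules)

instance
proof
  fix x y z :: "'a cring_product"
  note simps = component_simps int_component_simps component_carrier
  show "x * y * z = x * (y * z)"
    by (rule cring_product_eqI) (simp_all add: simps cring.cring_simprules(11))
  show "x * y = y * x"
    by (rule cring_product_eqI) (simp_all add: simps cring.cring_simprules(14))
  show "1 * x = x"
    by (rule cring_product_eqI) (simp_all add: simps cring.cring_simprules(12))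
  show "x + y + z = x + (y + z)"
    by (rule cring_product_eqI) (simp_all add: simps cring.cring_simprules(7))
  show "x + y = y + x"
    by (rule cring_product_eqI) (simp_all add: simps cring.cring_simprules(10))
  show "0 + x = x"
    by (rule cring_product_eqI) (simp_all add: simps cring.cring_simprules(8))
  show "- x + x = 0"
    by (rule cring_product_eqI) (simp_all add: simps cring.cring_simprules(9))
  show "x - y = x + - y"
    by (simp add: minus_cring_product_def)
  show "(x + y) * z = x * z + y * z"
    by (rule cring_product_eqI) (simp_all add: simps cring.cring_simprules(13) distrib_right)
  show "(0::'a cring_product) \<noteq> 1"
    using int_component_simps(1,2) by (metis zero_neq_one)
qed

end

text \<open>
  The map \<open>ev\<close> is the projection to the factor \<open>B\<close>, \<open>upd\<close> changes the coordinate at \<open>B\<close>, and the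
  idempotent \<open>unit_at\<close> is \<open>1\<close> at \<open>B\<close> and \<open>0\<close> at all other factors.
\<close>

locale cring_factor = cring B for B :: "'b ring" (structure)
begin

definition ev :: "'b cring_product \<Rightarrow> 'b" where
  "ev x = component x B"

definition upd :: "'b cring_product \<Rightarrow> 'b \<Rightarrow> 'b cring_product" where
  "upd x b = tuple (int_component x) ((component x)(B := b))"

definition unit_at :: "'b cring_product" where
  "unit_at = upd 0 \<one>"

lemma ev_closed [simp]: "ev x \<in> carrier B"
  by (simp add: ev_def component_carrier is_cring)

lemma ev_simps [simp]:
  "ev 0 = \<zero>" "ev 1 = \<one>" "ev (x + y) = ev x \<oplus> ev y" "ev (x * y) = ev x \<otimes> ev y"
  "ev (- x) = \<ominus> ev x" "ev (x - y) = ev x \<ominus> ev y"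
  by (simp_all add: ev_def component_simps is_cring)

lemma component_upd:
  assumes "b \<in> carrier B" "cring R"
  shows "component (upd x b) R = (if R = B then b else component x R)"
  unfolding upd_def by (subst component_tuple) (use assms in \<open>auto simp: component_carrier\<close>)

lemma int_component_upd: "b \<in> carrier B \<Longrightarrow> int_component (upd x b) = int_component x"
  unfolding upd_def by (rule int_component_tuple) (auto simp: component_carrier)

lemma ev_upd [simp]: "b \<in> carrier B \<Longrightarrow> ev (upd x b) = b"
  by (simp add: ev_def component_upd is_cring)

lemma upd_upd_add:
  "a \<in> carrier B \<Longrightarrow> b \<in> carrier B \<Longrightarrow> upd (x + y) (a \<oplus> b) = upd x a + upd y b"
  by (rule cring_product_eqI) (auto simp: component_simps int_component_simps component_upd int_component_upd)

lemma upd_upd_mult: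
  "a \<in> carrier B \<Longrightarrow> b \<in> carrier B \<Longrightarrow> upd (x * y) (a \<otimes> b) = upd x a * upd y b"
  by (rule cring_product_eqI) (auto simp: component_simps int_component_simps component_upd int_component_upd)

lemma upd_twice: "a \<in> carrier B \<Longrightarrow> b \<in> carrier B \<Longrightarrow> upd (upd x a) b = upd x b"
  by (rule cring_product_eqI) (auto simp: component_upd int_component_upd)

lemma upd_ev: "upd x (ev x) = x"
  by (rule cring_product_eqI) (use ev_closed[of x] in \<open>auto simp: component_upd int_component_upd ev_def\<close>)

lemma unit_at_mult: "unit_at * x = upd 0 (ev x)"
proof -
  have "unit_at * x = upd 0 \<one> * upd x (ev x)" by (simp add: upd_ev unit_at_def)
  also have "\<dots> = upd (0 * x) (\<one> \<otimes> ev x)" by (rule upd_upd_mult[symmetric]) auto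
  finally show ?thesis by simp
qed

lemma unit_at_idem: "unit_at * unit_at = unit_at"
  by (simp add: unit_at_mult) (simp add: unit_at_def)

lemma ev_unit_at [simp]: "ev unit_at = \<one>"
  by (simp add: unit_at_def)

lemma unit_at_compl_upd: "b \<in> carrier B \<Longrightarrow> (1 - unit_at) * upd x b = (1 - unit_at) * x"
proof -
  assume "b \<in> carrier B"
  then have "upd x b = upd (x + 0) (\<zero> \<oplus> b)" "x = upd (x + 0) (\<zero> \<oplus> ev x)"
    by (simp_all add: upd_ev)
  then have "upd x b = upd x \<zero> + upd 0 b" "x = upd x \<zero> + upd 0 (ev x)"
    using \<open>b \<in> carrier B\<close> by (metis upd_upd_add zero_closed ev_closed)+
  moreover have "(1 - unit_at) * upd 0 c = 0" if "c \<in> carrier B" for c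
    using that unit_at_mult[of "upd 0 c"] by (simp add: left_diff_distrib)
  ultimately show ?thesis
    using \<open>b \<in> carrier B\<close> by (metis add.right_neutral distrib_left ev_closed)
qed

lemma eq_by_parts: "ev x = ev y \<Longrightarrow> (1 - unit_at) * x = (1 - unit_at) * y \<Longrightarrow> x = y"
  using unit_at_mult[of x] unit_at_mult[of y] by (simp add: left_diff_distrib)

lemma ev_sum: "finite I \<Longrightarrow> ev (sum f I) = (\<Oplus>i\<in>I. ev (f i))"
  by (induction I rule: finite_induct) (auto simp: finsum_insert Pi_def)

lemma dvd_unit_at_mult: "b \<in> carrier B \<Longrightarrow> ev x = ev d \<otimes> b \<Longrightarrow> d dvd unit_at * x"
proof
  assume "b \<in> carrier B" "ev x = ev d \<otimes> b"
  then have "upd 0 (ev x) = upd (d * 0) (ev d \<otimes> b)" by simp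
  also have "\<dots> = upd d (ev d) * upd 0 b" by (rule upd_upd_mult) (use \<open>b \<in> carrier B\<close> in auto)
  finally show "unit_at * x = d * upd 0 b" by (simp add: unit_at_mult upd_ev)
qed

section \<open>Matrices over a commutative ring\<close>

definition mat_ev :: "nat \<Rightarrow> 'b cring_product mat \<Rightarrow> nat \<times> nat \<Rightarrow> 'b" where
  "mat_ev n M = (\<lambda>(i, j)\<in>{..<n} \<times> {..<n}. ev (M $$ (i, j)))"

definition mat_upd :: "nat \<Rightarrow> 'b cring_product mat \<Rightarrow> (nat \<times> nat \<Rightarrow> 'b) \<Rightarrow> 'b cring_product mat" where
  "mat_upd n M m = mat n n (\<lambda>ij. upd (M $$ ij) (m ij))"

lemma mat_upd_carrier [simp]: "mat_upd n M m \<in> carrier_mat n n"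
  by (simp add: mat_upd_def)

lemma mat_ev_closed [simp]: "mat_ev n M \<in> carrier (matrix_ring n B)"
  by (auto simp: mat_ev_def matrix_ring_def)

lemma mat_ev_upd [simp]: "m \<in> carrier (matrix_ring n B) \<Longrightarrow> mat_ev n (mat_upd n M m) = m"
  unfolding matrix_ring_def mat_ev_def mat_upd_def
  by (auto simp: fun_eq_iff restrict_def PiE_iff extensional_def)

lemma mat_ev_add:
  "M \<in> carrier_mat n n \<Longrightarrow> N \<in> carrier_mat n n \<Longrightarrow>
    mat_ev n (M + N) = mat_ev n M \<oplus>\<^bsub>matrix_ring n B\<^esub> mat_ev n N"
  by (auto simp: mat_ev_def matrix_ring_def fun_eq_iff restrict_def)

lemma mat_ev_mult:
  assumes "M \<in> carrier_mat n n" "N \<in> carrier_mat n n"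
  shows "mat_ev n (M * N) = mat_ev n M \<otimes>\<^bsub>matrix_ring n B\<^esub> mat_ev n N"
proof -
  have "ev ((M * N) $$ (i, j)) = (\<Oplus>k\<in>{..<n}. mat_ev n M (i, k) \<otimes> mat_ev n N (k, j))"
    if "i < n" "j < n" for i j
  proof -
    have "(M * N) $$ (i, j) = (\<Sum>k<n. M $$ (i, k) * N $$ (k, j))"
      using assms that by (simp add: scalar_prod_def lessThan_atLeast0)
    then have "ev ((M * N) $$ (i, j)) = (\<Oplus>k\<in>{..<n}. ev (M $$ (i, k)) \<otimes> ev (N $$ (k, j)))"
      by (simp add: ev_sum)
    also have "\<dots> = (\<Oplus>k\<in>{..<n}. mat_ev n M (i, k) \<otimes> mat_ev n N (k, j))"
      by (rule finsum_cong') (use that in \<open>auto simp: mat_ev_def\<close>)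
    finally show ?thesis .
  qed
  then show ?thesis
    by (auto simp: mat_ev_def[of n "M * N"] matrix_ring_def fun_eq_iff restrict_def)
qed

lemma mat_ev_one: "mat_ev n (1\<^sub>m n) = \<one>\<^bsub>matrix_ring n B\<^esub>"
  by (auto simp: mat_ev_def matrix_ring_def fun_eq_iff restrict_def)

lemma mat_ev_zero: "mat_ev n (0\<^sub>m n n) = \<zero>\<^bsub>matrix_ring n B\<^esub>"
  by (auto simp: mat_ev_def matrix_ring_def fun_eq_iff restrict_def)

lemma obtain_lift:
  assumes "m \<in> carrier (matrix_ring n B)"
  obtains M where "M \<in> carrier_mat n n" "m = mat_ev n M"
  using assms mat_ev_upd mat_upd_carrier by metis

text \<open>
  The map \<open>mat_ev\<close> is a surjection that respects all operations, and the ring axioms hold for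
  matrices over a type.
\<close>

lemma ring_matrix_ring: "ring (matrix_ring n B)"
proof (rule ringI)
  note hom = mat_ev_add[symmetric] mat_ev_mult[symmetric] mat_ev_one[symmetric] mat_ev_zero[symmetric]
  let ?M = "matrix_ring n B"
  show "abelian_group ?M"
  proof (rule abelian_groupI)
    fix x y z assume "x \<in> carrier ?M" "y \<in> carrier ?M" "z \<in> carrier ?M"
    then show "x \<oplus>\<^bsub>?M\<^esub> y \<oplus>\<^bsub>?M\<^esub> z = x \<oplus>\<^bsub>?M\<^esub> (y \<oplus>\<^bsub>?M\<^esub> z)"
      by (elim obtain_lift) (simp add: hom assoc_add_mat[of _ n n])
  next
    fix x y assume xy: "x \<in> carrier ?M" "y \<in> carrier ?M"
    then show "x \<oplus>\<^bsub>?M\<^esub> y = y \<oplus>\<^bsub>?M\<^esub> x"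
      by (elim obtain_lift) (simp add: hom comm_add_mat[of _ n n])
    show "x \<oplus>\<^bsub>?M\<^esub> y \<in> carrier ?M"
      using xy by (elim obtain_lift) (simp add: hom)
  next
    show "\<zero>\<^bsub>?M\<^esub> \<in> carrier ?M" by (simp add: hom)
  next
    fix x assume x: "x \<in> carrier ?M"
    then show "\<zero>\<^bsub>?M\<^esub> \<oplus>\<^bsub>?M\<^esub> x = x"
      by (elim obtain_lift) (simp add: hom)
    from x obtain X' where "X' \<in> carrier_mat n n" "x = mat_ev n X'" by (rule obtain_lift)
    then show "\<exists>y\<in>carrier ?M. y \<oplus>\<^bsub>?M\<^esub> x = \<zero>\<^bsub>?M\<^esub>"
      by (intro bexI[of _ "mat_ev n (- X')"]) (simp_all add: hom uminus_l_inv_mat)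
  qed
  show "Group.monoid ?M"
  proof (rule monoidI)
    fix x y z assume "x \<in> carrier ?M" "y \<in> carrier ?M" "z \<in> carrier ?M"
    then show "x \<otimes>\<^bsub>?M\<^esub> y \<otimes>\<^bsub>?M\<^esub> z = x \<otimes>\<^bsub>?M\<^esub> (y \<otimes>\<^bsub>?M\<^esub> z)"
      by (elim obtain_lift) (simp add: hom assoc_mult_mat[of _ n n _ n _ n])
  next
    fix x y assume xy: "x \<in> carrier ?M" "y \<in> carrier ?M"
    then show "x \<otimes>\<^bsub>?M\<^esub> y \<in> carrier ?M"
      by (elim obtain_lift) (simp add: hom)
  next
    show "\<one>\<^bsub>?M\<^esub> \<in> carrier ?M" by (simp add: hom)
  next
    fix x assume x: "x \<in> carrier ?M"
    then show "\<one>\<^bsub>?M\<^esub> \<otimes>\<^bsub>?M\<^esub> x = x" "x \<otimes>\<^bsub>?M\<^esub> \<one>\<^bsub>?M\<^esub> = x"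
      by (elim obtain_lift; simp add: hom left_mult_one_mat[of _ n n] right_mult_one_mat[of _ n n])+
  qed
  fix x y z assume "x \<in> carrier ?M" "y \<in> carrier ?M" "z \<in> carrier ?M"
  then show "(x \<oplus>\<^bsub>?M\<^esub> y) \<otimes>\<^bsub>?M\<^esub> z = x \<otimes>\<^bsub>?M\<^esub> z \<oplus>\<^bsub>?M\<^esub> y \<otimes>\<^bsub>?M\<^esub> z"
    "z \<otimes>\<^bsub>?M\<^esub> (x \<oplus>\<^bsub>?M\<^esub> y) = z \<otimes>\<^bsub>?M\<^esub> x \<oplus>\<^bsub>?M\<^esub> z \<otimes>\<^bsub>?M\<^esub> y"
    by (elim obtain_lift; simp add: hom add_mult_distrib_mat[of _ n n _ _ n]
        mult_add_distrib_mat[of _ n n _ n])+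
qed

lemma compl_mat_upd:
  assumes "m \<in> carrier (matrix_ring n B)" "M \<in> carrier_mat n n"
  shows "(1 - unit_at) \<cdot>\<^sub>m mat_upd n M m = (1 - unit_at) \<cdot>\<^sub>m M"
  by (rule eq_matI) (use assms in \<open>auto simp: mat_upd_def matrix_ring_def unit_at_compl_upd PiE_iff\<close>)

lemma mat_eq_by_parts:
  assumes "M \<in> carrier_mat n n" "N \<in> carrier_mat n n" "mat_ev n M = mat_ev n N"
    and "(1 - unit_at) \<cdot>\<^sub>m M = (1 - unit_at) \<cdot>\<^sub>m N"
  shows "M = N"
proof (rule eq_matI)
  fix i j assume ij: "i < dim_row N" "j < dim_col N"
  then have ij': "i < n" "j < n" using assms by auto
  show "M $$ (i, j) = N $$ (i, j)"
  proof (rule eq_by_parts)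
    show "ev (M $$ (i, j)) = ev (N $$ (i, j))"
      using fun_cong[OF assms(3), of "(i, j)"] ij' by (simp add: mat_ev_def)
    have "((1 - unit_at) \<cdot>\<^sub>m M) $$ (i, j) = ((1 - unit_at) \<cdot>\<^sub>m N) $$ (i, j)"
      using assms(4) by simp
    then show "(1 - unit_at) * M $$ (i, j) = (1 - unit_at) * N $$ (i, j)"
      using ij' assms(1,2) by simp
  qed
qed (use assms in auto)

end

locale star_cring = cring_factor B for B :: "'b ring" (structure) +
  fixes star :: "'b \<Rightarrow> 'b"
  assumes star_closed [simp]: "x \<in> carrier B \<Longrightarrow> star x \<in> carrier B"
    and star_add: "x \<in> carrier B \<Longrightarrow> y \<in> carrier B \<Longrightarrow> star (x \<oplus> y) = star x \<oplus> star y"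
    and star_mult: "x \<in> carrier B \<Longrightarrow> y \<in> carrier B \<Longrightarrow> star (x \<otimes> y) = star x \<otimes> star y"
    and star_star: "x \<in> carrier B \<Longrightarrow> star (star x) = x"
begin

definition star_upd :: "'b cring_product \<Rightarrow> 'b cring_product" where
  "star_upd x = upd x (star (ev x))"

sublocale up: star_type star_upd
proof
  fix x y
  show "star_upd (x + y) = star_upd x + star_upd y"
    by (simp add: star_upd_def star_add upd_upd_add)
  show "star_upd (x * y) = star_upd x * star_upd y"
    by (simp add: star_upd_def star_mult upd_upd_mult)
  show "star_upd (star_upd x) = x"
    by (simp add: star_upd_def star_star upd_twice upd_ev)
qed

lemma ev_star_upd [simp]: "ev (star_upd x) = star (ev x)"
  by (simp add: star_upd_def)

lemma star_one: "star \<one> = \<one>"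
  using ev_star_upd[of 1] by (simp add: up.star_one del: ev_star_upd)

lemma star_upd_upd_zero: "b \<in> carrier B \<Longrightarrow> star_upd (upd 0 b) = upd 0 (star b)"
  by (simp add: star_upd_def upd_twice)

lemma mat_ev_adjoint:
  "M \<in> carrier_mat n n \<Longrightarrow> mat_ev n (up.adjoint M) = matrix_star n star (mat_ev n M)"
  by (auto simp: mat_ev_def matrix_star_def up.adjoint_def fun_eq_iff restrict_def)

lemma ring_with_involution_matrix: "ring_with_involution (matrix_ring n B) (matrix_star n star)"
proof (rule ring_with_involution.intro[OF ring_matrix_ring], unfold_locales)
  let ?M = "matrix_ring n B"
  fix a b assume ab: "a \<in> carrier ?M" "b \<in> carrier ?M"
  then obtain X1 X2 where X: "X1 \<in> carrier_mat n n" "a = mat_ev n X1" "X2 \<in> carrier_mat n n" "b = mat_ev n X2"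
    by (metis obtain_lift)
  show "matrix_star n star a \<in> carrier ?M"
    using X by (simp add: mat_ev_adjoint[symmetric])
  show "matrix_star n star (matrix_star n star a) = a"
    using X by (simp add: mat_ev_adjoint[symmetric])
  show "matrix_star n star (a \<oplus>\<^bsub>?M\<^esub> b) = matrix_star n star a \<oplus>\<^bsub>?M\<^esub> matrix_star n star b"
    using X by (simp add: mat_ev_adjoint[symmetric] mat_ev_add[symmetric] up.adjoint_add[of _ n n])
  show "matrix_star n star (a \<otimes>\<^bsub>?M\<^esub> b) = matrix_star n star b \<otimes>\<^bsub>?M\<^esub> matrix_star n star a"
    using X by (simp add: mat_ev_adjoint[symmetric] mat_ev_mult[symmetric] up.adjoint_mult[of _ n n _ n])
qed

text \<open>
  The property of the adeles that makes local choices of a hermitian shift fit together.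
\<close>

definition norms_glue :: bool where
  "norms_glue \<longleftrightarrow> (\<forall>f\<in>carrier B. \<forall>g\<in>carrier B. \<exists>z\<in>carrier B. z \<otimes> z = z \<and> star z = z \<and>
    (let m = z \<otimes> (f \<otimes> star f) \<oplus> (\<one> \<ominus> z) \<otimes> (g \<otimes> star g)
     in (\<exists>u\<in>carrier B. f \<otimes> star f = m \<otimes> u) \<and> (\<exists>u\<in>carrier B. g \<otimes> star g = m \<otimes> u)))"

text \<open>
  The pair is lifted to the product ring, by \<open>(1, 0)\<close> at all factors other than \<open>B\<close>; there it is
  again unimodular and hermitian, and a shift found there is projected back to \<open>B\<close>.
\<close>

theorem unit_shift:
  assumes patch: norms_glue
    and \<kappa>: "\<kappa> \<in> carrier B" "star \<kappa> = \<kappa>" "\<kappa> \<otimes> \<kappa> \<ominus> \<kappa> \<in> Units B"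
    and \<theta>: "\<theta> \<in> carrier B" "star \<theta> \<ominus> \<theta> \<in> Units B"
    and ac: "coprime_sym_pair (matrix_ring n B) (matrix_star n star) a c"
  shows "\<exists>s\<in>sym_elements (matrix_ring n B) (matrix_star n star). \<exists>r\<in>Units (matrix_ring n B).
    a = s \<otimes>\<^bsub>matrix_ring n B\<^esub> c \<oplus>\<^bsub>matrix_ring n B\<^esub> r"
proof -
  let ?M = "matrix_ring n B" and ?e = unit_at
  interpret M: ring_with_involution ?M "matrix_star n star" by (rule ring_with_involution_matrix)
  have a: "a \<in> carrier ?M" and c: "c \<in> carrier ?M"
    and sym: "matrix_star n star a \<otimes>\<^bsub>?M\<^esub> c \<in> sym_elements ?M (matrix_star n star)"
    using ac by (auto simp: coprime_sym_pair_def)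
  have "\<one>\<^bsub>?M\<^esub> \<in> {x \<otimes>\<^bsub>?M\<^esub> a \<oplus>\<^bsub>?M\<^esub> y \<otimes>\<^bsub>?M\<^esub> c | x y. x \<in> carrier ?M \<and> y \<in> carrier ?M}"
    using ac by (simp add: coprime_sym_pair_def)
  then obtain x y where xy: "x \<in> carrier ?M" "y \<in> carrier ?M"
    "x \<otimes>\<^bsub>?M\<^esub> a \<oplus>\<^bsub>?M\<^esub> y \<otimes>\<^bsub>?M\<^esub> c = \<one>\<^bsub>?M\<^esub>" by auto
  \<comment> \<open>lifts that are \<open>(1, 0)\<close>, with Bezout coefficients \<open>1\<close> and \<open>0\<close>, away from \<open>B\<close>\<close>
  define A C P Q where "A = mat_upd n (1\<^sub>m n) a" and "C = mat_upd n (0\<^sub>m n n) c"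
    and "P = mat_upd n (1\<^sub>m n) x" and "Q = mat_upd n (0\<^sub>m n n) y"
  note defs = A_def C_def P_def Q_def
  have carrier [simp]: "A \<in> carrier_mat n n" "C \<in> carrier_mat n n" "P \<in> carrier_mat n n" "Q \<in> carrier_mat n n"
    by (simp_all add: defs)
  have ev: "mat_ev n A = a" "mat_ev n C = c" "mat_ev n P = x" "mat_ev n Q = y"
    using a c xy by (simp_all add: defs)
  let ?d = "1 - ?e"
  have away: "?d \<cdot>\<^sub>m A = ?d \<cdot>\<^sub>m 1\<^sub>m n" "?d \<cdot>\<^sub>m C = 0\<^sub>m n n" "?d \<cdot>\<^sub>m P = ?d \<cdot>\<^sub>m 1\<^sub>m n"
    using a c xy by (simp_all add: defs compl_mat_upd)
  have bezout: "P * A + Q * C = 1\<^sub>m n"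
  proof (rule mat_eq_by_parts[of _ n])
    show "mat_ev n (P * A + Q * C) = mat_ev n (1\<^sub>m n)"
      using xy(3) by (simp add: mat_ev_add mult_carrier_mat[of _ n n] mat_ev_mult mat_ev_one ev)
    have "?d \<cdot>\<^sub>m (P * A + Q * C) = (?d \<cdot>\<^sub>m P) * A + Q * (?d \<cdot>\<^sub>m C)"
      by (simp add: add_smult_distrib_left_mat[of _ n n] mult_carrier_mat[of _ n n]
          mult_smult_assoc_mat[of _ n n _ n] mult_smult_distrib[of _ n n _ n])
    also have "\<dots> = ?d \<cdot>\<^sub>m (1\<^sub>m n * A)"
      by (simp add: away mult_smult_assoc_mat[of _ n n _ n] right_mult_zero_mat[of _ n n]
          left_mult_one_mat[of _ n n] right_add_zero_mat[of _ n n])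
    finally show "?d \<cdot>\<^sub>m (P * A + Q * C) = ?d \<cdot>\<^sub>m 1\<^sub>m n"
      by (simp add: away left_mult_one_mat[of _ n n])
  qed (auto intro!: add_carrier_mat mult_carrier_mat[of _ n n])
  have AC: "up.adjoint A * C \<in> carrier_mat n n"
    by (rule mult_carrier_mat[of _ n n]) auto
  have "up.adjoint (up.adjoint A * C) = up.adjoint A * C"
  proof (rule mat_eq_by_parts[of _ n])
    show "mat_ev n (up.adjoint (up.adjoint A * C)) = mat_ev n (up.adjoint A * C)"
      using sym by (simp add: mat_ev_adjoint mult_carrier_mat[of _ n n] mat_ev_mult ev sym_elements_def)
    have "star_upd ?d = ?d"
      by (simp add: up.star_hom.hom_minus up.star_one star_upd_upd_zero star_one unit_at_def)
    then have "?d \<cdot>\<^sub>m up.adjoint C = up.adjoint (?d \<cdot>\<^sub>m C)"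
      by (intro eq_matI) (auto simp: up.adjoint_def up.star_mult)
    also have "\<dots> = 0\<^sub>m n n"
      unfolding away by (intro eq_matI) (auto simp: up.adjoint_def up.star_zero)
    finally have "?d \<cdot>\<^sub>m (up.adjoint C * A) = 0\<^sub>m n n"
      by (simp add: mult_smult_assoc_mat[of _ n n _ n, symmetric] left_mult_zero_mat[of _ n n])
    moreover have "?d \<cdot>\<^sub>m (up.adjoint A * C) = 0\<^sub>m n n"
      by (simp add: mult_smult_distrib[of _ n n _ n, symmetric] away right_mult_zero_mat[of _ n n])
    ultimately show "?d \<cdot>\<^sub>m up.adjoint (up.adjoint A * C) = ?d \<cdot>\<^sub>m (up.adjoint A * C)"
      by (simp add: up.adjoint_mult[of _ n n _ n])
  qed (use AC in auto)
  then have herm: "up.hermitian n (up.adjoint A * C)"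
    using AC by (simp add: up.hermitian_def)
  have patch_up: "\<exists>z. z * z = z \<and> star_upd z = z \<and>
      z * (f * star_upd f) + (1 - z) * (g * star_upd g) dvd ?e * (f * star_upd f) \<and>
      z * (f * star_upd f) + (1 - z) * (g * star_upd g) dvd ?e * (g * star_upd g)" for f g
  proof -
    obtain z u v where z: "z \<in> carrier B" "z \<otimes> z = z" "star z = z" and uv: "u \<in> carrier B" "v \<in> carrier B"
      "ev f \<otimes> star (ev f) = (z \<otimes> (ev f \<otimes> star (ev f)) \<oplus> (\<one> \<ominus> z) \<otimes> (ev g \<otimes> star (ev g))) \<otimes> u"
      "ev g \<otimes> star (ev g) = (z \<otimes> (ev f \<otimes> star (ev f)) \<oplus> (\<one> \<ominus> z) \<otimes> (ev g \<otimes> star (ev g))) \<otimes> v"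
      using patch[unfolded norms_glue_def Let_def, rule_format, OF ev_closed ev_closed, of f g] by auto
    have "upd 0 z * upd 0 z = upd 0 z"
      using upd_upd_mult[of z z 0 0] z by simp
    moreover have "star_upd (upd 0 z) = upd 0 z"
      using z by (simp add: star_upd_upd_zero)
    ultimately show ?thesis
      using uv z by (intro exI[of _ "upd 0 z"] conjI dvd_unit_at_mult[of u] dvd_unit_at_mult[of v]) simp_all
  qed
  have unit_dvd: "d dvd ?e" if "ev d \<in> Units B" for d
    using dvd_unit_at_mult[of "inv (ev d)" 1 d] that by simp
  have "\<exists>S. up.hermitian n S \<and> det (A - S * C) * star_upd (det (A - S * C)) dvd ?e"
  proof (rule up.hermitian_shift_norm_dvd[OF unit_at_idem patch_up _ _ _ _ _ _ _ bezout herm])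
    show "star_upd (upd 0 \<kappa>) = upd 0 \<kappa>" using \<kappa> by (simp add: star_upd_upd_zero)
    show "upd 0 \<kappa> * upd 0 \<kappa> - upd 0 \<kappa> dvd ?e" using \<kappa> by (intro unit_dvd) simp
    show "star_upd (upd 0 \<theta>) - upd 0 \<theta> dvd ?e" using \<theta> by (intro unit_dvd) simp
  qed auto
  then obtain S t where S: "up.hermitian n S" and t: "?e = det (A - S * C) * star_upd (det (A - S * C)) * t"
    by (auto elim!: dvdE)
  have S': "S \<in> carrier_mat n n" "up.adjoint S = S" using S by (auto simp: up.hermitian_def)
  define U where "U = A - S * C"
  have SC: "S * C \<in> carrier_mat n n"
    by (rule mult_carrier_mat[of _ n n]) (use S' in auto)
  then have U: "U \<in> carrier_mat n n"
    unfolding U_def by (rule minus_carrier_mat)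
  note V = adj_mat[OF U]
  define V where "V = (star_upd (det U) * t) \<cdot>\<^sub>m adj_mat U"
  have V': "V \<in> carrier_mat n n" using V by (simp add: V_def)
  have tU: "?e = (star_upd (det U) * t) * det U"
    using t by (simp add: U_def ac_simps)
  have "U * V = (star_upd (det U) * t) \<cdot>\<^sub>m (U * adj_mat U)"
    unfolding V_def by (rule mult_smult_distrib[OF U V(1)])
  also have "\<dots> = ?e \<cdot>\<^sub>m 1\<^sub>m n"
    unfolding V(2) tU by (rule eq_matI) (auto simp: mult.assoc)
  finally have UV: "U * V = ?e \<cdot>\<^sub>m 1\<^sub>m n" .
  have "V * U = (star_upd (det U) * t) \<cdot>\<^sub>m (adj_mat U * U)"
    unfolding V_def by (rule mult_smult_assoc_mat[OF V(1) U])
  also have "\<dots> = ?e \<cdot>\<^sub>m 1\<^sub>m n"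
    unfolding V(3) tU by (rule eq_matI) (auto simp: mult.assoc)
  finally have VU: "V * U = ?e \<cdot>\<^sub>m 1\<^sub>m n" .
  have "mat_ev n (?e \<cdot>\<^sub>m 1\<^sub>m n) = mat_ev n (1\<^sub>m n)"
    by (auto simp: mat_ev_def fun_eq_iff restrict_def)
  then have "mat_ev n U \<otimes>\<^bsub>?M\<^esub> mat_ev n V = \<one>\<^bsub>?M\<^esub>" "mat_ev n V \<otimes>\<^bsub>?M\<^esub> mat_ev n U = \<one>\<^bsub>?M\<^esub>"
    unfolding mat_ev_mult[OF U V', symmetric] mat_ev_mult[OF V' U, symmetric] UV VU
    by (simp_all add: mat_ev_one)
  then have "mat_ev n U \<in> Units ?M"
    unfolding Units_def by (auto intro!: bexI[of _ "mat_ev n V"])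
  moreover have "mat_ev n S \<in> sym_elements ?M (matrix_star n star)"
    using S' by (simp add: sym_elements_def mat_ev_adjoint[symmetric])
  moreover have "S * C + U = A"
    unfolding U_def by (rule eq_matI) (use carrier(1,2)[THEN carrier_matD(1)] carrier(1,2)[THEN carrier_matD(2)] S'(1)[THEN carrier_matD(1)] in auto)
  then have "a = mat_ev n S \<otimes>\<^bsub>?M\<^esub> c \<oplus>\<^bsub>?M\<^esub> mat_ev n U"
    using mat_ev_add[OF SC U] mat_ev_mult[OF S'(1) carrier(2)] ev by simp
  ultimately show ?thesis by blast
qed

end

section \<open>Absolute values\<close>

locale abs_val =
  fixes v :: "'a::field \<Rightarrow> real"
  assumes absolute_value: "absolute_value v"
begin

lemma nonneg [simp]: "0 \<le> v x"
  and eq_zero_iff [simp]: "v x = 0 \<longleftrightarrow> x = 0"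
  and mult: "v (x * y) = v x * v y"
  and triangle: "v (x + y) \<le> v x + v y"
  using absolute_value unfolding absolute_value_def by blast+

lemma zero [simp]: "v 0 = 0"
  by simp

lemma pos [simp]: "0 < v x \<longleftrightarrow> x \<noteq> 0"
  using nonneg[of x] eq_zero_iff[of x] by linarith

lemma one [simp]: "v 1 = 1"
  using mult[of 1 1] eq_zero_iff[of 1] by simp

lemma minus [simp]: "v (- x) = v x"
proof -
  have "v (- 1) * v (- 1) = 1"
    using mult[of "- 1" "- 1"] by simp
  then have "v (- 1) = 1"
    using nonneg[of "- 1"] by (metis abs_of_nonneg real_sqrt_abs2 real_sqrt_one)
  then show ?thesis using mult[of "- 1" x] by simp
qed

lemma diff_commute: "v (x - y) = v (y - x)"
  using minus[of "x - y"] by simp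

lemma power: "v (x ^ n) = v x ^ n"
  by (induction n) (simp_all add: mult)

lemma inverse: "v (inverse x) = inverse (v x)"
  by (cases "x = 0") (use mult[of x "inverse x"] in \<open>simp_all add: field_simps\<close>)

lemma divide: "v (x / y) = v x / v y"
  by (simp add: divide_inverse mult inverse)

lemma power_int: "v (x powi m) = v x powi m"
  by (cases "m \<ge> 0") (simp_all add: power_int_def power inverse)

lemma abs_diff_le: "\<bar>v x - v y\<bar> \<le> v (x - y)"
  using triangle[of "x - y" y] triangle[of "y - x" x] diff_commute[of x y] by simp

end

lemma nontrivialD:
  assumes "v \<in> nontrivial_absolute_values"
  shows "abs_val v" and "\<exists>x. 1 < v x"
proof -
  from assms show "abs_val v"
    by (simp add: nontrivial_absolute_values_def abs_val_def)
  then interpret abs_val v .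
  obtain x where "x \<noteq> 0" "v x \<noteq> 1"
    using assms by (auto simp: nontrivial_absolute_values_def)
  then show "\<exists>x. 1 < v x"
  proof (cases "1 < v x")
    case False
    then have "0 < v x" "v x < 1" using \<open>x \<noteq> 0\<close> \<open>v x \<noteq> 1\<close> by simp_all
    then have "1 < v (inverse x)" by (simp add: inverse one_less_inverse_iff)
    then show ?thesis by blast
  qed blast
qed

text \<open>
  Comparing \<open>v (y\<^sup>n / x\<^sup>m)\<close> with \<open>1\<close> compares \<open>ln (v y) / ln (v x)\<close> with the rational \<open>m / n\<close>. The implication
  thus bounds \<open>ln (w y) / ln (w x)\<close> by \<open>ln (v y) / ln (v x)\<close>, and applied to \<open>1 / y\<close> it gives the reverse bound.
\<close>

lemma abs_equivI:
  fixes v w :: "'a::field \<Rightarrow> real"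
  assumes v: "v \<in> nontrivial_absolute_values" and w: "w \<in> nontrivial_absolute_values"
    and less: "\<And>x. v x < 1 \<Longrightarrow> w x < 1"
  shows "(v, w) \<in> abs_equiv"
proof -
  interpret v: abs_val v by (rule nontrivialD[OF v])
  interpret w: abs_val w by (rule nontrivialD[OF w])
  obtain x where x: "1 < v x" using nontrivialD[OF v] by blast
  then have "w (inverse x) < 1" by (intro less) (simp add: v.inverse inverse_less_1_iff)
  moreover have "x \<noteq> 0" using x by auto
  ultimately have wx: "1 < w x"
    using w.pos[of x] by (simp add: w.inverse inverse_less_1_iff del: w.pos)
  have pos: "0 < ln (v x)" "0 < ln (w x)" using x wx by (auto intro: ln_gt_zero)
  have le: "ln (w y) / ln (w x) \<le> ln (v y) / ln (v x)" if "y \<noteq> 0" for y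
  proof (rule ccontr)
    assume "\<not> ?thesis"
    then obtain q where "q \<in> \<rat>" "ln (v y) / ln (v x) < q" "q < ln (w y) / ln (w x)"
      using Rats_dense_in_real by (meson not_le)
    then obtain m n :: int where n: "0 < n" and q: "q = of_int m / of_int n"
      by (metis Rats_cases')
    have "ln (v y) * n < m * ln (v x)"
      using \<open>ln (v y) / ln (v x) < q\<close> n pos by (simp add: q field_simps)
    then have "ln (v (y powi n / x powi m)) < 0"
      using \<open>y \<noteq> 0\<close> \<open>x \<noteq> 0\<close>
      by (simp add: v.divide v.power_int ln_div powr_real_of_int'[symmetric] ln_powr algebra_simps)
    then have "v (y powi n / x powi m) < 1"
      using \<open>y \<noteq> 0\<close> \<open>x \<noteq> 0\<close> by (simp add: ln_less_zero_iff)
    then have "w (y powi n / x powi m) < 1" by (rule less)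
    then have "ln (w (y powi n / x powi m)) < 0"
      using \<open>y \<noteq> 0\<close> \<open>x \<noteq> 0\<close> by (simp add: ln_less_zero_iff)
    then have "ln (w y) * n < m * ln (w x)"
      using \<open>y \<noteq> 0\<close> \<open>x \<noteq> 0\<close>
      by (simp add: w.divide w.power_int ln_div powr_real_of_int'[symmetric] ln_powr algebra_simps)
    then show False
      using \<open>q < ln (w y) / ln (w x)\<close> n pos by (simp add: q field_simps)
  qed
  have eq: "ln (w y) / ln (w x) = ln (v y) / ln (v x)" if "y \<noteq> 0" for y
    using le[OF that] le[of "inverse y"] that by (simp add: v.inverse w.inverse ln_inverse)
  define s where "s = ln (w x) / ln (v x)"
  have "s > 0" using pos by (simp add: s_def)
  moreover have "w y = v y powr s" for y
  proof (cases "y = 0")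
    case False
    then have "ln (w y) = s * ln (v y)"
      using eq[OF False] pos by (simp add: s_def field_simps)
    then show ?thesis using False by (simp add: powr_def) (metis exp_ln w.pos)
  qed simp
  ultimately show ?thesis using v w by (auto simp: abs_equiv_def)
qed

lemma abs_equiv_equiv:
  "equiv (nontrivial_absolute_values :: ('a::field \<Rightarrow> real) set) abs_equiv" (is "equiv ?A ?E")
proof (rule equivI)
  show "?E \<subseteq> ?A \<times> ?A"
    by (auto simp: abs_equiv_def)
  show "refl_on ?A ?E"
    by (rule refl_onI) (auto intro: abs_equivI)
  show "sym ?E"
  proof (rule symI)
    fix v w :: "'a \<Rightarrow> real" assume vw: "(v, w) \<in> abs_equiv"
    then obtain s where s: "s > 0" "\<And>x. w x = v x powr s"
      and vw': "v \<in> nontrivial_absolute_values" "w \<in> nontrivial_absolute_values"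
      by (auto simp: abs_equiv_def)
    interpret v: abs_val v by (rule nontrivialD[OF vw'(1)])
    have "v x < 1" if "w x < 1" for x
    proof (rule ccontr)
      assume "\<not> v x < 1"
      then have "1 \<le> v x powr s" using s(1) by (intro ge_one_powr_ge_zero) auto
      then show False using that s(2) by simp
    qed
    then show "(w, v) \<in> abs_equiv" by (rule abs_equivI[OF vw'(2,1)])
  qed
  show "trans ?E"
  proof (rule transI)
    fix u v w :: "'a \<Rightarrow> real" assume "(u, v) \<in> abs_equiv" "(v, w) \<in> abs_equiv"
    then obtain s t where st: "s > 0" "t > 0" "\<And>x. v x = u x powr s" "\<And>x. w x = v x powr t"
      and n: "u \<in> nontrivial_absolute_values" "w \<in> nontrivial_absolute_values"
      by (auto simp: abs_equiv_def)
    then have "\<forall>x. w x = u x powr (s * t)" by (simp add: powr_powr)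
    moreover have "s * t > 0" using st by simp
    ultimately show "(u, w) \<in> abs_equiv" using n unfolding abs_equiv_def by blast
  qed
qed

lemma place_abs_nontrivial: "P \<in> places \<Longrightarrow> place_abs P \<in> nontrivial_absolute_values"
  and place_abs_inequivalent:
    "P \<in> places \<Longrightarrow> Q \<in> places \<Longrightarrow> P \<noteq> Q \<Longrightarrow> (place_abs P, place_abs Q) \<notin> abs_equiv"
proof -
  have mem: "place_abs P \<in> P" if "P \<in> places" for P :: "('a \<Rightarrow> real) set"
    using that in_quotient_imp_non_empty[OF abs_equiv_equiv] unfolding places_def place_abs_def
    by (metis all_not_in_conv someI_ex)
  then show "P \<in> places \<Longrightarrow> place_abs P \<in> nontrivial_absolute_values"
    using in_quotient_imp_subset[OF abs_equiv_equiv] unfolding places_def by blast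
  show "P \<in> places \<Longrightarrow> Q \<in> places \<Longrightarrow> P \<noteq> Q \<Longrightarrow> (place_abs P, place_abs Q) \<notin> abs_equiv"
    using quotient_eqI[OF abs_equiv_equiv] mem unfolding places_def by metis
qed

locale nonarch_abs_val = abs_val +
  assumes ultrametric: "v (x + y) \<le> max (v x) (v y)"
begin

lemma add_dominant: "v y < v x \<Longrightarrow> v (x + y) = v x"
  using ultrametric[of x y] ultrametric[of "x + y" "- y"] by auto

lemma sum_less: "0 < B \<Longrightarrow> (\<And>i. i \<in> I \<Longrightarrow> v (f i) < B) \<Longrightarrow> v (sum f I) < B"
proof (induction I rule: infinite_finite_induct)
  case (insert i I)
  then have "max (v (f i)) (v (sum f I)) < B" by simp
  from le_less_trans[OF ultrametric this] show ?case using insert by simp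
qed simp_all

lemma sum_le: "0 \<le> B \<Longrightarrow> (\<And>i. i \<in> I \<Longrightarrow> v (f i) \<le> B) \<Longrightarrow> v (sum f I) \<le> B"
proof (induction I rule: infinite_finite_induct)
  case (insert i I)
  then have "max (v (f i)) (v (sum f I)) \<le> B" by simp
  from order_trans[OF ultrametric this] show ?case using insert by simp
qed simp_all

lemma of_nat_le_one: "v (of_nat n) \<le> 1"
  by (induction n) (auto intro: order_trans[OF ultrametric])

lemma of_int_le_one: "v (of_int z) \<le> 1"
  by (cases z) (simp_all add: of_nat_le_one del: of_nat_Suc)

end

text \<open>
  Induction on \<open>W\<close>. If \<open>z\<close> separates \<open>v\<close> from \<open>W\<close> and \<open>u\<close> separates \<open>v\<close> from the new \<open>w\<close>, then \<open>z\<^sup>r u\<close> with \<open>r\<close> large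
  works when \<open>w z \<le> 1\<close>. Otherwise \<open>z\<^sup>r\<close> is replaced by \<open>z\<^sup>r / (1 + z\<^sup>r)\<close>, which has value \<open>1\<close> at \<open>v\<close> and \<open>w\<close> and
  is small on \<open>W\<close>.
\<close>

lemma separating_element:
  fixes v :: "'a::field \<Rightarrow> real"
  assumes "finite W" and v: "nonarch_abs_val v" "v \<in> nontrivial_absolute_values"
    and W: "\<And>w. w \<in> W \<Longrightarrow> nonarch_abs_val w" "\<And>w. w \<in> W \<Longrightarrow> w \<in> nontrivial_absolute_values"
      "\<And>w. w \<in> W \<Longrightarrow> (v, w) \<notin> abs_equiv"
  shows "\<exists>z. 1 < v z \<and> (\<forall>w\<in>W. w z < 1)"
  using assms(1) W
proof (induction W rule: finite_induct)
  case empty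
  then show ?case using nontrivialD[OF v(2)] by simp
next
  case (insert w W)
  interpret v: nonarch_abs_val v by (rule v(1))
  interpret w: nonarch_abs_val w using insert by blast
  obtain z where z: "1 < v z" "\<forall>w\<in>W. w z < 1" using insert by blast
  obtain u where u: "1 < v u" "w u < 1"
  proof -
    have w': "w \<in> nontrivial_absolute_values" and vw: "(v, w) \<notin> abs_equiv"
      using insert.prems by blast+
    then have wv: "(w, v) \<notin> abs_equiv"
      using abs_equiv_equiv unfolding equiv_def by (meson symE)
    obtain x y where xy: "v x < 1" "1 \<le> w x" "w y < 1" "1 \<le> v y"
      using abs_equivI[OF v(2) w'] abs_equivI[OF w' v(2)] vw wv by (meson not_le)
    have "x \<noteq> 0" using xy(2) by auto
    show ?thesis
    proof (rule that[of "y / x"])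
      have "0 < v x" "0 < w x" using \<open>x \<noteq> 0\<close> by simp_all
      then show "1 < v (y / x)" "w (y / x) < 1"
        using xy by (simp_all add: v.divide w.divide field_simps)
    qed
  qed
  have small: "eventually (\<lambda>r. \<forall>w'\<in>W. w' z ^ r * w' u < 1) sequentially"
  proof (rule eventually_ball_finite[OF insert.hyps(1)], rule ballI)
    fix w' assume "w' \<in> W"
    interpret w': nonarch_abs_val w' using insert \<open>w' \<in> W\<close> by blast
    have "(\<lambda>r. w' z ^ r * w' u) \<longlonglongrightarrow> 0 * w' u"
      by (intro tendsto_intros LIMSEQ_realpow_zero) (use z \<open>w' \<in> W\<close> in auto)
    then show "eventually (\<lambda>r. w' z ^ r * w' u < 1) sequentially"
      by (rule order_tendstoD) simp
  qed
  then obtain r where r: "r \<ge> 1" "\<And>w'. w' \<in> W \<Longrightarrow> w' z ^ r * w' u < 1"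
    using eventually_conj[OF small eventually_ge_at_top[of 1]] eventually_happens by force
  show ?case
  proof (cases "w z \<le> 1")
    case True
    have "1 < v (z ^ r * u)"
      using mult_right_mono[OF one_le_power[of "v z" r], of "v u"] z u by (simp add: v.mult v.power)
    moreover have "w (z ^ r * u) < 1"
      using mult_left_le_one_le[of "w u" "w z ^ r"] True u by (simp add: w.mult w.power power_le_one)
    moreover have "w' (z ^ r * u) < 1" if "w' \<in> W" for w'
    proof -
      interpret w': nonarch_abs_val w' using insert that by blast
      show ?thesis using r(2)[OF that] by (simp add: w'.mult w'.power)
    qed
    ultimately show ?thesis by blast
  next
    case False
    let ?x = "z ^ r / (1 + z ^ r) * u"
    have big: "a (?x) = a u" if "nonarch_abs_val a" "1 < a z" for a
    proof -
      interpret a: nonarch_abs_val a by fact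
      have "a 1 < a (z ^ r)" using that(2) r(1) by (simp add: a.power one_less_power)
      moreover have "z \<noteq> 0" using that(2) by auto
      ultimately have "a (1 + z ^ r) = a z ^ r" and "a z ^ r \<noteq> 0"
        using a.add_dominant[of 1 "z ^ r"] by (auto simp: add.commute a.power)
      then show ?thesis by (simp add: a.mult a.divide a.power)
    qed
    have "w' ?x < 1" if "w' \<in> W" for w'
    proof -
      interpret w': nonarch_abs_val w' using insert that by blast
      have "w' (z ^ r) < w' 1" using z(2) that r(1) by (simp add: w'.power power_Suc_less_one power_less_one_iff)
      then have "w' (1 + z ^ r) = 1" using w'.add_dominant[of "z ^ r" 1] by simp
      then show ?thesis using r(2)[OF that] by (simp add: w'.mult w'.divide w'.power)
    qed
    then show ?thesis
      using big[OF v(1) z(1)] big[OF w.nonarch_abs_val_axioms] False u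
      by (intro exI[of _ ?x]) simp
  qed
qed

section \<open>Poles over a euclidean ring\<close>

text \<open>
  A subring \<open>R\<close> of a field, exhausted by finite sets \<open>D N\<close> of elements of size at most \<open>N\<close>, with a
  division algorithm: the integers with the usual absolute value, and \<open>k[t]\<close> over a finite field \<open>k\<close> with
  \<open>D N\<close> the polynomials of degree less than \<open>N\<close>. The argument for the finiteness of poles is the
  same in both cases.
\<close>

locale euclidean_filtration =
  fixes D :: "nat \<Rightarrow> 'a::field set"
  assumes D_0: "D 0 = {0}"
    and D_finite: "finite (D N)"
    and one_D: "1 \<in> (\<Union>N. D N)"
    and mult_D: "a \<in> (\<Union>N. D N) \<Longrightarrow> b \<in> (\<Union>N. D N) \<Longrightarrow> a * b \<in> (\<Union>N. D N)"
    and diff_D: "a \<in> (\<Union>N. D N) \<Longrightarrow> b \<in> (\<Union>N. D N) \<Longrightarrow> a - b \<in> (\<Union>N. D N)"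
    and division: "b \<in> D (Suc N) \<Longrightarrow> b \<notin> D N \<Longrightarrow> a \<in> (\<Union>N. D N) \<Longrightarrow> \<exists>q\<in>(\<Union>N. D N). a - q * b \<in> D N"
begin

definition R :: "'a set" where "R = (\<Union>N. D N)"

lemma R_closed:
  "0 \<in> R" "1 \<in> R" "a \<in> R \<Longrightarrow> b \<in> R \<Longrightarrow> a * b \<in> R" "a \<in> R \<Longrightarrow> b \<in> R \<Longrightarrow> a - b \<in> R"
  "a \<in> R \<Longrightarrow> b \<in> R \<Longrightarrow> a + b \<in> R" "a \<in> R \<Longrightarrow> a ^ k \<in> R"
proof -
  show 0: "0 \<in> R" using D_0 by (auto simp: R_def)
  show 1: "1 \<in> R" using one_D by (simp add: R_def)
  show m: "a \<in> R \<Longrightarrow> b \<in> R \<Longrightarrow> a * b \<in> R" for a b using mult_D unfolding R_def by blast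
  show d: "a \<in> R \<Longrightarrow> b \<in> R \<Longrightarrow> a - b \<in> R" for a b using diff_D unfolding R_def by blast
  show "a \<in> R \<Longrightarrow> b \<in> R \<Longrightarrow> a + b \<in> R"
    using d[of a "0 - b"] d[OF 0, of b] by simp
  show "a \<in> R \<Longrightarrow> a ^ k \<in> R" by (induction k) (auto intro: 1 m)
qed

lemma R_prod: "(\<And>i. i \<in> I \<Longrightarrow> f i \<in> R) \<Longrightarrow> prod f I \<in> R"
  by (induction I rule: infinite_finite_induct) (auto intro: R_closed)

lemma level_of:
  assumes "b \<in> R" "b \<noteq> 0"
  obtains N where "b \<in> D (Suc N)" "b \<notin> D N"
proof -
  define M where "M = (LEAST N. b \<in> D N)"
  have "b \<in> D M" unfolding M_def by (rule LeastI_ex) (use assms in \<open>auto simp: R_def\<close>)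
  moreover from this have "M \<noteq> 0" using D_0 assms(2) by (metis singletonD)
  then obtain N where "M = Suc N" by (cases M) auto
  moreover have "b \<notin> D N" using not_less_Least[of N "\<lambda>N. b \<in> D N"] \<open>M = Suc N\<close> unfolding M_def by simp
  ultimately show ?thesis using that by blast
qed

lemma division_R: "b \<in> D (Suc N) \<Longrightarrow> b \<notin> D N \<Longrightarrow> a \<in> R \<Longrightarrow> \<exists>q\<in>R. a - q * b \<in> D N"
  using division unfolding R_def by blast

definition integral_abs :: "('a \<Rightarrow> real) \<Rightarrow> bool" where
  "integral_abs v \<longleftrightarrow> nonarch_abs_val v \<and> v \<in> nontrivial_absolute_values \<and> (\<forall>a\<in>R. v a \<le> 1)"

text \<open>
  For \<open>v\<close> with \<open>integral_abs v\<close> this is a prime ideal of \<open>R\<close>, the center of the place \<open>v\<close> on \<open>R\<close>.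
\<close>

definition center :: "('a \<Rightarrow> real) \<Rightarrow> 'a set" where
  "center v = {a \<in> R. v a < 1}"

text \<open>
  An element \<open>\<pi>\<close> of minimal size in the common center \<open>\<pp>\<close> generates it, by division with remainder. An
  element of \<open>R\<close> is a power of \<open>\<pi>\<close> times an element outside \<open>\<pp>\<close>, and the latter has value \<open>1\<close> under all of
  \<open>V\<close>. Up to equivalence the absolute values in \<open>V\<close> therefore agree on \<open>R\<close>.
\<close>

lemma common_uniformizer:
  assumes V: "\<And>v. v \<in> V \<Longrightarrow> integral_abs v \<and> center v = \<pp>" and "c \<in> \<pp>" "c \<noteq> 0"
  shows "\<exists>\<pi>. (\<forall>v\<in>V. 0 < v \<pi> \<and> v \<pi> < 1) \<and> (\<forall>a\<in>R - {0}. \<exists>k. \<forall>v\<in>V. v a = v \<pi> ^ k)"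
proof (cases "V = {}")
  case False
  then obtain v\<^sub>0 where v\<^sub>0: "v\<^sub>0 \<in> V" by blast
  interpret v\<^sub>0: nonarch_abs_val v\<^sub>0 using V[OF v\<^sub>0] by (simp add: integral_abs_def)
  have \<pp>: "\<pp> = {a \<in> R. v a < 1}" if "v \<in> V" for v
    using V[OF that] by (simp add: center_def)
  define N where "N = (LEAST N. \<exists>a\<in>D N. a \<in> \<pp> \<and> a \<noteq> 0)"
  have "\<exists>N. \<exists>a\<in>D N. a \<in> \<pp> \<and> a \<noteq> 0"
    using assms(2,3) \<pp>[OF v\<^sub>0] unfolding R_def by blast
  then have "\<exists>a\<in>D N. a \<in> \<pp> \<and> a \<noteq> 0" unfolding N_def by (rule LeastI_ex)
  then obtain \<pi> where \<pi>: "\<pi> \<in> D N" "\<pi> \<in> \<pp>" "\<pi> \<noteq> 0" by blast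
  then have "N \<noteq> 0" using D_0 by (metis singletonD)
  then obtain M where M: "N = Suc M" by (cases N) auto
  have min: "a = 0" if "a \<in> D M" "a \<in> \<pp>" for a
    using not_less_Least[of M "\<lambda>N. \<exists>a\<in>D N. a \<in> \<pp> \<and> a \<noteq> 0", folded N_def] that M by blast
  then have "\<pi> \<notin> D M" using \<pi> by blast
  have multiple: "\<exists>q\<in>R. a = q * \<pi>" if a: "a \<in> \<pp>" for a
  proof -
    have "a \<in> R" using a \<pp>[OF v\<^sub>0] by blast
    then obtain q where q: "q \<in> R" "a - q * \<pi> \<in> D M"
      using division_R[of \<pi> M a] \<pi>(1) M \<open>\<pi> \<notin> D M\<close> by blast
    have "v\<^sub>0 q \<le> 1" using V[OF v\<^sub>0] q(1) by (simp add: integral_abs_def)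
    then have "v\<^sub>0 (q * \<pi>) < 1"
      using mult_left_le_one_le[of "v\<^sub>0 \<pi>" "v\<^sub>0 q"] \<pi>(2) \<pp>[OF v\<^sub>0] by (simp add: v\<^sub>0.mult)
    moreover have "v\<^sub>0 a < 1" using a \<pp>[OF v\<^sub>0] by blast
    ultimately have "v\<^sub>0 (a - q * \<pi>) < 1"
      using v\<^sub>0.ultrametric[of a "- (q * \<pi>)"] by simp
    moreover have "a - q * \<pi> \<in> R"
      using \<open>a \<in> R\<close> q(1) \<pi>(2) \<pp>[OF v\<^sub>0] by (auto intro: R_closed)
    ultimately have "a - q * \<pi> = 0" using min[OF q(2)] \<pp>[OF v\<^sub>0] by blast
    then show ?thesis using q(1) by auto
  qed
  have \<pi>v: "0 < v \<pi> \<and> v \<pi> < 1" if "v \<in> V" for v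
  proof -
    interpret nonarch_abs_val v using V[OF that] by (simp add: integral_abs_def)
    show ?thesis using \<pi> \<pp>[OF that] by simp
  qed
  have "\<exists>k. \<forall>v\<in>V. v a = v \<pi> ^ k" if a: "a \<in> R" "a \<noteq> 0" for a
  proof -
    have ex: "\<exists>k. \<not> (\<exists>q\<in>R. a = \<pi> ^ k * q)"
    proof (rule ccontr)
      assume all: "\<nexists>k. \<not> (\<exists>q\<in>R. a = \<pi> ^ k * q)"
      have "v\<^sub>0 a \<le> v\<^sub>0 \<pi> ^ k" for k
      proof -
        obtain q where "q \<in> R" "a = \<pi> ^ k * q" using all by blast
        then show ?thesis
          using V[OF v\<^sub>0] mult_left_le[of "v\<^sub>0 q" "v\<^sub>0 \<pi> ^ k"] by (simp add: integral_abs_def v\<^sub>0.mult v\<^sub>0.power)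
      qed
      moreover have "(\<lambda>k. v\<^sub>0 \<pi> ^ k) \<longlonglongrightarrow> 0"
        using \<pi>v[OF v\<^sub>0] by (intro LIMSEQ_realpow_zero) auto
      ultimately have "v\<^sub>0 a \<le> 0" by (intro LIMSEQ_le_const) auto
      then show False using a(2) v\<^sub>0.pos[of a] by linarith
    qed
    define K where "K = (LEAST k. \<not> (\<exists>q\<in>R. a = \<pi> ^ k * q))"
    have K: "\<not> (\<exists>q\<in>R. a = \<pi> ^ K * q)"
      unfolding K_def using ex by (rule LeastI_ex)
    then have "K \<noteq> 0" using a(1) by (intro notI) auto
    then obtain k where k: "K = Suc k" by (cases K) auto
    then have "\<exists>q\<in>R. a = \<pi> ^ k * q"
      using not_less_Least[of k "\<lambda>k. \<not> (\<exists>q\<in>R. a = \<pi> ^ k * q)"] unfolding K_def by auto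
    then obtain q where q: "q \<in> R" "a = \<pi> ^ k * q" by blast
    have "q \<notin> \<pp>"
    proof
      assume "q \<in> \<pp>"
      then obtain q' where "q' \<in> R" "q = q' * \<pi>" using multiple by blast
      then show False using K k q by (auto simp: ac_simps)
    qed
    have "v a = v \<pi> ^ k" if "v \<in> V" for v
    proof -
      interpret nonarch_abs_val v using V[OF that] by (simp add: integral_abs_def)
      have "v q = 1"
        using \<open>q \<notin> \<pp>\<close> \<pp>[OF that] q(1) V[OF that] by (force simp: integral_abs_def)
      then show ?thesis by (simp add: q(2) mult power)
    qed
    then show ?thesis by blast
  qed
  then show ?thesis using \<pi>v by blast
qed auto

text \<open>
  Suppose there are \<open>m + 1\<close> of them, and let \<open>z v\<close> be large at \<open>v\<close> and small at the others. In a relation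
  \<open>\<Sum> c\<^sub>v z v = 0\<close> with coefficients in \<open>R\<close> choose the coefficient \<open>c\<^sub>v\<close> of least order; since the orders
  are the same for all absolute values, the term \<open>c\<^sub>v z v\<close> is strictly dominant at \<open>v\<close>.
\<close>

lemma finite_with_center:
  fixes V :: "('a \<Rightarrow> real) set"
  assumes dep: "\<And>z :: nat \<Rightarrow> 'a. \<exists>c. (\<forall>i\<le>m. c i \<in> R) \<and> (\<exists>i\<le>m. c i \<noteq> 0) \<and> (\<Sum>i\<le>m. c i * z i) = 0"
    and V: "\<And>v. v \<in> V \<Longrightarrow> integral_abs v \<and> center v = \<pp>" and "c\<^sub>0 \<in> \<pp>" "c\<^sub>0 \<noteq> 0"
    and ineq: "\<And>v w. v \<in> V \<Longrightarrow> w \<in> V \<Longrightarrow> v \<noteq> w \<Longrightarrow> (v, w) \<notin> abs_equiv"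
  shows "finite V"
proof (rule ccontr)
  assume "infinite V"
  then obtain W where W: "W \<subseteq> V" "finite W" "card W = Suc m"
    by (meson infinite_arbitrarily_large)
  then obtain vs where vs: "bij_betw vs {..m} W"
    by (metis finite_same_card_bij lessThan_Suc_atMost card_lessThan finite_lessThan)
  then have vsW: "vs i \<in> W" if "i \<le> m" for i
    using that by (auto simp: bij_betw_def)
  have inj: "vs i \<noteq> vs j" if "i \<le> m" "j \<le> m" "i \<noteq> j" for i j
    using vs that by (auto simp: bij_betw_def inj_on_def)
  have nonarch: "nonarch_abs_val v" "v \<in> nontrivial_absolute_values" if "v \<in> W" for v
    using V[of v] W that by (auto simp: integral_abs_def)
  have "\<exists>z. 1 < v z \<and> (\<forall>w\<in>W - {v}. w z < 1)" if "v \<in> W" for v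
  proof (rule separating_element)
    show "finite (W - {v})" using W by simp
    show "(v, w) \<notin> abs_equiv" if "w \<in> W - {v}" for w
      using ineq[of v w] W(1) that \<open>v \<in> W\<close> by blast
  qed (use nonarch that in blast)+
  then obtain z where z: "\<And>v. v \<in> W \<Longrightarrow> 1 < v (z v)" "\<And>v w. v \<in> W \<Longrightarrow> w \<in> W \<Longrightarrow> w \<noteq> v \<Longrightarrow> w (z v) < 1"
    by (metis DiffI singletonD)
  obtain c where c: "\<forall>i\<le>m. c i \<in> R" "\<exists>i\<le>m. c i \<noteq> 0" "(\<Sum>i\<le>m. c i * z (vs i)) = 0"
    using dep[of "\<lambda>i. z (vs i)"] by blast
  obtain \<pi> where \<pi>: "\<forall>v\<in>V. 0 < v \<pi> \<and> v \<pi> < 1" "\<forall>a\<in>R - {0}. \<exists>k. \<forall>v\<in>V. v a = v \<pi> ^ k"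
    using common_uniformizer[OF V assms(3,4)] by blast
  then obtain ord where ord: "\<And>a v. a \<in> R \<Longrightarrow> a \<noteq> 0 \<Longrightarrow> v \<in> V \<Longrightarrow> v a = v \<pi> ^ ord a"
    by (metis DiffI singletonD)
  obtain i where i: "i \<le> m" "c i \<noteq> 0" "\<And>j. j \<le> m \<Longrightarrow> c j \<noteq> 0 \<Longrightarrow> ord (c i) \<le> ord (c j)"
  proof -
    have "\<exists>i. (i \<le> m \<and> c i \<noteq> 0) \<and> (\<forall>j. (j \<le> m \<and> c j \<noteq> 0) \<longrightarrow> ord (c i) \<le> ord (c j))"
      using ex_has_least_nat[of "\<lambda>i. i \<le> m \<and> c i \<noteq> 0" _ "\<lambda>i. ord (c i)"] c(2) by blast
    then show ?thesis using that by blast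
  qed
  define v where "v = vs i"
  have v: "v \<in> W" "v \<in> V" using vsW[OF i(1)] W by (auto simp: v_def)
  interpret nonarch_abs_val v by (rule nonarch(1)[OF v(1)])
  have "0 < v (c i)" using i(2) by simp
  have "v (\<Sum>j\<in>{..m} - {i}. c j * z (vs j)) < v (c i)"
  proof (rule sum_less)
    fix j assume j: "j \<in> {..m} - {i}"
    have zj: "v (z (vs j)) < 1" using z(2)[of "vs j" v] vsW j inj i(1) v by (auto simp: v_def)
    have "v (c j) \<le> v (c i)"
    proof (cases "c j = 0")
      case False
      then show ?thesis
        using ord[of "c j" v] ord[of "c i" v] c(1) i j v \<pi>(1) power_decreasing[of "ord (c i)" "ord (c j)" "v \<pi>"]
        by (auto simp: less_imp_le)
    qed simp
    then have "v (c j) * v (z (vs j)) \<le> v (c i) * v (z (vs j))" by (intro mult_right_mono) auto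
    also have "\<dots> < v (c i)" using zj \<open>0 < v (c i)\<close> by simp
    finally show "v (c j * z (vs j)) < v (c i)" by (simp add: mult)
  qed fact
  moreover have "(\<Sum>j\<in>{..m} - {i}. c j * z (vs j)) = - (c i * z v)"
    using c(3) i(1) sum.remove[of "{..m}" i "\<lambda>j. c j * z (vs j)"] by (simp add: v_def eq_neg_iff_add_eq_0 add.commute)
  moreover have "v (c i) < v (c i * z v)"
    using z(1)[OF v(1)] \<open>0 < v (c i)\<close> by (simp add: mult)
  ultimately show False by simp
qed

text \<open>
  Otherwise the leading term would dominate the equation at \<open>v\<close>.
\<close>

lemma leading_coefficient_small:
  assumes "nonarch_abs_val v" "\<forall>a\<in>R. v a \<le> 1" "\<forall>i\<le>k. c i \<in> R" "(\<Sum>i\<le>k. c i * x ^ i) = 0" "1 < v x" "c k \<noteq> 0"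
  shows "v (c k) < 1"
proof (rule ccontr)
  interpret nonarch_abs_val v by fact
  assume "\<not> v (c k) < 1"
  have "v (\<Sum>i<k. c i * x ^ i) < v x ^ k"
  proof (rule sum_less)
    fix i assume i: "i \<in> {..<k}"
    have "v (c i) \<le> 1" using assms(2,3) i by auto
    then have "v (c i * x ^ i) \<le> v x ^ i"
      using mult_right_mono[of "v (c i)" 1 "v x ^ i"] by (simp add: mult power)
    also have "\<dots> < v x ^ k" using assms(5) i by (intro power_strict_increasing) auto
    finally show "v (c i * x ^ i) < v x ^ k" .
  qed (rule zero_less_power, use assms(5) in linarith)
  moreover have "(\<Sum>i<k. c i * x ^ i) = - (c k * x ^ k)"
    using assms(4) by (simp add: lessThan_Suc_atMost[symmetric] eq_neg_iff_add_eq_0)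
  moreover have "v x ^ k \<le> v (c k * x ^ k)"
    using \<open>\<not> v (c k) < 1\<close> mult_right_mono[of 1 "v (c k)" "v x ^ k"] by (simp add: mult power)
  ultimately show False by simp
qed

text \<open>
  The element \<open>x\<close> satisfies an equation over \<open>R\<close>, and its leading coefficient \<open>c\<close> lies in the center of
  every member of \<open>V\<close>. A center containing \<open>c\<close> is determined by the remainders modulo \<open>c\<close> in it, and there are only
  finitely many remainders. So finitely many centers occur, each for finitely many absolute values.
\<close>

theorem finite_inequivalent:
  fixes V :: "('a \<Rightarrow> real) set"
  assumes dep: "\<And>z :: nat \<Rightarrow> 'a. \<exists>c. (\<forall>i\<le>m. c i \<in> R) \<and> (\<exists>i\<le>m. c i \<noteq> 0) \<and> (\<Sum>i\<le>m. c i * z i) = 0"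
    and V: "\<And>v. v \<in> V \<Longrightarrow> integral_abs v \<and> 1 < v x"
    and ineq: "\<And>v w. v \<in> V \<Longrightarrow> w \<in> V \<Longrightarrow> v \<noteq> w \<Longrightarrow> (v, w) \<notin> abs_equiv"
  shows "finite V"
proof -
  obtain c where c: "\<forall>i\<le>m. c i \<in> R" "\<exists>i\<le>m. c i \<noteq> 0" "(\<Sum>i\<le>m. c i * x ^ i) = 0"
    using dep[of "\<lambda>i. x ^ i"] by blast
  define k where "k = (GREATEST i. i \<le> m \<and> c i \<noteq> 0)"
  have k: "k \<le> m" "c k \<noteq> 0"
    using GreatestI_ex_nat[of "\<lambda>i. i \<le> m \<and> c i \<noteq> 0" m] c(2) unfolding k_def by auto
  have "c i = 0" if "k < i" "i \<le> m" for i
    using Greatest_le_nat[of "\<lambda>i. i \<le> m \<and> c i \<noteq> 0" i m] that unfolding k_def by force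
  then have "(\<Sum>i\<le>k. c i * x ^ i) = (\<Sum>i\<le>m. c i * x ^ i)"
    using k(1) by (intro sum.mono_neutral_left) auto
  then have "v (c k) < 1" if "v \<in> V" for v
    using leading_coefficient_small[of v k c x] V[OF that] c k by (auto simp: integral_abs_def)
  moreover have "c k \<in> R" using c k by blast
  ultimately have mem: "c k \<in> center v" if "v \<in> V" for v using that by (simp add: center_def)
  obtain N where N: "c k \<in> D (Suc N)" "c k \<notin> D N" using level_of \<open>c k \<in> R\<close> k(2) by blast
  have center_eq: "center v \<subseteq> center w" if vw: "v \<in> V" "w \<in> V" "center v \<inter> D N = center w \<inter> D N" for v w
  proof
    interpret v: nonarch_abs_val v using V vw by (simp add: integral_abs_def)
    interpret w: nonarch_abs_val w using V vw by (simp add: integral_abs_def)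
    fix a assume a: "a \<in> center v"
    then have "a \<in> R" by (simp add: center_def)
    then obtain q where q: "q \<in> R" "a - q * c k \<in> D N" using division_R N by blast
    have small: "u (q * c k) < 1" if "u \<in> V" for u
    proof -
      interpret u: nonarch_abs_val u using V that by (simp add: integral_abs_def)
      have "u q \<le> 1" "u (c k) < 1" using V[OF that] q mem[OF that] by (auto simp: integral_abs_def center_def)
      then show ?thesis using mult_left_le_one_le[of "u (c k)" "u q"] by (simp add: u.mult)
    qed
    have "v (a - q * c k) < 1"
      using v.ultrametric[of a "- (q * c k)"] small[OF vw(1)] a
      by (auto simp: center_def max_def split: if_splits)
    then have "a - q * c k \<in> center v"
      using \<open>a \<in> R\<close> q(1) \<open>c k \<in> R\<close> by (auto simp: center_def intro: R_closed)
    then have "a - q * c k \<in> center w" using vw(3) q(2) by blast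
    then have "w (a - q * c k + q * c k) < 1"
      using w.ultrametric[of "a - q * c k" "q * c k"] small[OF vw(2)]
      by (auto simp: center_def max_def split: if_splits)
    then show "a \<in> center w" using \<open>a \<in> R\<close> by (simp add: center_def)
  qed
  have "finite {v \<in> V. center v \<inter> D N = P}" for P
  proof (cases "{v \<in> V. center v \<inter> D N = P} = {}")
    case False
    then obtain v where v: "v \<in> V" "center v \<inter> D N = P" by blast
    show ?thesis
    proof (rule finite_with_center[OF dep, of _ "center v"])
      show "integral_abs w \<and> center w = center v" if "w \<in> {v \<in> V. center v \<inter> D N = P}" for w
        using that V[of w] center_eq[of v w] center_eq[of w v] v by blast
      show "c k \<in> center v" "c k \<noteq> 0" using mem v k by blast+
    qed (use ineq in blast)
  next
    case True
    show ?thesis unfolding True by simp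
  qed
  then have "finite (\<Union>P\<in>Pow (D N). {v \<in> V. center v \<inter> D N = P})"
    by (intro finite_UN_I) (simp_all add: D_finite)
  moreover have "V \<subseteq> (\<Union>P\<in>Pow (D N). {v \<in> V. center v \<inter> D N = P})"
    by (intro subsetI, rule UN_I[of "center v \<inter> D N" for v]) simp_all
  ultimately show ?thesis using finite_subset by blast
qed

end

lemma nonarchimedean_place:
  assumes "P \<in> places" "nonarchimedean P"
  shows "nonarch_abs_val (place_abs P)"
  using nontrivialD(1)[OF place_abs_nontrivial[OF assms(1)]] assms(2)
  by (simp add: nonarch_abs_val_def nonarch_abs_val_axioms_def nonarchimedean_def)

theorem (in euclidean_filtration) finite_integral_places:
  fixes x :: 'a
  assumes "\<And>z :: nat \<Rightarrow> 'a. \<exists>c. (\<forall>i\<le>m. c i \<in> R) \<and> (\<exists>i\<le>m. c i \<noteq> 0) \<and> (\<Sum>i\<le>m. c i * z i) = 0"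
  shows "finite {P \<in> places. nonarchimedean P \<and> (\<forall>a\<in>R. place_abs P a \<le> 1) \<and> 1 < place_abs P x}"
    (is "finite ?S")
proof -
  have "finite (place_abs ` ?S)"
  proof (rule finite_inequivalent[OF assms, of _ x])
    fix v assume "v \<in> place_abs ` ?S"
    then obtain P where "P \<in> ?S" "v = place_abs P" by blast
    then show "integral_abs v \<and> 1 < v x"
      using nonarchimedean_place[of P] place_abs_nontrivial[of P] by (simp add: integral_abs_def)
  next
    show "(v, w) \<notin> abs_equiv" if "v \<in> place_abs ` ?S" "w \<in> place_abs ` ?S" "v \<noteq> w" for v w
      using that place_abs_inequivalent by blast
  qed
  moreover have "inj_on place_abs ?S"
  proof (rule inj_onI)
    fix P Q :: "('a \<Rightarrow> real) set"
    assume PQ: "P \<in> ?S" "Q \<in> ?S" "place_abs P = place_abs Q"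
    have "P \<in> places" "Q \<in> places" using PQ by simp_all
    moreover from this have "(place_abs P, place_abs Q) \<in> abs_equiv"
      unfolding PQ(3) by (intro abs_equivI place_abs_nontrivial)
    ultimately show "P = Q" using place_abs_inequivalent by blast
  qed
  ultimately show ?thesis by (rule finite_imageD)
qed

section \<open>Poles in global fields\<close>

lemma type_ring_simps:
  "carrier (ring_of_type_algebra :: 'a::field ring) = UNIV"
  "x \<otimes>\<^bsub>ring_of_type_algebra\<^esub> y = (x * y :: 'a)"
  "x \<oplus>\<^bsub>ring_of_type_algebra\<^esub> y = (x + y :: 'a)"
  "\<one>\<^bsub>ring_of_type_algebra\<^esub> = (1 :: 'a)"
  "\<zero>\<^bsub>ring_of_type_algebra\<^esub> = (0 :: 'a)"
  by (simp_all add: ring_of_type_algebra_def)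

lemma type_ring_field: "field (ring_of_type_algebra :: 'a::field ring)"
  by (rule field_from_type_algebra)

lemma type_ring_a_inv: "\<ominus>\<^bsub>ring_of_type_algebra\<^esub> x = (- x :: 'a::field)"
proof -
  interpret field "ring_of_type_algebra :: 'a ring" by (rule type_ring_field)
  have "(- x) \<oplus>\<^bsub>ring_of_type_algebra\<^esub> x = \<zero>\<^bsub>ring_of_type_algebra\<^esub>" by (simp add: type_ring_simps)
  then show ?thesis by (rule minus_equality) (simp_all add: type_ring_simps)
qed

lemma type_ring_m_inv: "x \<noteq> 0 \<Longrightarrow> inv\<^bsub>ring_of_type_algebra\<^esub> x = inverse (x :: 'a::field)"
proof -
  interpret field "ring_of_type_algebra :: 'a ring" by (rule type_ring_field)
  assume "x \<noteq> 0"
  then show ?thesis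
    by (intro inv_unique'[symmetric]) (simp_all add: type_ring_simps)
qed

lemma subfield_typeI:
  fixes K :: "'a::field set"
  assumes "1 \<in> K" "\<And>x. x \<in> K \<Longrightarrow> - x \<in> K" "\<And>x y. x \<in> K \<Longrightarrow> y \<in> K \<Longrightarrow> x + y \<in> K"
    "\<And>x y. x \<in> K \<Longrightarrow> y \<in> K \<Longrightarrow> x * y \<in> K" "\<And>x. x \<in> K \<Longrightarrow> x \<noteq> 0 \<Longrightarrow> inverse x \<in> K"
  shows "subfield K ring_of_type_algebra"
proof -
  interpret field "ring_of_type_algebra :: 'a ring" by (rule type_ring_field)
  have "subring K ring_of_type_algebra"
    by (rule subringI) (use assms in \<open>simp_all add: type_ring_simps type_ring_a_inv\<close>)
  then show ?thesis
    by (rule subfieldI') (use assms in \<open>simp add: type_ring_simps type_ring_m_inv\<close>)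
qed

lemma subfield_typeD:
  fixes K :: "'a::field set"
  assumes "subfield K ring_of_type_algebra"
  shows "0 \<in> K" "1 \<in> K" "x \<in> K \<Longrightarrow> - x \<in> K" "x \<in> K \<Longrightarrow> y \<in> K \<Longrightarrow> x + y \<in> K"
    "x \<in> K \<Longrightarrow> y \<in> K \<Longrightarrow> x - y \<in> K" "x \<in> K \<Longrightarrow> y \<in> K \<Longrightarrow> x * y \<in> K" "x \<in> K \<Longrightarrow> inverse x \<in> K"
    "x \<in> K \<Longrightarrow> y \<in> K \<Longrightarrow> x / y \<in> K"
proof -
  interpret field "ring_of_type_algebra :: 'a ring" by (rule type_ring_field)
  note E = subringE[OF subfieldE(1)[OF assms], unfolded type_ring_simps]
  show 0: "0 \<in> K" and "1 \<in> K" and uminus: "x \<in> K \<Longrightarrow> - x \<in> K" for x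
    using E(2,3) E(5)[of x] by (auto simp: type_ring_a_inv)
  show add: "x \<in> K \<Longrightarrow> y \<in> K \<Longrightarrow> x + y \<in> K" and mult: "x \<in> K \<Longrightarrow> y \<in> K \<Longrightarrow> x * y \<in> K" for x y
    using E(6,7)[of x y] by auto
  show "x \<in> K \<Longrightarrow> y \<in> K \<Longrightarrow> x - y \<in> K"
    using add[of x "- y"] uminus by simp
  show inv: "x \<in> K \<Longrightarrow> inverse x \<in> K" for x
    using subfield_m_inv(1)[OF assms, of x] 0 by (cases "x = 0") (auto simp: type_ring_simps type_ring_m_inv)
  show "x \<in> K \<Longrightarrow> y \<in> K \<Longrightarrow> x / y \<in> K"
    using mult inv by (simp add: divide_inverse)
qed

lemma combine_type:
  fixes Ks :: "'a::field list"
  assumes "length Ks = length Us"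
  shows "ring.combine ring_of_type_algebra Ks Us = (\<Sum>i<length Us. Ks ! i * Us ! i)"
proof -
  interpret field "ring_of_type_algebra :: 'a ring" by (rule type_ring_field)
  from assms show ?thesis
  proof (induction Ks Us rule: list_induct2)
    case (Cons k Ks u Us)
    then show ?case
      by (simp add: type_ring_simps sum.lessThan_Suc_shift del: sum.lessThan_Suc)
  qed (simp add: type_ring_simps)
qed

lemma dimension_dependence:
  fixes K :: "'a::field set" and z :: "nat \<Rightarrow> 'a"
  assumes K: "subfield K ring_of_type_algebra" and "ring.dimension ring_of_type_algebra m K UNIV"
  shows "\<exists>k. (\<forall>i\<le>m. k i \<in> K) \<and> (\<exists>i\<le>m. k i \<noteq> 0) \<and> (\<Sum>i\<le>m. k i * z i) = 0"
proof -
  interpret field "ring_of_type_algebra :: 'a ring" by (rule type_ring_field)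
  let ?Us = "map z [0..<Suc m]"
  have "\<not> independent K ?Us"
    using independent_length_le_dimension[OF K assms(2), of ?Us] by auto
  then obtain Ks where Ks: "length Ks = length ?Us" "combine Ks ?Us = \<zero>\<^bsub>ring_of_type_algebra\<^esub>"
    "set Ks \<subseteq> K" "set Ks \<noteq> {\<zero>\<^bsub>ring_of_type_algebra\<^esub>}"
    using dependent_imp_non_trivial_combine[OF K, of ?Us] by (auto simp: type_ring_simps)
  have len: "length Ks = Suc m" using Ks(1) by simp
  then have "Ks \<noteq> []" by auto
  then have "\<exists>x\<in>set Ks. x \<noteq> 0" using Ks(4) by (cases Ks) (auto simp: type_ring_simps)
  then have "\<exists>i\<le>m. Ks ! i \<noteq> 0" using len by (auto simp: in_set_conv_nth less_Suc_eq_le)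
  moreover have "(\<Sum>i\<le>m. Ks ! i * z i) = 0"
  proof -
    have "(\<Sum>i\<le>m. Ks ! i * z i) = (\<Sum>i<length ?Us. Ks ! i * ?Us ! i)"
      by (rule sum.cong) (auto simp del: upt_Suc)
    then show ?thesis using Ks(2) unfolding combine_type[OF Ks(1)] by (simp add: type_ring_simps)
  qed
  moreover have "\<forall>i\<le>m. Ks ! i \<in> K"
    using Ks(3) len by (auto simp: less_Suc_eq_le intro!: subsetD[OF Ks(3)])
  ultimately show ?thesis by blast
qed

context euclidean_filtration
begin

lemma fractions_subfield: "subfield {a / b | a b. a \<in> R \<and> b \<in> R \<and> b \<noteq> 0} ring_of_type_algebra"
    (is "subfield ?Q _")
proof (rule subfield_typeI)
  have frac: "a / b \<in> ?Q" if "a \<in> R" "b \<in> R" "b \<noteq> 0" for a b using that by blast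
  show "1 \<in> ?Q" using frac[of 1 1] R_closed(2) by simp
  show "- x \<in> ?Q" if x: "x \<in> ?Q" for x
  proof -
    obtain a b where ab: "a \<in> R" "b \<in> R" "b \<noteq> 0" "x = a / b" using x by blast
    then show ?thesis using frac[OF R_closed(4)[OF R_closed(1) ab(1)] ab(2,3)] by simp
  qed
  show "inverse x \<in> ?Q" if x: "x \<in> ?Q" and "x \<noteq> 0" for x
  proof -
    obtain a b where "a \<in> R" "b \<in> R" "b \<noteq> 0" "x = a / b" using x by blast
    then show ?thesis using frac[of b a] \<open>x \<noteq> 0\<close> by simp
  qed
  fix x y assume "x \<in> ?Q" "y \<in> ?Q"
  then obtain a b c d where abcd: "a \<in> R" "b \<in> R" "b \<noteq> 0" "x = a / b" "c \<in> R" "d \<in> R" "d \<noteq> 0" "y = c / d"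
    by blast
  have "(a * d + c * b) / (b * d) \<in> ?Q" "(a * c) / (b * d) \<in> ?Q"
    by (rule frac; use abcd in \<open>auto intro!: R_closed\<close>)+
  moreover have "x + y = (a * d + c * b) / (b * d)" "x * y = (a * c) / (b * d)"
    using abcd by (simp_all add: field_simps)
  ultimately show "x + y \<in> ?Q" "x * y \<in> ?Q" by simp_all
qed

text \<open>
  Clearing denominators turns linear relations over the field of fractions of \<open>R\<close> into relations over \<open>R\<close>.
\<close>

theorem finite_poles_integral:
  fixes x :: 'a
  assumes "ring.finite_dimension ring_of_type_algebra (generate_field ring_of_type_algebra H) UNIV"
    and H: "\<And>h. h \<in> H \<Longrightarrow> \<exists>a\<in>R. \<exists>b\<in>R. b \<noteq> 0 \<and> h = a / b"
  shows "finite {P \<in> places. nonarchimedean P \<and> (\<forall>a\<in>R. place_abs P a \<le> 1) \<and> 1 < place_abs P x}"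
proof -
  interpret F: field "ring_of_type_algebra :: 'a ring" by (rule type_ring_field)
  let ?K = "generate_field (ring_of_type_algebra :: 'a ring) H"
  obtain m where m: "F.dimension m ?K UNIV" using assms(1) by (auto simp: F.finite_dimension_def)
  have K: "subfield ?K ring_of_type_algebra"
    by (rule F.generate_field_is_subfield) (simp add: type_ring_simps)
  have "H \<subseteq> {a / b | a b. a \<in> R \<and> b \<in> R \<and> b \<noteq> 0}" using H by blast
  then have sub: "?K \<subseteq> {a / b | a b. a \<in> R \<and> b \<in> R \<and> b \<noteq> 0}"
    by (intro F.generate_field_min_subfield1 fractions_subfield) (simp_all add: type_ring_simps)
  show ?thesis
  proof (rule finite_integral_places)
    fix z :: "nat \<Rightarrow> 'a"
    obtain k where k: "\<forall>i\<le>m. k i \<in> ?K" "\<exists>i\<le>m. k i \<noteq> 0" "(\<Sum>i\<le>m. k i * z i) = 0"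
      using dimension_dependence[OF K m] by blast
    have "\<forall>i. \<exists>a b. i \<le> m \<longrightarrow> a \<in> R \<and> b \<in> R \<and> b \<noteq> 0 \<and> k i = a / b"
      using k(1) sub by blast
    then obtain a b where ab: "\<And>i. i \<le> m \<Longrightarrow> a i \<in> R \<and> b i \<in> R \<and> b i \<noteq> 0 \<and> k i = a i / b i"
      by metis
    define c where "c i = a i * (\<Prod>j\<in>{..m} - {i}. b j)" for i
    have ck: "c i = (\<Prod>j\<le>m. b j) * k i" if "i \<le> m" for i
      using ab[OF that] that prod.remove[of "{..m}" i b] by (simp add: c_def)
    have nz: "(\<Prod>j\<le>m. b j) \<noteq> 0" using ab by simp
    have "\<forall>i\<le>m. c i \<in> R" unfolding c_def using ab by (auto intro!: R_closed R_prod)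
    moreover have "\<exists>i\<le>m. c i \<noteq> 0" using k(2) ck nz by force
    moreover have "(\<Sum>i\<le>m. c i * z i) = (\<Prod>j\<le>m. b j) * (\<Sum>i\<le>m. k i * z i)"
      unfolding sum_distrib_left by (rule sum.cong) (simp_all add: ck mult.assoc)
    ultimately show "\<exists>c. (\<forall>i\<le>m. c i \<in> R) \<and> (\<exists>i\<le>m. c i \<noteq> 0) \<and> (\<Sum>i\<le>m. c i * z i) = 0"
      using k(3) by auto
  qed
qed

end

text \<open>
  Here \<open>R\<close> is the image of \<open>\<int>\<close> in the field, on which every nonarchimedean absolute
  value is at most \<open>1\<close>.
\<close>

lemma number_field_finite_poles:
  assumes "number_field TYPE('a::field)"
  shows "finite {P \<in> places. nonarchimedean P \<and> 1 < place_abs P (x :: 'a)}"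
proof -
  define D where "D N = (of_int ` {- int N..int N} :: 'a set)" for N
  have R: "(\<Union>N. D N) = range of_int"
  proof
    show "range of_int \<subseteq> (\<Union>N. D N)"
    proof
      fix y :: 'a assume "y \<in> range of_int"
      then obtain z where "y = of_int z" by blast
      then have "y \<in> D (nat \<bar>z\<bar>)" unfolding D_def by (intro image_eqI[of _ _ z]) auto
      then show "y \<in> (\<Union>N. D N)" by blast
    qed
  qed (auto simp: D_def)
  interpret euclidean_filtration D
  proof (unfold_locales, unfold R)
    fix b a :: 'a and N
    assume b: "b \<in> D (Suc N)" "b \<notin> D N" and a: "a \<in> range of_int"
    obtain k l where kl: "k \<in> {- int (Suc N)..int (Suc N)}" "b = of_int k" "a = of_int l"
      using b a by (auto simp: D_def)
    then have "k \<notin> {- int N..int N}" using b(2) by (auto simp: D_def)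
    then have "\<bar>k\<bar> = int N + 1" using kl(1) by auto
    then have "\<bar>l mod k\<bar> \<le> int N" using abs_mod_less[of k l] by auto
    moreover have "a - of_int (l div k) * b = of_int (l mod k)"
      using kl by (simp add: minus_div_mult_eq_mod[symmetric])
    ultimately have "a - of_int (l div k) * b \<in> D N"
      unfolding D_def by (intro image_eqI[of _ _ "l mod k"]) auto
    then show "\<exists>q\<in>range of_int. a - q * b \<in> D N" by blast
  next
    fix a b :: 'a assume "a \<in> range of_int" "b \<in> range of_int"
    then obtain k l where "a = of_int k" "b = of_int l" by blast
    then show "a * b \<in> range of_int" "a - b \<in> range of_int"
      by (metis of_int_mult rangeI, metis of_int_diff rangeI)
  next
    show "1 \<in> range of_int" by (metis of_int_1 rangeI)
  qed (simp_all add: D_def)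
  have "finite {P \<in> places. nonarchimedean P \<and> (\<forall>a\<in>R. place_abs P a \<le> 1) \<and> 1 < place_abs P x}"
    by (rule finite_poles_integral[where H = "{}"]) (use assms in \<open>auto simp: number_field_def\<close>)
  moreover have "place_abs P a \<le> 1" if "P \<in> places" "nonarchimedean P" "a \<in> R" for P a
    using nonarch_abs_val.of_int_le_one[OF nonarchimedean_place[OF that(1,2)]] that(3)
    by (auto simp: R_def R)
  ultimately show ?thesis by (auto elim!: rev_finite_subset)
qed

text \<open>
  Division with remainder does not leave the field generated by the coefficients.
\<close>

lemma polynomial_division:
  fixes k :: "'a::field set"
  assumes k: "subfield k ring_of_type_algebra"
    and p: "\<And>i. coeff p i \<in> k" "\<And>i. N < i \<Longrightarrow> coeff p i = 0" "coeff p N \<noteq> 0"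
    and f: "\<And>i. coeff f i \<in> k" "\<And>i. M \<le> i \<Longrightarrow> coeff f i = 0"
  shows "\<exists>q. (\<forall>i. coeff q i \<in> k) \<and> (\<forall>i\<ge>N. coeff (f - q * p) i = 0)"
  using f
proof (induction M arbitrary: f)
  case 0
  then show ?case by (intro exI[of _ 0]) (auto simp: subfield_typeD[OF k])
next
  case (Suc M)
  show ?case
  proof (cases "M < N")
    case True
    then show ?thesis using Suc.prems by (intro exI[of _ 0]) (auto simp: subfield_typeD[OF k])
  next
    case False
    define q where "q = monom (coeff f M / coeff p N) (M - N)"
    have q: "coeff q i \<in> k" for i using Suc.prems(1) p by (simp add: q_def subfield_typeD[OF k])
    have qp: "coeff (q * p) i = (if i < M - N then 0 else coeff f M / coeff p N * coeff p (i - (M - N)))" for i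
      by (simp add: q_def coeff_monom_mult)
    have "\<exists>q'. (\<forall>i. coeff q' i \<in> k) \<and> (\<forall>i\<ge>N. coeff ((f - q * p) - q' * p) i = 0)"
    proof (rule Suc.IH)
      show "coeff (f - q * p) i \<in> k" for i
        using Suc.prems(1) p(1) by (simp add: qp subfield_typeD[OF k])
      show "coeff (f - q * p) i = 0" if "M \<le> i" for i
        using Suc.prems(2)[of i] p(2)[of "i - (M - N)"] p(3) that False by (cases "i = M") (auto simp: qp)
    qed
    then obtain q' where q': "\<forall>i. coeff q' i \<in> k" "\<forall>i\<ge>N. coeff ((f - q * p) - q' * p) i = 0" by blast
    have eq: "f - (q + q') * p = (f - q * p) - q' * p" by (simp add: algebra_simps)
    have "\<forall>i\<ge>N. coeff (f - (q + q') * p) i = 0" unfolding eq by (rule q'(2))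
    moreover have "\<forall>i. coeff (q + q') i \<in> k" using q q'(1) by (simp add: subfield_typeD[OF k])
    ultimately show ?thesis by blast
  qed
qed

lemma polynomial_filtration:
  fixes k :: "'a::field set" and t :: 'a
  assumes k: "subfield k ring_of_type_algebra" and "finite k"
  defines "D \<equiv> \<lambda>N. {poly p t | p. (\<forall>i. coeff p i \<in> k) \<and> (\<forall>i\<ge>N. coeff p i = 0)}"
  shows "euclidean_filtration D" "(\<Union>N. D N) = {poly p t | p. \<forall>i. coeff p i \<in> k}"
proof -
  show R: "(\<Union>N. D N) = {poly p t | p. \<forall>i. coeff p i \<in> k}"
  proof
    show "{poly p t | p. \<forall>i. coeff p i \<in> k} \<subseteq> (\<Union>N. D N)"
    proof clarify
      fix p assume p: "\<forall>i. coeff p i \<in> k"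
      have "poly p t \<in> D (Suc (degree p))"
        unfolding D_def using p by (auto intro!: exI[of _ p] coeff_eq_0)
      then show "poly p t \<in> (\<Union>N. D N)" by blast
    qed
  qed (auto simp: D_def)
  have sum: "sum g I \<in> k" if "\<And>i. i \<in> I \<Longrightarrow> g i \<in> k" for g and I :: "nat set"
    using that by (induction I rule: infinite_finite_induct) (auto simp: subfield_typeD[OF k])
  have mult: "coeff (p * q) i \<in> k" if "\<forall>i. coeff p i \<in> k" "\<forall>i. coeff q i \<in> k" for p q i
    using that by (auto simp: coeff_mult subfield_typeD[OF k] intro!: sum)
  show "euclidean_filtration D"
  proof (unfold_locales, unfold R)
    show "D 0 = {0}"
    proof
      show "D 0 \<subseteq> {0}" by (auto simp: D_def) (metis leading_coeff_0_iff poly_0)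
      show "{0} \<subseteq> D 0" by (auto simp: D_def subfield_typeD[OF k] intro!: exI[of _ 0])
    qed
    show "finite (D N)" for N
    proof (rule finite_subset)
      show "finite ((\<lambda>xs. poly (Poly xs) t) ` {xs. set xs \<subseteq> k \<and> length xs = N})"
        using \<open>finite k\<close> by (intro finite_imageI finite_lists_length_eq)
      show "D N \<subseteq> (\<lambda>xs. poly (Poly xs) t) ` {xs. set xs \<subseteq> k \<and> length xs = N}"
      proof
        fix y assume "y \<in> D N"
        then obtain p where p: "y = poly p t" "\<forall>i. coeff p i \<in> k" "\<forall>i\<ge>N. coeff p i = 0"
          by (auto simp: D_def)
        have "Poly (map (coeff p) [0..<N]) = p"
          using p(3) by (intro poly_eqI) (auto simp: coeff_Poly_eq nth_default_def)
        then show "y \<in> (\<lambda>xs. poly (Poly xs) t) ` {xs. set xs \<subseteq> k \<and> length xs = N}"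
          using p by (intro image_eqI[of _ _ "map (coeff p) [0..<N]"]) auto
      qed
    qed
    show "1 \<in> {poly p t | p. \<forall>i. coeff p i \<in> k}"
      by (auto intro!: exI[of _ 1] simp: coeff_1 subfield_typeD[OF k])
  next
    fix a b assume "a \<in> {poly p t | p. \<forall>i. coeff p i \<in> k}" "b \<in> {poly p t | p. \<forall>i. coeff p i \<in> k}"
    then obtain p q where pq: "a = poly p t" "\<forall>i. coeff p i \<in> k" "b = poly q t" "\<forall>i. coeff q i \<in> k"
      by blast
    have "\<forall>i. coeff (p * q) i \<in> k"
      using pq mult by blast
    then show "a * b \<in> {poly p t | p. \<forall>i. coeff p i \<in> k}"
      using pq by (intro CollectI exI[of _ "p * q"]) simp
    show "a - b \<in> {poly p t | p. \<forall>i. coeff p i \<in> k}"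
      using pq by (intro CollectI exI[of _ "p - q"]) (simp add: subfield_typeD[OF k])
  next
    fix b N a assume b: "b \<in> D (Suc N)" "b \<notin> D N" and a: "a \<in> {poly p t | p. \<forall>i. coeff p i \<in> k}"
    obtain p where p: "b = poly p t" "\<forall>i. coeff p i \<in> k" "\<forall>i\<ge>Suc N. coeff p i = 0"
      using b by (auto simp: D_def)
    have "coeff p N \<noteq> 0"
    proof
      assume "coeff p N = 0"
      then have "\<forall>i\<ge>N. coeff p i = 0" using p(3) by (metis le_antisym not_less_eq_eq)
      then show False using b(2) p by (auto simp: D_def)
    qed
    moreover obtain f where f: "a = poly f t" "\<forall>i. coeff f i \<in> k" using a by blast
    ultimately obtain q where q: "\<forall>i. coeff q i \<in> k" "\<forall>i\<ge>N. coeff (f - q * p) i = 0"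
      using polynomial_division[OF k, of p N f "Suc (degree f)"] p(2,3) by (auto simp: coeff_eq_0 Suc_le_eq)
    have "\<forall>i. coeff (f - q * p) i \<in> k"
      unfolding coeff_diff using subfield_typeD(5)[OF k] f(2) mult[OF q(1) p(2)] by blast
    then have "poly (f - q * p) t \<in> D N" unfolding D_def using q(2) by blast
    then show "\<exists>q\<in>{poly p t | p. \<forall>i. coeff p i \<in> k}. a - q * b \<in> D N"
      using f(1) p(1) q(1) by (intro bexI[of _ "poly q t"]) auto
  qed
qed

text \<open>
  A nonzero element of a finite field is a root of unity.
\<close>

lemma (in abs_val) finite_subfield_le_one:
  assumes "subfield k ring_of_type_algebra" "finite k" "c \<in> k"
  shows "v c \<le> 1"
proof (cases "c = 0")
  case False
  have "c ^ n \<in> k" for n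
    by (induction n) (use assms in \<open>auto simp: subfield_typeD\<close>)
  then have "range (\<lambda>n. c ^ n) \<subseteq> k" by blast
  then have "\<not> inj (\<lambda>n::nat. c ^ n)"
    using assms(2) finite_imageD finite_subset infinite_UNIV_nat by blast
  then obtain i j :: nat where ij: "c ^ i = c ^ j" "i < j"
    unfolding inj_def by (metis linorder_neqE_nat)
  have "c ^ j = c ^ i * c ^ (j - i)" using power_add[of c i "j - i"] ij(2) by simp
  then have "c ^ i * c ^ (j - i) = c ^ i * 1" using ij(1) by simp
  then have "c ^ (j - i) = 1" using False by simp
  then have "v c ^ (j - i) = 1" by (metis one power)
  then show ?thesis using one_less_power[of "v c" "j - i"] ij(2) by fastforce
qed simp

text \<open>
  A place with \<open>|t| \<le> 1\<close> is at most \<open>1\<close> on \<open>k[t]\<close>, and any other place is at most \<open>1\<close> on \<open>k[1/t]\<close>. Both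
  rings have the same field of fractions.
\<close>

lemma function_field_finite_poles:
  assumes "global_function_field TYPE('a::field)"
  shows "finite {P \<in> places. nonarchimedean P \<and> 1 < place_abs P (x :: 'a)}"
proof -
  obtain k and t :: 'a where k: "subfield k ring_of_type_algebra" "finite k"
    and dim: "ring.finite_dimension ring_of_type_algebra (generate_field ring_of_type_algebra (insert t k)) UNIV"
    using assms by (auto simp: global_function_field_def)
  have half: "finite {P \<in> places. nonarchimedean P \<and> place_abs P u \<le> 1 \<and> 1 < place_abs P x}"
    if u: "u = t \<or> u = inverse t" for u
  proof -
    define D where "D N = {poly p u | p. (\<forall>i. coeff p i \<in> k) \<and> (\<forall>i\<ge>N. coeff p i = 0)}" for N
    interpret euclidean_filtration D
      unfolding D_def by (rule polynomial_filtration(1)[OF k])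
    have R: "R = {poly p u | p. \<forall>i. coeff p i \<in> k}"
      unfolding R_def D_def by (rule polynomial_filtration(2)[OF k])
    have kR: "c \<in> R" if "c \<in> k" for c
      unfolding R by (intro CollectI exI[of _ "[:c:]"])
        (use that in \<open>auto simp: coeff_pCons subfield_typeD[OF k(1)] split: nat.splits\<close>)
    have uR: "u \<in> R"
      unfolding R by (intro CollectI exI[of _ "[:0, 1:]"])
        (auto simp: coeff_pCons subfield_typeD[OF k(1)] split: nat.splits)
    have "finite {P \<in> places. nonarchimedean P \<and> (\<forall>a\<in>R. place_abs P a \<le> 1) \<and> 1 < place_abs P x}"
    proof (rule finite_poles_integral[OF dim])
      fix h assume "h \<in> insert t k"
      then consider "h \<in> R" | "h = inverse u" "u \<noteq> 0" using u kR uR by (cases "u = 0") auto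
      then show "\<exists>a\<in>R. \<exists>b\<in>R. b \<noteq> 0 \<and> h = a / b"
      proof cases
        case 1
        then show ?thesis using R_closed(2) by (intro bexI[of _ h] bexI[of _ 1]) auto
      next
        case 2
        then show ?thesis using R_closed(2) uR by (intro bexI[of _ 1] bexI[of _ u]) (auto simp: inverse_eq_divide)
      qed
    qed
    moreover have "place_abs P a \<le> 1" if P: "P \<in> places" "nonarchimedean P" "place_abs P u \<le> 1" and "a \<in> R" for P a
    proof -
      interpret nonarch_abs_val "place_abs P" by (rule nonarchimedean_place[OF P(1,2)])
      obtain p where p: "a = poly p u" "\<forall>i. coeff p i \<in> k" using \<open>a \<in> R\<close> R by blast
      have "place_abs P (coeff p i * u ^ i) \<le> 1" for i
        using finite_subfield_le_one[OF k, of "coeff p i"] p(2) P(3)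
        by (simp add: mult power mult_le_one power_le_one)
      then show ?thesis unfolding p(1) poly_altdef by (intro sum_le) auto
    qed
    ultimately show ?thesis by (auto elim!: rev_finite_subset)
  qed
  have "place_abs P t \<le> 1 \<or> place_abs P (inverse t) \<le> 1" if "P \<in> places" for P
  proof -
    interpret abs_val "place_abs P" by (rule nontrivialD(1)[OF place_abs_nontrivial[OF that]])
    show ?thesis by (auto simp: inverse inverse_le_1_iff)
  qed
  then have "{P \<in> places. nonarchimedean P \<and> 1 < place_abs P x} \<subseteq>
      {P \<in> places. nonarchimedean P \<and> place_abs P t \<le> 1 \<and> 1 < place_abs P x} \<union>
      {P \<in> places. nonarchimedean P \<and> place_abs P (inverse t) \<le> 1 \<and> 1 < place_abs P x}"
    by blast
  then show ?thesis by (rule finite_subset) (use half in simp)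
qed

theorem global_field_finite_poles:
  "global_field TYPE('a::field) \<Longrightarrow> finite {P \<in> places. nonarchimedean P \<and> 1 < place_abs P (x :: 'a)}"
  using number_field_finite_poles function_field_finite_poles by (auto simp: global_field_def)

text \<open>
  The parameter that separates the linear from the quadratic part of a shift in
  \<open>mixed_minors_mem\<close>; the field with two elements has none.
\<close>

lemma global_field_third_element:
  assumes "global_field TYPE('a::field)"
  shows "\<exists>\<kappa>::'a. \<kappa> * \<kappa> - \<kappa> \<noteq> 0"
proof (cases "number_field TYPE('a)")
  case True
  then have "(of_nat 2 :: 'a) \<noteq> 0"
    unfolding of_nat_eq_0_iff_char_dvd by (simp add: number_field_def)
  then show ?thesis by (intro exI[of _ 2]) simp
next
  case False
  then obtain k and t :: 'a where k: "subfield k ring_of_type_algebra"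
    and t: "ring.transcendental ring_of_type_algebra k t"
    using assms by (auto simp: global_field_def global_function_field_def)
  interpret F: field "ring_of_type_algebra :: 'a ring" by (rule type_ring_field)
  note inj = t[unfolded F.transcendental_def, THEN inj_onD]
  have mem: "[1, 0] \<in> carrier (k[X]\<^bsub>ring_of_type_algebra\<^esub>)" "[1] \<in> carrier (k[X]\<^bsub>ring_of_type_algebra\<^esub>)"
    "[] \<in> carrier (k[X]\<^bsub>ring_of_type_algebra\<^esub>)"
    using subfield_typeD(1,2)[OF k] by (simp_all add: univ_poly_def polynomial_def type_ring_simps)
  have "t \<noteq> 0" using inj[of "[1, 0]" "[]"] mem by (auto simp: type_ring_simps)
  moreover have "t \<noteq> 1" using inj[of "[1, 0]" "[1]"] mem by (auto simp: type_ring_simps)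
  ultimately have "t * (t - 1) \<noteq> 0" by simp
  then show ?thesis by (intro exI[of _ t]) (simp add: algebra_simps)
qed

section \<open>Completions\<close>

context abs_val
begin

lemma cauchy_carrier:
  "x \<in> carrier (cauchy_ring v) \<longleftrightarrow> (\<forall>e>0. \<exists>N. \<forall>m\<ge>N. \<forall>n\<ge>N. v (x m - x n) < e)"
  by (simp add: cauchy_ring_def)

lemma cauchy_abs_convergent:
  assumes "x \<in> carrier (cauchy_ring v)"
  shows "convergent (\<lambda>n. v (x n))"
proof (rule Cauchy_convergent, rule metric_CauchyI)
  fix e :: real assume "0 < e"
  then obtain N where "\<forall>m\<ge>N. \<forall>n\<ge>N. v (x m - x n) < e"
    using assms unfolding cauchy_carrier by blast
  then show "\<exists>N. \<forall>m\<ge>N. \<forall>n\<ge>N. dist (v (x m)) (v (x n)) < e"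
    using abs_diff_le by (metis dist_real_def le_less_trans)
qed

lemma cauchy_bounded:
  assumes "x \<in> carrier (cauchy_ring v)"
  obtains B where "0 < B" "\<And>n. v (x n) \<le> B"
proof -
  have "Bseq (\<lambda>n. v (x n))"
    using cauchy_abs_convergent[OF assms] by (rule convergent_imp_Bseq)
  then show ?thesis using that unfolding Bseq_def by auto
qed

lemma triangle_diff: "v (x - y) \<le> v x + v y"
  using triangle[of x "- y"] by simp

lemma cauchy_add:
  assumes "x \<in> carrier (cauchy_ring v)" "y \<in> carrier (cauchy_ring v)"
  shows "(\<lambda>n. x n + y n) \<in> carrier (cauchy_ring v)"
  unfolding cauchy_carrier
proof (intro allI impI)
  fix e :: real assume "0 < e"
  then obtain M N where M: "\<forall>m\<ge>M. \<forall>n\<ge>M. v (x m - x n) < e / 2" and N: "\<forall>m\<ge>N. \<forall>n\<ge>N. v (y m - y n) < e / 2"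
    using assms unfolding cauchy_carrier by (meson half_gt_zero)
  show "\<exists>N. \<forall>m\<ge>N. \<forall>n\<ge>N. v (x m + y m - (x n + y n)) < e"
  proof (intro exI allI impI)
    fix m n assume "max M N \<le> m" "max M N \<le> n"
    then have "v (x m - x n) < e / 2" "v (y m - y n) < e / 2" using M N by auto
    moreover have "v (x m + y m - (x n + y n)) \<le> v (x m - x n) + v (y m - y n)"
      using triangle[of "x m - x n" "y m - y n"] by (simp add: algebra_simps)
    ultimately show "v (x m + y m - (x n + y n)) < e" by simp
  qed
qed

lemma cauchy_mult:
  assumes "x \<in> carrier (cauchy_ring v)" "y \<in> carrier (cauchy_ring v)"
  shows "(\<lambda>n. x n * y n) \<in> carrier (cauchy_ring v)"
  unfolding cauchy_carrier
proof (intro allI impI)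
  fix e :: real assume "0 < e"
  obtain A B where A: "0 < A" "\<And>n. v (x n) \<le> A" and B: "0 < B" "\<And>n. v (y n) \<le> B"
    using assms cauchy_bounded by metis
  obtain M N where M: "\<forall>m\<ge>M. \<forall>n\<ge>M. v (x m - x n) < e / (2 * B)"
    and N: "\<forall>m\<ge>N. \<forall>n\<ge>N. v (y m - y n) < e / (2 * A)"
    using assms \<open>0 < e\<close> A(1) B(1) unfolding cauchy_carrier by (meson divide_pos_pos mult_pos_pos zero_less_numeral)
  show "\<exists>N. \<forall>m\<ge>N. \<forall>n\<ge>N. v (x m * y m - x n * y n) < e"
  proof (intro exI allI impI)
    fix m n assume "max M N \<le> m" "max M N \<le> n"
    then have "v (x m - x n) < e / (2 * B)" "v (y m - y n) < e / (2 * A)" using M N by auto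
    then have "v (y m) * v (x m - x n) \<le> B * v (x m - x n)" "B * v (x m - x n) < e / 2"
      "v (x n) * v (y m - y n) \<le> A * v (y m - y n)" "A * v (y m - y n) < e / 2"
      using A B by (auto intro: mult_right_mono simp: field_simps)
    moreover have "x m * y m - x n * y n = y m * (x m - x n) + x n * (y m - y n)"
      by (simp add: algebra_simps)
    then have "v (x m * y m - x n * y n) \<le> v (y m) * v (x m - x n) + v (x n) * v (y m - y n)"
      using triangle[of "y m * (x m - x n)" "x n * (y m - y n)"] by (simp only: mult)
    ultimately show "v (x m * y m - x n * y n) < e" by linarith
  qed
qed

lemma cauchy_minus: "x \<in> carrier (cauchy_ring v) \<Longrightarrow> (\<lambda>n. - x n) \<in> carrier (cauchy_ring v)"
  unfolding cauchy_carrier using diff_commute by (metis minus_diff_minus minus)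

lemma cauchy_const: "(\<lambda>_. a) \<in> carrier (cauchy_ring v)"
  by (simp add: cauchy_carrier)

lemma cauchy_ops:
  "x \<otimes>\<^bsub>cauchy_ring v\<^esub> y = (\<lambda>n. x n * y n)" "x \<oplus>\<^bsub>cauchy_ring v\<^esub> y = (\<lambda>n. x n + y n)"
  "\<one>\<^bsub>cauchy_ring v\<^esub> = (\<lambda>_. 1)" "\<zero>\<^bsub>cauchy_ring v\<^esub> = (\<lambda>_. 0)"
  by (simp_all add: cauchy_ring_def)

lemma cring_cauchy_ring: "cring (cauchy_ring v)"
proof (rule cringI)
  show "abelian_group (cauchy_ring v)"
  proof (rule abelian_groupI)
    show "\<exists>y\<in>carrier (cauchy_ring v). y \<oplus>\<^bsub>cauchy_ring v\<^esub> x = \<zero>\<^bsub>cauchy_ring v\<^esub>"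
      if "x \<in> carrier (cauchy_ring v)" for x
      using cauchy_minus[OF that] by (intro bexI[of _ "\<lambda>n. - x n"]) (simp_all add: cauchy_ops)
  qed (simp_all add: cauchy_ops cauchy_add cauchy_const ac_simps)
  show "comm_monoid (cauchy_ring v)"
    by (rule comm_monoidI) (simp_all add: cauchy_ops cauchy_mult cauchy_const ac_simps)
qed (simp add: cauchy_ops distrib_right)

lemma null_cauchy: "x \<in> null_sequences v \<Longrightarrow> x \<in> carrier (cauchy_ring v)"
  unfolding cauchy_carrier
proof (intro allI impI)
  fix e :: real assume "x \<in> null_sequences v" "0 < e"
  then obtain N where N: "\<And>n. n \<ge> N \<Longrightarrow> v (x n) < e / 2"
    using LIMSEQ_D[of "\<lambda>n. v (x n)" 0 "e / 2"] by (auto simp: null_sequences_def)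
  show "\<exists>N. \<forall>m\<ge>N. \<forall>n\<ge>N. v (x m - x n) < e"
  proof (intro exI allI impI)
    fix m n assume "N \<le> m" "N \<le> n"
    then show "v (x m - x n) < e" using triangle_diff[of "x m" "x n"] N[of m] N[of n] by simp
  qed
qed

lemma null_sequencesI:
  assumes "\<And>n. v (x n) \<le> b n" "b \<longlonglongrightarrow> 0"
  shows "x \<in> null_sequences v"
  unfolding null_sequences_def
  by (rule CollectI, rule tendsto_sandwich[OF _ _ tendsto_const assms(2)]) (simp_all add: assms(1))

lemma null_ideal: "ideal (null_sequences v) (cauchy_ring v)"
proof -
  interpret cring "cauchy_ring v" by (rule cring_cauchy_ring)
  have null_mult: "(\<lambda>n. y n * x n) \<in> null_sequences v"
    if x: "x \<in> null_sequences v" and y: "y \<in> carrier (cauchy_ring v)" for x y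
  proof -
    obtain B where B: "\<And>n. v (y n) \<le> B" using cauchy_bounded[OF y] by blast
    have "(\<lambda>n. B * v (x n)) \<longlonglongrightarrow> B * 0"
      using x unfolding null_sequences_def by (intro tendsto_mult tendsto_const) simp
    then show ?thesis
      by (intro null_sequencesI[of _ "\<lambda>n. B * v (x n)"]) (simp_all add: mult mult_right_mono B)
  qed
  show ?thesis
  proof (rule idealI)
    show "ring (cauchy_ring v)" by (rule ring_axioms)
    show "subgroup (null_sequences v) (add_monoid (cauchy_ring v))"
    proof (rule group.subgroupI[OF a_group])
      show "null_sequences v \<subseteq> carrier (add_monoid (cauchy_ring v))"
        using null_cauchy by auto
      have "(\<lambda>_. 0) \<in> null_sequences v" by (simp add: null_sequences_def)
      then show "null_sequences v \<noteq> {}" by blast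
      fix x assume x: "x \<in> null_sequences v"
      have "\<ominus>\<^bsub>cauchy_ring v\<^esub> x = (\<lambda>n. - x n)"
        by (rule minus_equality) (use x null_cauchy cauchy_minus in \<open>auto simp: cauchy_ops\<close>)
      then have "\<ominus>\<^bsub>cauchy_ring v\<^esub> x \<in> null_sequences v" using x by (simp add: null_sequences_def)
      then show "inv\<^bsub>add_monoid (cauchy_ring v)\<^esub> x \<in> null_sequences v" by (simp add: a_inv_def)
      fix y assume y: "y \<in> null_sequences v"
      have "(\<lambda>n. v (x n) + v (y n)) \<longlonglongrightarrow> 0 + 0"
        using x y unfolding null_sequences_def by (intro tendsto_add) simp_all
      then show "x \<otimes>\<^bsub>add_monoid (cauchy_ring v)\<^esub> y \<in> null_sequences v"
        by (intro null_sequencesI[of _ "\<lambda>n. v (x n) + v (y n)"]) (simp_all add: cauchy_ops triangle)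
    qed
    fix a x assume "a \<in> null_sequences v" "x \<in> carrier (cauchy_ring v)"
    then show "x \<otimes>\<^bsub>cauchy_ring v\<^esub> a \<in> null_sequences v" "a \<otimes>\<^bsub>cauchy_ring v\<^esub> x \<in> null_sequences v"
      using null_mult[of a x] by (simp_all add: cauchy_ops mult.commute)
  qed
qed

lemma cauchy_inverse:
  assumes x: "x \<in> carrier (cauchy_ring v)" and lim: "(\<lambda>n. v (x n)) \<longlonglongrightarrow> L" "L \<noteq> 0"
  shows "(\<lambda>n. inverse (x n)) \<in> carrier (cauchy_ring v)"
    and "eventually (\<lambda>n. x n \<noteq> 0) sequentially"
proof -
  have "0 \<le> L" using lim(1) by (rule LIMSEQ_le_const) auto
  then have "0 < L / 2" "L / 2 < L" using lim(2) by auto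
  then have "eventually (\<lambda>n. L / 2 < v (x n)) sequentially"
    using order_tendstoD(1)[OF lim(1)] by blast
  then obtain M where M: "\<And>n. n \<ge> M \<Longrightarrow> L / 2 < v (x n)"
    unfolding eventually_sequentially by blast
  have nz: "x n \<noteq> 0" if "n \<ge> M" for n using M[OF that] \<open>0 < L / 2\<close> by auto
  then show "eventually (\<lambda>n. x n \<noteq> 0) sequentially"
    unfolding eventually_sequentially by blast
  show "(\<lambda>n. inverse (x n)) \<in> carrier (cauchy_ring v)"
    unfolding cauchy_carrier
  proof (intro allI impI)
    fix e :: real assume "0 < e"
    then obtain N where N: "\<forall>m\<ge>N. \<forall>n\<ge>N. v (x m - x n) < e * (L / 2) ^ 2"
      using x \<open>0 < L / 2\<close> unfolding cauchy_carrier by (metis mult_pos_pos zero_less_power)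
    show "\<exists>N. \<forall>m\<ge>N. \<forall>n\<ge>N. v (inverse (x m) - inverse (x n)) < e"
    proof (intro exI allI impI)
      fix m n assume mn: "max M N \<le> m" "max M N \<le> n"
      have "inverse (x m) - inverse (x n) = (x n - x m) / (x m * x n)"
        using nz mn by (simp add: field_simps)
      then have "v (inverse (x m) - inverse (x n)) = v (x n - x m) / (v (x m) * v (x n))"
        by (simp add: divide mult)
      also have "\<dots> \<le> v (x n - x m) / (L / 2) ^ 2"
        unfolding power2_eq_square
        by (intro divide_left_mono mult_mono mult_pos_pos) (use M mn nz \<open>0 < L / 2\<close> in \<open>auto intro: less_imp_le\<close>)
      also have "\<dots> < e"
        using N mn \<open>0 < L / 2\<close> by (simp add: pos_divide_less_eq)
      finally show "v (inverse (x m) - inverse (x n)) < e" .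
    qed
  qed
qed

end

locale place =
  fixes P :: "('a::field \<Rightarrow> real) set"
  assumes place: "P \<in> places"
begin

abbreviation "v \<equiv> place_abs P"
abbreviation "coset x \<equiv> null_sequences v +>\<^bsub>cauchy_ring v\<^esub> x"

sublocale abs_val v
  by (rule nontrivialD(1)[OF place_abs_nontrivial[OF place]])

sublocale null: ideal "null_sequences v" "cauchy_ring v"
  by (rule null_ideal)

sublocale completion: cring "completion P"
  unfolding completion_def by (rule null.quotient_is_cring[OF cring_cauchy_ring])

lemma coset_hom: "ring_hom_cring (cauchy_ring v) (completion P) (\<lambda>x. coset x)"
  unfolding completion_def by (rule null.rcos_ring_hom_cring[OF cring_cauchy_ring])

lemma completion_cases:
  assumes "\<xi> \<in> carrier (completion P)"
  obtains x where "x \<in> carrier (cauchy_ring v)" "\<xi> = coset x"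
  using assms by (auto simp: completion_def FactRing_def A_RCOSETS_def')

lemma coset_ops:
  assumes "x \<in> carrier (cauchy_ring v)" "y \<in> carrier (cauchy_ring v)"
  shows "coset x \<in> carrier (completion P)"
    and "coset x \<otimes>\<^bsub>completion P\<^esub> coset y = coset (\<lambda>n. x n * y n)"
    and "coset x \<oplus>\<^bsub>completion P\<^esub> coset y = coset (\<lambda>n. x n + y n)"
proof -
  interpret h: ring_hom_cring "cauchy_ring v" "completion P" "\<lambda>x. coset x" by (rule coset_hom)
  show "coset x \<in> carrier (completion P)" using assms by simp
  show "coset x \<otimes>\<^bsub>completion P\<^esub> coset y = coset (\<lambda>n. x n * y n)"
    "coset x \<oplus>\<^bsub>completion P\<^esub> coset y = coset (\<lambda>n. x n + y n)"
    using h.hom_mult[OF assms] h.hom_add[OF assms] by (simp_all add: cauchy_ops)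
qed

lemma coset_one: "\<one>\<^bsub>completion P\<^esub> = coset (\<lambda>_. 1)" and coset_zero: "\<zero>\<^bsub>completion P\<^esub> = coset (\<lambda>_. 0)"
proof -
  interpret h: ring_hom_cring "cauchy_ring v" "completion P" "\<lambda>x. coset x" by (rule coset_hom)
  show "\<one>\<^bsub>completion P\<^esub> = coset (\<lambda>_. 1)" "\<zero>\<^bsub>completion P\<^esub> = coset (\<lambda>_. 0)"
    using h.hom_one h.hom_zero by (simp_all add: cauchy_ops)
qed

lemma coset_eqI:
  assumes "x \<in> carrier (cauchy_ring v)" "y \<in> carrier (cauchy_ring v)" "(\<lambda>n. v (x n - y n)) \<longlonglongrightarrow> 0"
  shows "coset x = coset y"
proof -
  have "(\<lambda>n. x n - y n) \<in> null_sequences v" using assms(3) by (simp add: null_sequences_def)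
  then have "x \<in> coset y"
    unfolding a_r_coset_def' by (auto simp: cauchy_ops intro!: bexI[of _ "\<lambda>n. x n - y n"])
  then show ?thesis
    using null.a_repr_independence' assms(2) by metis
qed

lemma completion_abs_coset:
  assumes "x \<in> carrier (cauchy_ring v)"
  shows "(\<lambda>n. v (x n)) \<longlonglongrightarrow> completion_abs P (coset x)"
proof -
  obtain r where r: "(\<lambda>n. v (x n)) \<longlonglongrightarrow> r"
    using cauchy_abs_convergent[OF assms] by (auto simp: convergent_def)
  have "(\<lambda>n. v (y n)) \<longlonglongrightarrow> r" if y: "y \<in> coset x" for y
  proof -
    obtain h where h: "h \<in> null_sequences v" "y = (\<lambda>n. h n + x n)"
      using y by (auto simp: a_r_coset_def' cauchy_ops)
    have "(\<lambda>n. v (y n) - v (x n)) \<longlonglongrightarrow> 0"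
    proof (rule metric_tendsto_imp_tendsto)
      have "\<bar>v (y n) - v (x n)\<bar> \<le> v (h n)" for n
        using abs_diff_le[of "y n" "x n"] by (simp add: h(2))
      then show "eventually (\<lambda>n. dist (v (y n) - v (x n)) 0 \<le> dist (v (h n)) 0) sequentially"
        by simp
      show "(\<lambda>n. v (h n)) \<longlonglongrightarrow> 0" using h(1) by (simp add: null_sequences_def)
    qed
    from tendsto_add[OF this r] show ?thesis by simp
  qed
  moreover have "x \<in> coset x" using assms by (rule null.a_rcos_self)
  ultimately have "completion_abs P (coset x) = r"
    unfolding completion_abs_def using r LIMSEQ_unique by (intro the_equality) blast+
  then show ?thesis using r by simp
qed

lemma completion_abs_eqI:
  "x \<in> carrier (cauchy_ring v) \<Longrightarrow> (\<lambda>n. v (x n)) \<longlonglongrightarrow> r \<Longrightarrow> completion_abs P (coset x) = r"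
  using completion_abs_coset LIMSEQ_unique by blast

lemma completion_abs_nonneg: "\<xi> \<in> carrier (completion P) \<Longrightarrow> 0 \<le> completion_abs P \<xi>"
  by (elim completion_cases, simp only:) (rule LIMSEQ_le_const[OF completion_abs_coset], auto)

lemma completion_abs_mult:
  assumes "\<xi> \<in> carrier (completion P)" "\<eta> \<in> carrier (completion P)"
  shows "completion_abs P (\<xi> \<otimes>\<^bsub>completion P\<^esub> \<eta>) = completion_abs P \<xi> * completion_abs P \<eta>"
proof -
  obtain x y where xy: "x \<in> carrier (cauchy_ring v)" "\<xi> = coset x" "y \<in> carrier (cauchy_ring v)" "\<eta> = coset y"
    using assms completion_cases by metis
  then show ?thesis
    using completion_abs_eqI[OF cauchy_mult[OF xy(1,3)]] tendsto_mult[OF completion_abs_coset completion_abs_coset, OF xy(1,3)]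
    by (simp add: coset_ops mult)
qed

lemma completion_abs_one: "completion_abs P \<one>\<^bsub>completion P\<^esub> = 1"
  and completion_abs_zero: "completion_abs P \<zero>\<^bsub>completion P\<^esub> = 0"
  unfolding coset_one coset_zero by (rule completion_abs_eqI[OF cauchy_const]; simp)+

lemma completion_abs_eq_0:
  assumes "\<xi> \<in> carrier (completion P)" "completion_abs P \<xi> = 0"
  shows "\<xi> = \<zero>\<^bsub>completion P\<^esub>"
proof -
  obtain x where x: "x \<in> carrier (cauchy_ring v)" "\<xi> = coset x"
    using assms completion_cases by metis
  then show ?thesis
    unfolding coset_zero x(2)
    using assms(2)[unfolded x(2)] completion_abs_coset[OF x(1)] by (intro coset_eqI cauchy_const x) auto
qed

lemma completion_ultrametric:
  assumes "nonarchimedean P" "\<xi> \<in> carrier (completion P)" "\<eta> \<in> carrier (completion P)"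
  shows "completion_abs P (\<xi> \<oplus>\<^bsub>completion P\<^esub> \<eta>) \<le> max (completion_abs P \<xi>) (completion_abs P \<eta>)"
proof -
  obtain x y where xy: "x \<in> carrier (cauchy_ring v)" "\<xi> = coset x" "y \<in> carrier (cauchy_ring v)" "\<eta> = coset y"
    using assms completion_cases by metis
  show ?thesis
    unfolding xy(2,4) coset_ops(3)[OF xy(1,3)]
  proof (rule LIMSEQ_le)
    show "(\<lambda>n. v (x n + y n)) \<longlonglongrightarrow> completion_abs P (coset (\<lambda>n. x n + y n))"
      by (rule completion_abs_coset[OF cauchy_add[OF xy(1,3)]])
    show "(\<lambda>n. max (v (x n)) (v (y n))) \<longlonglongrightarrow> max (completion_abs P (coset x)) (completion_abs P (coset y))"
      by (intro tendsto_max completion_abs_coset xy)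
    show "\<exists>N. \<forall>n\<ge>N. v (x n + y n) \<le> max (v (x n)) (v (y n))"
      using assms(1) by (auto simp: nonarchimedean_def)
  qed
qed

lemma completion_inverse:
  assumes "\<xi> \<in> carrier (completion P)" "\<xi> \<noteq> \<zero>\<^bsub>completion P\<^esub>"
  shows "\<exists>\<eta>\<in>carrier (completion P). \<xi> \<otimes>\<^bsub>completion P\<^esub> \<eta> = \<one>\<^bsub>completion P\<^esub>"
proof -
  obtain x where x: "x \<in> carrier (cauchy_ring v)" "\<xi> = coset x"
    using assms completion_cases by metis
  have "completion_abs P (coset x) \<noteq> 0" using completion_abs_eq_0 assms x(2) by blast
  note inv = cauchy_inverse[OF x(1) completion_abs_coset[OF x(1)] this]
  have "coset (\<lambda>n. x n * inverse (x n)) = coset (\<lambda>_. 1)"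
  proof (rule coset_eqI[OF cauchy_mult[OF x(1) inv(1)] cauchy_const])
    have "eventually (\<lambda>n. v (x n * inverse (x n) - 1) = 0) sequentially"
      using inv(2) by eventually_elim simp
    then show "(\<lambda>n. v (x n * inverse (x n) - 1)) \<longlonglongrightarrow> 0" by (rule tendsto_eventually)
  qed
  then show ?thesis
    using x inv by (intro bexI[of _ "coset (\<lambda>n. inverse (x n))"]) (simp_all add: coset_ops coset_one)
qed

text \<open>
  The quotient exists because the completion is a field; the case \<open>\<xi> = 0\<close> forces \<open>\<eta> = 0\<close>.
\<close>

lemma completion_multiple:
  assumes "\<xi> \<in> carrier (completion P)" "\<eta> \<in> carrier (completion P)" "completion_abs P \<eta> \<le> completion_abs P \<xi>"
  shows "\<exists>\<zeta>\<in>carrier (completion P). completion_abs P \<zeta> \<le> 1 \<and> \<eta> = \<xi> \<otimes>\<^bsub>completion P\<^esub> \<zeta>"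
proof (cases "\<xi> = \<zero>\<^bsub>completion P\<^esub>")
  case True
  then have "completion_abs P \<eta> = 0"
    using assms(3) completion_abs_nonneg[OF assms(2)] completion_abs_zero by simp
  then have "\<eta> = \<zero>\<^bsub>completion P\<^esub>" using completion_abs_eq_0[OF assms(2)] by simp
  then show ?thesis using True completion_abs_zero by (intro bexI[of _ "\<zero>\<^bsub>completion P\<^esub>"]) simp_all
next
  case False
  then obtain \<iota> where \<iota>: "\<iota> \<in> carrier (completion P)" "\<xi> \<otimes>\<^bsub>completion P\<^esub> \<iota> = \<one>\<^bsub>completion P\<^esub>"
    using completion_inverse[OF assms(1)] by blast
  have "completion_abs P \<xi> * completion_abs P \<iota> = 1"
    using completion_abs_mult[OF assms(1) \<iota>(1)] \<iota>(2) completion_abs_one by simp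
  then have "completion_abs P (\<eta> \<otimes>\<^bsub>completion P\<^esub> \<iota>) \<le> 1"
    using mult_right_mono[OF assms(3) completion_abs_nonneg[OF \<iota>(1)]]
    by (simp add: completion_abs_mult[OF assms(2) \<iota>(1)])
  moreover have "\<eta> = \<xi> \<otimes>\<^bsub>completion P\<^esub> (\<eta> \<otimes>\<^bsub>completion P\<^esub> \<iota>)"
    using assms \<iota> completion.m_lcomm[of \<xi> \<eta> \<iota>] by simp
  ultimately show ?thesis using assms \<iota> by blast
qed

lemma completion_embed_simps:
  "completion_embed P a \<in> carrier (completion P)"
  "completion_embed P (a * b) = completion_embed P a \<otimes>\<^bsub>completion P\<^esub> completion_embed P b"
  "completion_embed P (a + b) = completion_embed P a \<oplus>\<^bsub>completion P\<^esub> completion_embed P b"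
  "completion_embed P 1 = \<one>\<^bsub>completion P\<^esub>"
  "completion_abs P (completion_embed P a) = v a"
  by (simp_all add: completion_embed_def coset_ops(1)[OF cauchy_const cauchy_const]
      coset_ops(2,3)[OF cauchy_const cauchy_const] coset_one completion_abs_eqI[OF cauchy_const])

end

section \<open>The adele ring\<close>

lemma local_integers_closed:
  assumes "P \<in> places" "nonarchimedean P"
  shows "\<zero>\<^bsub>completion P\<^esub> \<in> local_integers P" "\<one>\<^bsub>completion P\<^esub> \<in> local_integers P"
    "\<xi> \<in> local_integers P \<Longrightarrow> \<eta> \<in> local_integers P \<Longrightarrow> \<xi> \<oplus>\<^bsub>completion P\<^esub> \<eta> \<in> local_integers P"
    "\<xi> \<in> local_integers P \<Longrightarrow> \<eta> \<in> local_integers P \<Longrightarrow> \<xi> \<otimes>\<^bsub>completion P\<^esub> \<eta> \<in> local_integers P"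
    "\<xi> \<in> local_integers P \<Longrightarrow> \<ominus>\<^bsub>completion P\<^esub> \<xi> \<in> local_integers P"
proof -
  interpret place P by unfold_locales (rule assms(1))
  show "\<zero>\<^bsub>completion P\<^esub> \<in> local_integers P" "\<one>\<^bsub>completion P\<^esub> \<in> local_integers P"
    by (simp_all add: local_integers_def completion_abs_zero completion_abs_one)
  show "\<xi> \<in> local_integers P \<Longrightarrow> \<eta> \<in> local_integers P \<Longrightarrow> \<xi> \<oplus>\<^bsub>completion P\<^esub> \<eta> \<in> local_integers P"
    using completion_ultrametric[OF assms(2), of \<xi> \<eta>] by (auto simp: local_integers_def)
  show mult: "\<xi> \<in> local_integers P \<Longrightarrow> \<eta> \<in> local_integers P \<Longrightarrow> \<xi> \<otimes>\<^bsub>completion P\<^esub> \<eta> \<in> local_integers P" for \<xi> \<eta>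
    by (auto simp: local_integers_def completion_abs_mult completion_abs_nonneg mult_le_one)
  have "completion_abs P (\<ominus>\<^bsub>completion P\<^esub> \<one>\<^bsub>completion P\<^esub>) * completion_abs P (\<ominus>\<^bsub>completion P\<^esub> \<one>\<^bsub>completion P\<^esub>) = 1"
    using completion_abs_mult[of "\<ominus>\<^bsub>completion P\<^esub> \<one>\<^bsub>completion P\<^esub>" "\<ominus>\<^bsub>completion P\<^esub> \<one>\<^bsub>completion P\<^esub>"]
    by (simp add: completion.l_minus completion.r_minus completion_abs_one)
  then have "completion_abs P (\<ominus>\<^bsub>completion P\<^esub> \<one>\<^bsub>completion P\<^esub>) = 1"
    using completion_abs_nonneg[of "\<ominus>\<^bsub>completion P\<^esub> \<one>\<^bsub>completion P\<^esub>"]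
    by (metis abs_of_nonneg completion.a_inv_closed completion.one_closed real_sqrt_abs2 real_sqrt_one)
  then have "\<ominus>\<^bsub>completion P\<^esub> \<one>\<^bsub>completion P\<^esub> \<in> local_integers P" by (simp add: local_integers_def)
  moreover have "\<ominus>\<^bsub>completion P\<^esub> \<xi> = \<ominus>\<^bsub>completion P\<^esub> \<one>\<^bsub>completion P\<^esub> \<otimes>\<^bsub>completion P\<^esub> \<xi>" if "\<xi> \<in> carrier (completion P)"
    using that by (simp add: completion.l_minus)
  ultimately show "\<xi> \<in> local_integers P \<Longrightarrow> \<ominus>\<^bsub>completion P\<^esub> \<xi> \<in> local_integers P"
    using mult by (simp add: local_integers_def)
qed

lemma completion_cring: "P \<in> places \<Longrightarrow> cring (completion P)"
proof -
  assume "P \<in> places"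
  then interpret place P by unfold_locales
  show ?thesis by (rule completion.is_cring)
qed

lemmas completion_simps = completion_cring[THEN cring.cring_simprules(1)]
  completion_cring[THEN cring.cring_simprules(2)] completion_cring[THEN cring.cring_simprules(3)]
  completion_cring[THEN cring.cring_simprules(5)] completion_cring[THEN cring.cring_simprules(6)]

lemma adele_ops:
  "P \<in> places \<Longrightarrow> (x \<otimes>\<^bsub>adele_ring\<^esub> y) P = x P \<otimes>\<^bsub>completion P\<^esub> y P"
  "P \<in> places \<Longrightarrow> (x \<oplus>\<^bsub>adele_ring\<^esub> y) P = x P \<oplus>\<^bsub>completion P\<^esub> y P"
  "P \<in> places \<Longrightarrow> \<one>\<^bsub>adele_ring\<^esub> P = \<one>\<^bsub>completion P\<^esub>"
  "P \<in> places \<Longrightarrow> \<zero>\<^bsub>adele_ring\<^esub> P = \<zero>\<^bsub>completion P\<^esub>"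
  by (simp_all add: adele_ring_def)

lemma adele_carrierI:
  assumes "x \<in> extensional places" "\<And>P. P \<in> places \<Longrightarrow> x P \<in> carrier (completion P)"
    and "finite S" "\<And>P. P \<in> places \<Longrightarrow> nonarchimedean P \<Longrightarrow> P \<notin> S \<Longrightarrow> x P \<in> local_integers P"
  shows "x \<in> carrier adele_ring"
  using assms finite_subset[of "{P \<in> places. nonarchimedean P \<and> x P \<notin> local_integers P}" S]
  by (auto simp: adele_ring_def PiE_def)

lemma adele_carrierD:
  assumes "x \<in> carrier adele_ring"
  shows "x \<in> extensional places" "P \<in> places \<Longrightarrow> x P \<in> carrier (completion P)"
    "finite {P \<in> places. nonarchimedean P \<and> x P \<notin> local_integers P}"
  using assms by (auto simp: adele_ring_def PiE_def)

lemma adele_extensional: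
  "x \<otimes>\<^bsub>adele_ring\<^esub> y \<in> extensional places" "x \<oplus>\<^bsub>adele_ring\<^esub> y \<in> extensional places"
  "\<one>\<^bsub>adele_ring\<^esub> \<in> extensional places" "\<zero>\<^bsub>adele_ring\<^esub> \<in> extensional places"
  by (simp_all add: adele_ring_def)

lemma adele_closed:
  fixes x y :: "('a::field \<Rightarrow> real) set \<Rightarrow> (nat \<Rightarrow> 'a) set"
  assumes "x \<in> carrier adele_ring" "y \<in> carrier adele_ring"
  shows "x \<otimes>\<^bsub>adele_ring\<^esub> y \<in> carrier adele_ring" "x \<oplus>\<^bsub>adele_ring\<^esub> y \<in> carrier adele_ring"
proof -
  let ?S = "{P \<in> places. nonarchimedean P \<and> x P \<notin> local_integers P} \<union>
    {P \<in> places. nonarchimedean P \<and> y P \<notin> local_integers P}"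
  have "finite ?S" using assms adele_carrierD(3) by blast
  then show "x \<otimes>\<^bsub>adele_ring\<^esub> y \<in> carrier adele_ring" "x \<oplus>\<^bsub>adele_ring\<^esub> y \<in> carrier adele_ring"
    by (rule adele_carrierI[rotated 2];
        use assms in \<open>auto simp: adele_extensional adele_ops completion_simps adele_carrierD local_integers_closed\<close>)+
qed

lemma adele_eqI:
  "x \<in> extensional places \<Longrightarrow> y \<in> extensional places \<Longrightarrow> (\<And>P. P \<in> places \<Longrightarrow> x P = y P) \<Longrightarrow> x = y"
  by (rule extensionalityI)

lemma cring_adele_ring: "cring (adele_ring :: (('a::field \<Rightarrow> real) set \<Rightarrow> (nat \<Rightarrow> 'a) set) ring)"
    (is "cring ?A")
proof (rule cringI)
  note [simp] = adele_extensional adele_ops adele_carrierD(1,2) adele_closed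
  note cring_rules = completion_cring[THEN cring.cring_simprules(7)] completion_cring[THEN cring.cring_simprules(10)]
    completion_cring[THEN cring.cring_simprules(8)] completion_cring[THEN cring.cring_simprules(11)]
    completion_cring[THEN cring.cring_simprules(12)] completion_cring[THEN cring.cring_simprules(13)]
    completion_cring[THEN cring.cring_simprules(14)]
  have zero: "\<zero>\<^bsub>?A\<^esub> \<in> carrier ?A" and one: "\<one>\<^bsub>?A\<^esub> \<in> carrier ?A"
    by (rule adele_carrierI[OF _ _ finite.emptyI]; simp add: completion_simps local_integers_closed)+
  show "abelian_group ?A"
  proof (rule abelian_groupI)
    fix x y z assume xyz: "x \<in> carrier ?A" "y \<in> carrier ?A" "z \<in> carrier ?A"
    show "x \<oplus>\<^bsub>?A\<^esub> y \<oplus>\<^bsub>?A\<^esub> z = x \<oplus>\<^bsub>?A\<^esub> (y \<oplus>\<^bsub>?A\<^esub> z)"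
      by (rule adele_eqI) (use xyz in \<open>simp_all add: cring_rules(1)\<close>)
  next
    fix x y assume xy: "x \<in> carrier ?A" "y \<in> carrier ?A"
    show "x \<oplus>\<^bsub>?A\<^esub> y \<in> carrier ?A" using xy by simp
    show "x \<oplus>\<^bsub>?A\<^esub> y = y \<oplus>\<^bsub>?A\<^esub> x"
      by (rule adele_eqI) (use xy in \<open>simp_all add: cring_rules(2)\<close>)
  next
    fix x assume x: "x \<in> carrier ?A"
    show "\<zero>\<^bsub>?A\<^esub> \<oplus>\<^bsub>?A\<^esub> x = x"
      by (rule adele_eqI) (use x in \<open>simp_all add: cring_rules(3)\<close>)
    let ?y = "\<lambda>P\<in>places. \<ominus>\<^bsub>completion P\<^esub> x P"
    have "?y \<in> carrier ?A"
      by (rule adele_carrierI[OF _ _ adele_carrierD(3)[OF x]])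
        (use x in \<open>auto simp: completion_simps local_integers_closed\<close>)
    moreover have "?y \<oplus>\<^bsub>?A\<^esub> x = \<zero>\<^bsub>?A\<^esub>"
      by (rule adele_eqI) (use x in \<open>simp_all add: completion_cring[THEN cring.cring_simprules(9)]\<close>)
    ultimately show "\<exists>y\<in>carrier ?A. y \<oplus>\<^bsub>?A\<^esub> x = \<zero>\<^bsub>?A\<^esub>" by blast
  qed (rule zero)
  show "comm_monoid ?A"
  proof (rule comm_monoidI)
    fix x y z assume xyz: "x \<in> carrier ?A" "y \<in> carrier ?A" "z \<in> carrier ?A"
    show "x \<otimes>\<^bsub>?A\<^esub> y \<otimes>\<^bsub>?A\<^esub> z = x \<otimes>\<^bsub>?A\<^esub> (y \<otimes>\<^bsub>?A\<^esub> z)"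
      by (rule adele_eqI) (use xyz in \<open>simp_all add: cring_rules(4)\<close>)
  next
    fix x y assume xy: "x \<in> carrier ?A" "y \<in> carrier ?A"
    show "x \<otimes>\<^bsub>?A\<^esub> y \<in> carrier ?A" using xy by simp
    show "x \<otimes>\<^bsub>?A\<^esub> y = y \<otimes>\<^bsub>?A\<^esub> x"
      by (rule adele_eqI) (use xy in \<open>simp_all add: cring_rules(7)\<close>)
  next
    fix x assume x: "x \<in> carrier ?A"
    show "\<one>\<^bsub>?A\<^esub> \<otimes>\<^bsub>?A\<^esub> x = x"
      by (rule adele_eqI) (use x in \<open>simp_all add: cring_rules(5)\<close>)
  qed (rule one)
  fix x y z assume xyz: "x \<in> carrier ?A" "y \<in> carrier ?A" "z \<in> carrier ?A"
  show "(x \<oplus>\<^bsub>?A\<^esub> y) \<otimes>\<^bsub>?A\<^esub> z = x \<otimes>\<^bsub>?A\<^esub> z \<oplus>\<^bsub>?A\<^esub> y \<otimes>\<^bsub>?A\<^esub> z"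
    by (rule adele_eqI) (use xyz in \<open>simp_all add: cring_rules(6)\<close>)
qed

text \<open>
  The finiteness of poles is what makes the diagonal image of an element an adele.
\<close>

lemma adele_embed_hom:
  assumes "global_field TYPE('a::field)"
  shows "(adele_embed :: 'a \<Rightarrow> _) \<in> Ring.ring_hom ring_of_type_algebra adele_ring"
proof (rule ring_hom_memI)
  have embed: "completion_embed P a \<in> carrier (completion P)"
    "completion_embed P (a * b) = completion_embed P a \<otimes>\<^bsub>completion P\<^esub> completion_embed P b"
    "completion_embed P (a + b) = completion_embed P a \<oplus>\<^bsub>completion P\<^esub> completion_embed P b"
    "completion_embed P 1 = \<one>\<^bsub>completion P\<^esub>"
    "completion_abs P (completion_embed P a) = place_abs P a" if "P \<in> places" for P and a b :: 'a
  proof -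
    interpret place P by unfold_locales (rule that)
    show "completion_embed P a \<in> carrier (completion P)"
      "completion_embed P (a * b) = completion_embed P a \<otimes>\<^bsub>completion P\<^esub> completion_embed P b"
      "completion_embed P (a + b) = completion_embed P a \<oplus>\<^bsub>completion P\<^esub> completion_embed P b"
      "completion_embed P 1 = \<one>\<^bsub>completion P\<^esub>"
      "completion_abs P (completion_embed P a) = place_abs P a"
      by (rule completion_embed_simps)+
  qed
  note [simp] = embed adele_ops adele_extensional
  fix a b :: 'a
  show "adele_embed a \<in> carrier adele_ring"
    by (rule adele_carrierI[OF _ _ global_field_finite_poles[OF assms, of a]])
      (auto simp: adele_embed_def local_integers_def)
  show "adele_embed (a \<otimes>\<^bsub>ring_of_type_algebra\<^esub> b) = adele_embed a \<otimes>\<^bsub>adele_ring\<^esub> adele_embed b"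
    by (rule adele_eqI) (simp_all add: adele_embed_def type_ring_simps)
  show "adele_embed (a \<oplus>\<^bsub>ring_of_type_algebra\<^esub> b) = adele_embed a \<oplus>\<^bsub>adele_ring\<^esub> adele_embed b"
    by (rule adele_eqI) (simp_all add: adele_embed_def type_ring_simps)
  show "adele_embed \<one>\<^bsub>ring_of_type_algebra :: 'a ring\<^esub> = \<one>\<^bsub>adele_ring\<^esub>"
    by (rule adele_eqI) (simp_all add: adele_embed_def type_ring_simps)
qed

text \<open>
  The idempotent selects at each place the larger of \<open>x\<close> and \<open>y\<close>, so the quotients \<open>u\<close> are bounded by \<open>1\<close> at
  every place and are adeles.
\<close>

theorem adele_patching:
  fixes x y :: "('a::field \<Rightarrow> real) set \<Rightarrow> (nat \<Rightarrow> 'a) set"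
  assumes x: "x \<in> carrier adele_ring" and y: "y \<in> carrier adele_ring"
  shows "\<exists>z\<in>carrier adele_ring. z \<otimes>\<^bsub>adele_ring\<^esub> z = z \<and>
    (\<exists>u\<in>carrier adele_ring. x = (z \<otimes>\<^bsub>adele_ring\<^esub> x \<oplus>\<^bsub>adele_ring\<^esub> (\<one>\<^bsub>adele_ring\<^esub> \<ominus>\<^bsub>adele_ring\<^esub> z) \<otimes>\<^bsub>adele_ring\<^esub> y) \<otimes>\<^bsub>adele_ring\<^esub> u) \<and>
    (\<exists>u\<in>carrier adele_ring. y = (z \<otimes>\<^bsub>adele_ring\<^esub> x \<oplus>\<^bsub>adele_ring\<^esub> (\<one>\<^bsub>adele_ring\<^esub> \<ominus>\<^bsub>adele_ring\<^esub> z) \<otimes>\<^bsub>adele_ring\<^esub> y) \<otimes>\<^bsub>adele_ring\<^esub> u)"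
proof -
  let ?A = "adele_ring :: (('a \<Rightarrow> real) set \<Rightarrow> (nat \<Rightarrow> 'a) set) ring"
  interpret cring ?A by (rule cring_adele_ring)
  define z w where "z = (\<lambda>P\<in>places. if completion_abs P (y P) \<le> completion_abs P (x P) then \<one>\<^bsub>completion P\<^esub> else \<zero>\<^bsub>completion P\<^esub>)"
    and "w = (\<lambda>P\<in>places. if completion_abs P (y P) \<le> completion_abs P (x P) then \<zero>\<^bsub>completion P\<^esub> else \<one>\<^bsub>completion P\<^esub>)"
  note [simp] = adele_ops adele_extensional adele_carrierD(1,2)
  have z: "z \<in> carrier ?A" and w: "w \<in> carrier ?A"
    by (rule adele_carrierI[OF _ _ finite.emptyI]; simp add: z_def w_def completion_simps local_integers_closed)+
  have cr: "a \<otimes>\<^bsub>completion P\<^esub> \<one>\<^bsub>completion P\<^esub> = a" "\<one>\<^bsub>completion P\<^esub> \<otimes>\<^bsub>completion P\<^esub> a = a"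
    "a \<oplus>\<^bsub>completion P\<^esub> \<zero>\<^bsub>completion P\<^esub> = a" "\<zero>\<^bsub>completion P\<^esub> \<oplus>\<^bsub>completion P\<^esub> a = a"
    "\<zero>\<^bsub>completion P\<^esub> \<otimes>\<^bsub>completion P\<^esub> a = \<zero>\<^bsub>completion P\<^esub>"
    if "P \<in> places" "a \<in> carrier (completion P)" for P and a :: "(nat \<Rightarrow> 'a) set"
  proof -
    interpret C: cring "completion P" by (rule completion_cring[OF that(1)])
    show "a \<otimes>\<^bsub>completion P\<^esub> \<one>\<^bsub>completion P\<^esub> = a" "\<one>\<^bsub>completion P\<^esub> \<otimes>\<^bsub>completion P\<^esub> a = a"
      "a \<oplus>\<^bsub>completion P\<^esub> \<zero>\<^bsub>completion P\<^esub> = a" "\<zero>\<^bsub>completion P\<^esub> \<oplus>\<^bsub>completion P\<^esub> a = a"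
      "\<zero>\<^bsub>completion P\<^esub> \<otimes>\<^bsub>completion P\<^esub> a = \<zero>\<^bsub>completion P\<^esub>"
      using that(2) by simp_all
  qed
  have idem: "z \<otimes>\<^bsub>?A\<^esub> z = z"
    by (rule adele_eqI) (simp_all add: z_def completion_simps cr)
  have "z \<oplus>\<^bsub>?A\<^esub> w = \<one>\<^bsub>?A\<^esub>"
    by (rule adele_eqI) (simp_all add: z_def w_def completion_simps cr)
  then have w_eq: "\<one>\<^bsub>?A\<^esub> \<ominus>\<^bsub>?A\<^esub> z = w"
    using z w by (metis a_minus_def add.inv_closed add.m_assoc add.m_comm minus_closed one_closed r_neg r_zero)
  define m where "m = z \<otimes>\<^bsub>?A\<^esub> x \<oplus>\<^bsub>?A\<^esub> w \<otimes>\<^bsub>?A\<^esub> y"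
  have m: "m \<in> carrier ?A" using z w x y by (simp add: m_def)
  have mP: "m P = (if completion_abs P (y P) \<le> completion_abs P (x P) then x P else y P)" if "P \<in> places" for P
    using that x y by (simp add: m_def z_def w_def completion_simps cr)
  have multiple: "\<exists>u\<in>carrier ?A. a = m \<otimes>\<^bsub>?A\<^esub> u" if a: "a = x \<or> a = y" for a
  proof -
    have aA: "a \<in> carrier ?A" using a x y by blast
    have "\<exists>\<zeta>\<in>carrier (completion P). completion_abs P \<zeta> \<le> 1 \<and> a P = m P \<otimes>\<^bsub>completion P\<^esub> \<zeta>" if "P \<in> places" for P
    proof -
      interpret place P by unfold_locales (rule that)
      show ?thesis
        by (rule completion_multiple) (use that a x y in \<open>auto simp: mP\<close>)
    qed
    then obtain u where u: "\<And>P. P \<in> places \<Longrightarrow> u P \<in> carrier (completion P) \<and> completion_abs P (u P) \<le> 1 \<and> a P = m P \<otimes>\<^bsub>completion P\<^esub> u P"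
      by metis
    have "restrict u places \<in> carrier ?A"
      by (rule adele_carrierI[OF _ _ finite.emptyI]) (use u in \<open>auto simp: local_integers_def\<close>)
    moreover have "a = m \<otimes>\<^bsub>?A\<^esub> restrict u places"
      by (rule adele_eqI) (use u aA in auto)
    ultimately show ?thesis by blast
  qed
  show ?thesis
    using z idem multiple[of x] multiple[of y] unfolding m_def w_eq[symmetric] by blast
qed

section \<open>Tensor products\<close>

lemma frag_extend_fun_add: "frag_extend (\<lambda>x. F x + G x) f = frag_extend F f + frag_extend G f"
  by (simp add: frag_extend_def frag_cmul_distrib2 sum.distrib)

lemma frag_extend_fun_diff:
  fixes F G :: "'a \<Rightarrow> 'b \<Rightarrow>\<^sub>0 int"
  shows "frag_extend (\<lambda>x. F x - G x) f = frag_extend F f - frag_extend G f"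
proof -
  have "frag_cmul c (a - b) = frag_cmul c a - frag_cmul c b" for c and a b :: "'b \<Rightarrow>\<^sub>0 int"
    using frag_cmul_distrib2[of c "a - b" b] by (simp add: algebra_simps)
  then show ?thesis by (simp add: frag_extend_def sum_subtractf)
qed

lemma frag_extend_fun_zero: "frag_extend (\<lambda>x. 0) f = 0"
  by (simp add: frag_extend_def)

text \<open>
  The tensor product of two commutative \<open>K\<close>-algebras as a commutative ring \<open>T\<close>, with the canonical maps
  \<open>left\<close> and \<open>right\<close>.
\<close>

locale tensor = R: cring R + S: cring S
  for R :: "('r, 'm) ring_scheme" and S :: "('s, 'k) ring_scheme" +
  fixes K :: "('c, 'l) ring_scheme" and i :: "'c \<Rightarrow> 'r" and j :: "'c \<Rightarrow> 's"
  assumes i_hom: "i \<in> Ring.ring_hom K R" and j_hom: "j \<in> Ring.ring_hom K S" and K_ring: "ring K"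
begin

abbreviation "Fr \<equiv> free_ring_on_pairs R S"
abbreviation "pairs \<equiv> carrier R \<times> carrier S"
abbreviation "I \<equiv> tensor_ideal K R S i j"
abbreviation "T \<equiv> tensor_ring K R S i j"

definition mul :: "'r \<times> 's \<Rightarrow> 'r \<times> 's \<Rightarrow> 'r \<times> 's" where
  "mul p q = (fst p \<otimes>\<^bsub>R\<^esub> fst q, snd p \<otimes>\<^bsub>S\<^esub> snd q)"

lemma mul_closed: "p \<in> pairs \<Longrightarrow> q \<in> pairs \<Longrightarrow> mul p q \<in> pairs"
  by (auto simp: mul_def)

lemma Fr_simps:
  "f \<in> carrier Fr \<longleftrightarrow> Poly_Mapping.keys f \<subseteq> pairs"
  "f \<oplus>\<^bsub>Fr\<^esub> g = f + g" "\<zero>\<^bsub>Fr\<^esub> = 0" "\<one>\<^bsub>Fr\<^esub> = frag_of (\<one>\<^bsub>R\<^esub>, \<one>\<^bsub>S\<^esub>)"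
  "f \<otimes>\<^bsub>Fr\<^esub> g = frag_extend (\<lambda>p. frag_extend (\<lambda>q. frag_of (mul p q)) g) f"
  by (simp_all add: free_ring_on_pairs_def mul_def case_prod_unfold)

lemma Fr_mult_of: "frag_of p \<otimes>\<^bsub>Fr\<^esub> frag_of q = frag_of (mul p q)"
  by (simp add: Fr_simps)

lemma Fr_closed:
  "p \<in> pairs \<Longrightarrow> frag_of p \<in> carrier Fr" "0 \<in> carrier Fr"
  "f \<in> carrier Fr \<Longrightarrow> g \<in> carrier Fr \<Longrightarrow> f + g \<in> carrier Fr"
  "f \<in> carrier Fr \<Longrightarrow> g \<in> carrier Fr \<Longrightarrow> f - g \<in> carrier Fr"
  "f \<in> carrier Fr \<Longrightarrow> g \<in> carrier Fr \<Longrightarrow> f \<otimes>\<^bsub>Fr\<^esub> g \<in> carrier Fr"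
proof -
  show "p \<in> pairs \<Longrightarrow> frag_of p \<in> carrier Fr" "0 \<in> carrier Fr"
    by (simp_all add: Fr_simps keys_frag_of)
  show "f \<in> carrier Fr \<Longrightarrow> g \<in> carrier Fr \<Longrightarrow> f + g \<in> carrier Fr"
    using keys_add[of f g] by (auto simp: Fr_simps)
  show "f \<in> carrier Fr \<Longrightarrow> g \<in> carrier Fr \<Longrightarrow> f - g \<in> carrier Fr"
    using keys_diff[of f g] by (auto simp: Fr_simps)
  assume "f \<in> carrier Fr" "g \<in> carrier Fr"
  then have f: "Poly_Mapping.keys f \<subseteq> pairs" and g: "Poly_Mapping.keys g \<subseteq> pairs"
    by (simp_all add: Fr_simps)
  have inner: "Poly_Mapping.keys (frag_extend (\<lambda>q. frag_of (mul p q)) g) \<subseteq> pairs" if "p \<in> pairs" for p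
  proof (rule order_trans[OF keys_frag_extend], rule UN_least)
    fix q assume "q \<in> Poly_Mapping.keys g"
    then show "Poly_Mapping.keys (frag_of (mul p q)) \<subseteq> pairs"
      using g mul_closed[OF that, of q] by (auto simp: keys_frag_of)
  qed
  have "Poly_Mapping.keys (f \<otimes>\<^bsub>Fr\<^esub> g) \<subseteq> pairs"
    unfolding Fr_simps
    by (rule order_trans[OF keys_frag_extend], rule UN_least, rule inner) (use f in blast)
  then show "f \<otimes>\<^bsub>Fr\<^esub> g \<in> carrier Fr" by (simp add: Fr_simps)
qed

lemma Fr_bilinear:
  "(f + f') \<otimes>\<^bsub>Fr\<^esub> g = f \<otimes>\<^bsub>Fr\<^esub> g + f' \<otimes>\<^bsub>Fr\<^esub> g" "(f - f') \<otimes>\<^bsub>Fr\<^esub> g = f \<otimes>\<^bsub>Fr\<^esub> g - f' \<otimes>\<^bsub>Fr\<^esub> g"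
  "f \<otimes>\<^bsub>Fr\<^esub> (g + g') = f \<otimes>\<^bsub>Fr\<^esub> g + f \<otimes>\<^bsub>Fr\<^esub> g'" "f \<otimes>\<^bsub>Fr\<^esub> (g - g') = f \<otimes>\<^bsub>Fr\<^esub> g - f \<otimes>\<^bsub>Fr\<^esub> g'"
  "0 \<otimes>\<^bsub>Fr\<^esub> g = 0" "f \<otimes>\<^bsub>Fr\<^esub> 0 = 0"
  by (simp_all add: Fr_simps frag_extend_add frag_extend_diff frag_extend_fun_add frag_extend_fun_diff
      frag_extend_fun_zero)

lemma Fr_induct [consumes 1, case_names zero of diff]:
  assumes "f \<in> carrier Fr" "P 0" "\<And>x y. x \<in> carrier R \<Longrightarrow> y \<in> carrier S \<Longrightarrow> P (frag_of (x, y))"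
    and "\<And>f g. f \<in> carrier Fr \<Longrightarrow> g \<in> carrier Fr \<Longrightarrow> P f \<Longrightarrow> P g \<Longrightarrow> P (f - g)"
  shows "P f"
proof -
  have "Poly_Mapping.keys f \<subseteq> pairs" using assms(1) by (simp add: Fr_simps)
  then have "f \<in> carrier Fr \<and> P f"
    by (rule frag_induction) (use assms(2-) Fr_closed in auto)
  then show ?thesis by blast
qed

lemma Fr_assoc:
  assumes f: "f \<in> carrier Fr" and g: "g \<in> carrier Fr" and h: "h \<in> carrier Fr"
  shows "f \<otimes>\<^bsub>Fr\<^esub> g \<otimes>\<^bsub>Fr\<^esub> h = f \<otimes>\<^bsub>Fr\<^esub> (g \<otimes>\<^bsub>Fr\<^esub> h)"
  using f
proof (induction f rule: Fr_induct)
  case f: (of x y)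
  show ?case using g
  proof (induction g rule: Fr_induct)
    case g: (of x' y')
    show ?case using h
    proof (induction h rule: Fr_induct)
      case (of x'' y'')
      then show ?case
        using f g by (simp add: Fr_mult_of mul_def R.m_assoc S.m_assoc)
    qed (simp_all add: Fr_bilinear)
  qed (simp_all add: Fr_bilinear)
qed (simp_all add: Fr_bilinear)

lemma Fr_comm:
  assumes f: "f \<in> carrier Fr" and g: "g \<in> carrier Fr"
  shows "f \<otimes>\<^bsub>Fr\<^esub> g = g \<otimes>\<^bsub>Fr\<^esub> f"
  using f
proof (induction f rule: Fr_induct)
  case f: (of x y)
  show ?case using g
  proof (induction g rule: Fr_induct)
    case (of x' y')
    then show ?case
      using f by (simp add: Fr_mult_of mul_def R.m_comm S.m_comm)
  qed (simp_all add: Fr_bilinear)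
qed (simp_all add: Fr_bilinear)

lemma Fr_one: "f \<in> carrier Fr \<Longrightarrow> \<one>\<^bsub>Fr\<^esub> \<otimes>\<^bsub>Fr\<^esub> f = f"
proof (induction f rule: Fr_induct)
  case (of x y)
  then show ?case by (simp add: Fr_simps(4) Fr_mult_of mul_def)
qed (simp_all add: Fr_bilinear)

lemma cring_Fr: "cring Fr"
proof (rule cringI)
  show "abelian_group Fr"
  proof (rule abelian_groupI)
    fix f assume "f \<in> carrier Fr"
    then show "\<exists>g\<in>carrier Fr. g \<oplus>\<^bsub>Fr\<^esub> f = \<zero>\<^bsub>Fr\<^esub>"
      using Fr_closed(4)[OF Fr_closed(2), of f] by (intro bexI[of _ "0 - f"]) (simp_all add: Fr_simps(2,3))
  qed (simp_all add: Fr_simps(2,3) Fr_closed ac_simps)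
  show "comm_monoid Fr"
  proof (rule comm_monoidI)
    show "\<one>\<^bsub>Fr\<^esub> \<in> carrier Fr" by (simp add: Fr_simps(4) Fr_closed)
  qed (blast intro: Fr_closed Fr_assoc Fr_one Fr_comm)+
qed (simp add: Fr_simps(2) Fr_bilinear)

sublocale Fr: cring Fr by (rule cring_Fr)

lemma Fr_minus: "f \<in> carrier Fr \<Longrightarrow> g \<in> carrier Fr \<Longrightarrow> f \<ominus>\<^bsub>Fr\<^esub> g = f - g"
proof -
  assume f: "f \<in> carrier Fr" and g: "g \<in> carrier Fr"
  have "\<ominus>\<^bsub>Fr\<^esub> g = - g"
    using Fr_closed(4)[OF Fr_closed(2) g] by (intro Fr.minus_equality) (use g in \<open>simp_all add: Fr_simps(2,3)\<close>)
  then show ?thesis by (simp add: a_minus_def Fr_simps(2))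
qed

text \<open>
  The generators of \<open>tensor_ideal\<close>, to which statements about the ideal \<open>I\<close> are reduced.
\<close>

definition relations :: "(('r \<times> 's) \<Rightarrow>\<^sub>0 int) set" where
  "relations =
    {frag_of (x \<oplus>\<^bsub>R\<^esub> x', y) - frag_of (x, y) - frag_of (x', y) | x x' y.
        x \<in> carrier R \<and> x' \<in> carrier R \<and> y \<in> carrier S} \<union>
     {frag_of (x, y \<oplus>\<^bsub>S\<^esub> y') - frag_of (x, y) - frag_of (x, y') | x y y'.
        x \<in> carrier R \<and> y \<in> carrier S \<and> y' \<in> carrier S} \<union>
     {frag_of (i c \<otimes>\<^bsub>R\<^esub> x, y) - frag_of (x, j c \<otimes>\<^bsub>S\<^esub> y) | c x y.
        c \<in> carrier K \<and> x \<in> carrier R \<and> y \<in> carrier S}"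

lemma relationsI:
  "x \<in> carrier R \<Longrightarrow> x' \<in> carrier R \<Longrightarrow> y \<in> carrier S \<Longrightarrow>
    frag_of (x \<oplus>\<^bsub>R\<^esub> x', y) - frag_of (x, y) - frag_of (x', y) \<in> relations"
  "x \<in> carrier R \<Longrightarrow> y \<in> carrier S \<Longrightarrow> y' \<in> carrier S \<Longrightarrow>
    frag_of (x, y \<oplus>\<^bsub>S\<^esub> y') - frag_of (x, y) - frag_of (x, y') \<in> relations"
  "c \<in> carrier K \<Longrightarrow> x \<in> carrier R \<Longrightarrow> y \<in> carrier S \<Longrightarrow>
    frag_of (i c \<otimes>\<^bsub>R\<^esub> x, y) - frag_of (x, j c \<otimes>\<^bsub>S\<^esub> y) \<in> relations"
  by (auto simp: relations_def)

lemma relations_induct [consumes 1, case_names left right balanced]: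
  assumes "f \<in> relations"
    and "\<And>x x' y. x \<in> carrier R \<Longrightarrow> x' \<in> carrier R \<Longrightarrow> y \<in> carrier S \<Longrightarrow>
      Q (frag_of (x \<oplus>\<^bsub>R\<^esub> x', y) - frag_of (x, y) - frag_of (x', y))"
    and "\<And>x y y'. x \<in> carrier R \<Longrightarrow> y \<in> carrier S \<Longrightarrow> y' \<in> carrier S \<Longrightarrow>
      Q (frag_of (x, y \<oplus>\<^bsub>S\<^esub> y') - frag_of (x, y) - frag_of (x, y'))"
    and "\<And>c x y. c \<in> carrier K \<Longrightarrow> x \<in> carrier R \<Longrightarrow> y \<in> carrier S \<Longrightarrow>
      Q (frag_of (i c \<otimes>\<^bsub>R\<^esub> x, y) - frag_of (x, j c \<otimes>\<^bsub>S\<^esub> y))"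
  shows "Q f"
  using assms(1) unfolding relations_def
  by (elim UnE CollectE exE conjE) (simp_all only: assms(2-4))

lemma ideal_relations: "I = Idl\<^bsub>Fr\<^esub> relations"
  by (simp add: tensor_ideal_def relations_def)

lemma i_closed: "c \<in> carrier K \<Longrightarrow> i c \<in> carrier R" and j_closed: "c \<in> carrier K \<Longrightarrow> j c \<in> carrier S"
  using i_hom j_hom by (auto simp: Ring.ring_hom_def)

lemma relations_carrier: "relations \<subseteq> carrier Fr"
  unfolding relations_def using i_closed j_closed by (auto intro!: Fr_closed)

sublocale I: ideal I Fr
  unfolding ideal_relations by (rule Fr.genideal_ideal[OF relations_carrier])

lemma relations_I: "relations \<subseteq> I"
  unfolding ideal_relations by (rule Fr.genideal_self[OF relations_carrier])

sublocale T: cring T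
  unfolding tensor_ring_def by (rule I.quotient_is_cring[OF cring_Fr])

abbreviation "residue f \<equiv> I +>\<^bsub>Fr\<^esub> f"

lemma residue_hom: "ring_hom_cring Fr T (\<lambda>f. residue f)"
  unfolding tensor_ring_def by (rule I.rcos_ring_hom_cring[OF cring_Fr])

sublocale cl: ring_hom_cring Fr T "\<lambda>f. residue f" by (rule residue_hom)

lemma T_cases:
  assumes "b \<in> carrier T"
  obtains f where "f \<in> carrier Fr" "b = residue f"
proof -
  have "carrier T = (\<Union>f\<in>carrier Fr. {residue f})"
    unfolding tensor_ring_def FactRing_def A_RCOSETS_def' by (simp only: partial_object.simps)
  then show ?thesis using assms that by blast
qed

lemma residue_eqI: "f \<in> carrier Fr \<Longrightarrow> g \<in> carrier Fr \<Longrightarrow> f - g \<in> I \<Longrightarrow> residue f = residue g"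
  using Fr.quotient_eq_iff_same_a_r_cos[OF I.is_ideal, of f g] by (simp add: Fr_minus)

lemma residue_diff: "f \<in> carrier Fr \<Longrightarrow> g \<in> carrier Fr \<Longrightarrow> residue (f - g) = residue f \<ominus>\<^bsub>T\<^esub> residue g"
  using cl.hom_add[of f "\<ominus>\<^bsub>Fr\<^esub> g"] by (simp add: Fr_minus[symmetric] a_minus_def)

definition pure :: "'r \<Rightarrow> 's \<Rightarrow> (('r \<times> 's) \<Rightarrow>\<^sub>0 int) set" where
  "pure x y = residue (frag_of (x, y))"

lemma pure_closed [simp]: "x \<in> carrier R \<Longrightarrow> y \<in> carrier S \<Longrightarrow> pure x y \<in> carrier T"
  by (simp add: pure_def Fr_closed)

lemma pure_mult:
  "x \<in> carrier R \<Longrightarrow> y \<in> carrier S \<Longrightarrow> x' \<in> carrier R \<Longrightarrow> y' \<in> carrier S \<Longrightarrow>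
    pure x y \<otimes>\<^bsub>T\<^esub> pure x' y' = pure (x \<otimes>\<^bsub>R\<^esub> x') (y \<otimes>\<^bsub>S\<^esub> y')"
  by (simp add: pure_def Fr_closed cl.hom_mult[symmetric] Fr_mult_of mul_def)

lemma pure_add_left:
  assumes "x \<in> carrier R" "x' \<in> carrier R" "y \<in> carrier S"
  shows "pure (x \<oplus>\<^bsub>R\<^esub> x') y = pure x y \<oplus>\<^bsub>T\<^esub> pure x' y"
proof -
  have "frag_of (x \<oplus>\<^bsub>R\<^esub> x', y) - (frag_of (x, y) + frag_of (x', y)) \<in> relations"
    using relationsI(1)[OF assms] by (simp add: diff_diff_add)
  then have "residue (frag_of (x \<oplus>\<^bsub>R\<^esub> x', y)) = residue (frag_of (x, y) + frag_of (x', y))"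
    using assms relations_I by (intro residue_eqI) (auto intro!: Fr_closed)
  then show ?thesis
    using assms cl.hom_add[of "frag_of (x, y)" "frag_of (x', y)"] by (simp add: pure_def Fr_closed Fr_simps(2))
qed

lemma pure_add_right:
  assumes "x \<in> carrier R" "y \<in> carrier S" "y' \<in> carrier S"
  shows "pure x (y \<oplus>\<^bsub>S\<^esub> y') = pure x y \<oplus>\<^bsub>T\<^esub> pure x y'"
proof -
  have "frag_of (x, y \<oplus>\<^bsub>S\<^esub> y') - (frag_of (x, y) + frag_of (x, y')) \<in> relations"
    using relationsI(2)[OF assms] by (simp add: diff_diff_add)
  then have "residue (frag_of (x, y \<oplus>\<^bsub>S\<^esub> y')) = residue (frag_of (x, y) + frag_of (x, y'))"
    using assms relations_I by (intro residue_eqI) (auto intro!: Fr_closed)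
  then show ?thesis
    using assms cl.hom_add[of "frag_of (x, y)" "frag_of (x, y')"] by (simp add: pure_def Fr_closed Fr_simps(2))
qed

lemma pure_balanced:
  assumes "c \<in> carrier K" "x \<in> carrier R" "y \<in> carrier S"
  shows "pure (i c \<otimes>\<^bsub>R\<^esub> x) y = pure x (j c \<otimes>\<^bsub>S\<^esub> y)"
proof -
  have "frag_of (i c \<otimes>\<^bsub>R\<^esub> x, y) - frag_of (x, j c \<otimes>\<^bsub>S\<^esub> y) \<in> relations"
    using assms by (rule relationsI(3))
  then show ?thesis
    unfolding pure_def using assms relations_I i_closed j_closed by (intro residue_eqI) (auto intro!: Fr_closed)
qed

lemma pure_one: "pure \<one>\<^bsub>R\<^esub> \<one>\<^bsub>S\<^esub> = \<one>\<^bsub>T\<^esub>"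
  using cl.hom_one by (simp add: pure_def Fr_simps(4))

definition left :: "'r \<Rightarrow> (('r \<times> 's) \<Rightarrow>\<^sub>0 int) set" where "left x = pure x \<one>\<^bsub>S\<^esub>"
definition right :: "'s \<Rightarrow> (('r \<times> 's) \<Rightarrow>\<^sub>0 int) set" where "right y = pure \<one>\<^bsub>R\<^esub> y"

sublocale left: ring_hom_cring R T left
  by (intro ring_hom_cringI ring_hom_ringI2 ring_hom_memI R.ring_axioms T.ring_axioms R.cring_axioms T.cring_axioms)
    (simp_all add: left_def pure_mult pure_add_left pure_one)

sublocale right: ring_hom_cring S T right
  by (intro ring_hom_cringI ring_hom_ringI2 ring_hom_memI S.ring_axioms T.ring_axioms S.cring_axioms T.cring_axioms)
    (simp_all add: right_def pure_mult pure_add_right pure_one)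

lemma left_right: "c \<in> carrier K \<Longrightarrow> left (i c) = right (j c)"
  using pure_balanced[of c "\<one>\<^bsub>R\<^esub>" "\<one>\<^bsub>S\<^esub>"] i_closed j_closed by (simp add: left_def right_def)

lemma pure_eq: "x \<in> carrier R \<Longrightarrow> y \<in> carrier S \<Longrightarrow> pure x y = left x \<otimes>\<^bsub>T\<^esub> right y"
  by (simp add: left_def right_def pure_mult)

text \<open>
  For a pure tensor this is the expansion of its first factor, and the pure tensors generate.
\<close>

lemma quadratic_generation:
  assumes \<theta>: "\<theta> \<in> carrier R"
    and basis: "\<And>x. x \<in> carrier R \<Longrightarrow> \<exists>a\<in>carrier K. \<exists>b\<in>carrier K. x = i a \<oplus>\<^bsub>R\<^esub> i b \<otimes>\<^bsub>R\<^esub> \<theta>"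
    and "b \<in> carrier T"
  shows "\<exists>p\<in>carrier S. \<exists>q\<in>carrier S. b = right p \<oplus>\<^bsub>T\<^esub> left \<theta> \<otimes>\<^bsub>T\<^esub> right q"
proof -
  obtain f where "f \<in> carrier Fr" "b = residue f" using T_cases assms(3) by blast
  from this(1) have "\<exists>p\<in>carrier S. \<exists>q\<in>carrier S. residue f = right p \<oplus>\<^bsub>T\<^esub> left \<theta> \<otimes>\<^bsub>T\<^esub> right q"
  proof (induction f rule: Fr_induct)
    case zero
    have "residue 0 = \<zero>\<^bsub>T\<^esub>" using cl.hom_zero by (simp add: Fr_simps(3))
    then show ?case
      using \<theta> by (intro bexI[of _ "\<zero>\<^bsub>S\<^esub>"]) simp_all
  next
    case (of x y)
    obtain a b where ab: "a \<in> carrier K" "b \<in> carrier K" "x = i a \<oplus>\<^bsub>R\<^esub> i b \<otimes>\<^bsub>R\<^esub> \<theta>"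
      using basis[OF of(1)] by blast
    have cl: "i a \<in> carrier R" "i b \<in> carrier R" "j a \<in> carrier S" "j b \<in> carrier S"
      using ab i_closed j_closed by auto
    have "residue (frag_of (x, y)) = left x \<otimes>\<^bsub>T\<^esub> right y"
      using of by (simp add: pure_eq[symmetric] pure_def)
    also have "left x = right (j a) \<oplus>\<^bsub>T\<^esub> right (j b) \<otimes>\<^bsub>T\<^esub> left \<theta>"
      using cl \<theta> by (simp add: ab(3) left_right[symmetric] ab(1,2))
    also have "(right (j a) \<oplus>\<^bsub>T\<^esub> right (j b) \<otimes>\<^bsub>T\<^esub> left \<theta>) \<otimes>\<^bsub>T\<^esub> right y =
        right (j a \<otimes>\<^bsub>S\<^esub> y) \<oplus>\<^bsub>T\<^esub> left \<theta> \<otimes>\<^bsub>T\<^esub> right (j b \<otimes>\<^bsub>S\<^esub> y)"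
      using cl \<theta> of by (simp add: T.l_distr) (simp add: T.m_ac)
    finally show ?case using cl of by blast
  next
    case (diff f g)
    then obtain p q p' q' where pq: "p \<in> carrier S" "q \<in> carrier S" "p' \<in> carrier S" "q' \<in> carrier S"
      "residue f = right p \<oplus>\<^bsub>T\<^esub> left \<theta> \<otimes>\<^bsub>T\<^esub> right q" "residue g = right p' \<oplus>\<^bsub>T\<^esub> left \<theta> \<otimes>\<^bsub>T\<^esub> right q'"
      by blast
    have "residue (f - g) = residue f \<ominus>\<^bsub>T\<^esub> residue g" using diff by (simp add: residue_diff)
    also have "\<dots> = (right p \<ominus>\<^bsub>T\<^esub> right p') \<oplus>\<^bsub>T\<^esub> left \<theta> \<otimes>\<^bsub>T\<^esub> (right q \<ominus>\<^bsub>T\<^esub> right q')"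
      unfolding pq(5,6) a_minus_def using pq(1-4) \<theta>
      by (simp add: T.minus_add T.r_distr T.r_minus T.a_ac)
    also have "\<dots> = right (p \<ominus>\<^bsub>S\<^esub> p') \<oplus>\<^bsub>T\<^esub> left \<theta> \<otimes>\<^bsub>T\<^esub> right (q \<ominus>\<^bsub>S\<^esub> q')"
      using pq(1-4) by (simp add: a_minus_def)
    finally show ?case using pq(1-4) by blast
  qed
  then show ?thesis using \<open>b = residue f\<close> by simp
qed

end

locale tensor_automorphism = tensor +
  fixes \<phi> :: "'a \<Rightarrow> 'a"
  assumes \<phi>_hom: "\<phi> \<in> Ring.ring_hom R R" and \<phi>_i: "c \<in> carrier K \<Longrightarrow> \<phi> (i c) = i c"
    and \<phi>_\<phi>: "x \<in> carrier R \<Longrightarrow> \<phi> (\<phi> x) = x"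
begin

lemma \<phi>_simps:
  "x \<in> carrier R \<Longrightarrow> \<phi> x \<in> carrier R" "\<phi> \<one>\<^bsub>R\<^esub> = \<one>\<^bsub>R\<^esub>"
  "x \<in> carrier R \<Longrightarrow> y \<in> carrier R \<Longrightarrow> \<phi> (x \<otimes>\<^bsub>R\<^esub> y) = \<phi> x \<otimes>\<^bsub>R\<^esub> \<phi> y"
  "x \<in> carrier R \<Longrightarrow> y \<in> carrier R \<Longrightarrow> \<phi> (x \<oplus>\<^bsub>R\<^esub> y) = \<phi> x \<oplus>\<^bsub>R\<^esub> \<phi> y"
  using \<phi>_hom by (auto simp: Ring.ring_hom_def)

definition \<Phi> :: "(('a \<times> 'c) \<Rightarrow>\<^sub>0 int) \<Rightarrow> (('a \<times> 'c) \<Rightarrow>\<^sub>0 int)" where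
  "\<Phi> = frag_extend (\<lambda>(x, y). frag_of (\<phi> x, id y))"

abbreviation star :: "(('a \<times> 'c) \<Rightarrow>\<^sub>0 int) set \<Rightarrow> (('a \<times> 'c) \<Rightarrow>\<^sub>0 int) set" where
  "star \<equiv> tensor_map K R S i j \<phi> id"

lemma \<Phi>_simps: "\<Phi> 0 = 0" "\<Phi> (frag_of (x, y)) = frag_of (\<phi> x, y)" "\<Phi> (f - g) = \<Phi> f - \<Phi> g" "\<Phi> (f + g) = \<Phi> f + \<Phi> g"
  by (simp_all add: \<Phi>_def frag_extend_add frag_extend_diff)

lemma \<Phi>_closed: "f \<in> carrier Fr \<Longrightarrow> \<Phi> f \<in> carrier Fr"
  by (induction f rule: Fr_induct) (simp_all add: \<Phi>_simps Fr_closed \<phi>_simps)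

lemma \<Phi>_mult:
  assumes "f \<in> carrier Fr" "g \<in> carrier Fr"
  shows "\<Phi> (f \<otimes>\<^bsub>Fr\<^esub> g) = \<Phi> f \<otimes>\<^bsub>Fr\<^esub> \<Phi> g"
  using assms(1)
proof (induction f rule: Fr_induct)
  case f: (of x y)
  show ?case using assms(2)
  proof (induction g rule: Fr_induct)
    case (of x' y')
    then show ?case using f by (simp add: Fr_mult_of mul_def \<Phi>_simps \<phi>_simps)
  qed (simp_all add: Fr_bilinear \<Phi>_simps)
qed (simp_all add: Fr_bilinear \<Phi>_simps)

lemma \<Phi>_\<Phi>: "f \<in> carrier Fr \<Longrightarrow> \<Phi> (\<Phi> f) = f"
  by (induction f rule: Fr_induct) (simp_all add: \<Phi>_simps \<phi>_\<phi>)

lemma \<Phi>_ring_hom: "ring_hom_ring Fr Fr \<Phi>"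
  by (rule ring_hom_ringI2)
    (auto intro!: ring_hom_memI Fr.ring_axioms simp: \<Phi>_closed \<Phi>_mult \<Phi>_simps Fr_simps(2) \<phi>_simps Fr_simps(4))

lemma \<Phi>_ideal: "f \<in> I \<Longrightarrow> \<Phi> f \<in> I"
proof -
  interpret \<Phi>: ring_hom_ring Fr Fr \<Phi> by (rule \<Phi>_ring_hom)
  have "\<Phi> f \<in> relations" if "f \<in> relations" for f
    using that
  proof (induction f rule: relations_induct)
    case (left x x' y)
    then show ?case using relationsI(1)[of "\<phi> x" "\<phi> x'" y] by (simp add: \<Phi>_simps \<phi>_simps)
  next
    case (right x y y')
    then show ?case using relationsI(2)[of "\<phi> x" y y'] by (simp add: \<Phi>_simps \<phi>_simps)
  next
    case (balanced c x y)
    then show ?case using relationsI(3)[of c "\<phi> x" y] by (simp add: \<Phi>_simps \<phi>_simps \<phi>_i i_closed)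
  qed
  then have sub: "relations \<subseteq> {f \<in> carrier Fr. \<Phi> f \<in> I}"
    using relations_carrier relations_I by blast
  have "I \<subseteq> {f \<in> carrier Fr. \<Phi> f \<in> I}"
    by (rule Fr.genideal_minimal[OF \<Phi>.ideal_vimage[OF I.is_ideal] sub, folded ideal_relations])
  then show "f \<in> I \<Longrightarrow> \<Phi> f \<in> I" by blast
qed

text \<open>
  The map \<open>\<Phi>\<close> preserves the ideal, so all cosets in the union that defines \<open>tensor_map\<close> coincide.
\<close>

lemma star_residue:
  assumes f: "f \<in> carrier Fr"
  shows "star (residue f) = residue (\<Phi> f)"
proof -
  have "residue (\<Phi> g) = residue (\<Phi> f)" if g: "g \<in> residue f" for g
  proof -
    obtain h where h: "h \<in> I" "g = h + f" using g by (auto simp: a_r_coset_def' Fr_simps(2))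
    have "h \<in> carrier Fr" using h I.Icarr by blast
    then show ?thesis
      using h f \<Phi>_ideal[OF h(1)] by (intro residue_eqI) (simp_all add: \<Phi>_simps \<Phi>_closed Fr_closed)
  qed
  moreover have "f \<in> residue f" using f by (rule I.a_rcos_self)
  ultimately have "(\<Union>g\<in>residue f. residue (\<Phi> g)) = residue (\<Phi> f)" by blast
  then show ?thesis by (simp add: tensor_map_def \<Phi>_def)
qed

lemma star_simps:
  "b \<in> carrier T \<Longrightarrow> star b \<in> carrier T"
  "b \<in> carrier T \<Longrightarrow> b' \<in> carrier T \<Longrightarrow> star (b \<oplus>\<^bsub>T\<^esub> b') = star b \<oplus>\<^bsub>T\<^esub> star b'"
  "b \<in> carrier T \<Longrightarrow> b' \<in> carrier T \<Longrightarrow> star (b \<otimes>\<^bsub>T\<^esub> b') = star b \<otimes>\<^bsub>T\<^esub> star b'"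
  "b \<in> carrier T \<Longrightarrow> star (star b) = b"
proof -
  show "b \<in> carrier T \<Longrightarrow> star b \<in> carrier T" "b \<in> carrier T \<Longrightarrow> star (star b) = b"
    by (elim T_cases; simp add: star_residue \<Phi>_closed \<Phi>_\<Phi>)+
  assume "b \<in> carrier T" "b' \<in> carrier T"
  then obtain f g where fg: "f \<in> carrier Fr" "b = residue f" "g \<in> carrier Fr" "b' = residue g"
    using T_cases by metis
  note add = cl.hom_add[unfolded Fr_simps(2)] and closed = Fr_closed \<Phi>_closed
  show "star (b \<oplus>\<^bsub>T\<^esub> b') = star b \<oplus>\<^bsub>T\<^esub> star b'"
    using fg by (simp add: add[symmetric] star_residue closed \<Phi>_simps)
  show "star (b \<otimes>\<^bsub>T\<^esub> b') = star b \<otimes>\<^bsub>T\<^esub> star b'"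
    using fg by (simp add: cl.hom_mult[symmetric] star_residue closed \<Phi>_mult del: cl.hom_mult)
qed

lemma star_left: "x \<in> carrier R \<Longrightarrow> star (left x) = left (\<phi> x)"
  and star_right: "y \<in> carrier S \<Longrightarrow> star (right y) = right y"
  by (simp_all add: left_def right_def pure_def star_residue Fr_closed \<Phi>_simps \<phi>_simps)

end

section \<open>Separable quadratic extensions\<close>

lemma field_hom_simps:
  fixes h :: "'a::field \<Rightarrow> 'b::field"
  assumes "h \<in> Ring.ring_hom ring_of_type_algebra ring_of_type_algebra"
  shows "h (x + y) = h x + h y" "h (x * y) = h x * h y" "h 1 = 1" "h 0 = 0" "h (- x) = - h x"
    "h (x - y) = h x - h y" "h x = 0 \<longleftrightarrow> x = 0" "h (inverse x) = inverse (h x)"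
proof -
  show add: "h (x + y) = h x + h y" and mult: "h (x * y) = h x * h y" and one: "h 1 = 1" for x y
    using assms by (auto simp: Ring.ring_hom_def type_ring_simps)
  show zero: "h 0 = 0" using add[of 0 0] by (metis add.right_neutral add_left_cancel)
  show uminus: "h (- x) = - h x" for x
    using add[of x "- x"] zero by (simp add: eq_neg_iff_add_eq_0 add.commute)
  show "h (x - y) = h x - h y" using add[of x "- y"] uminus by simp
  have inv: "h x * h (inverse x) = 1" if "x \<noteq> 0" for x
    using mult[of x "inverse x"] that one by simp
  then show "h x = 0 \<longleftrightarrow> x = 0" using zero by (metis mult_zero_left zero_neq_one)
  show "h (inverse x) = inverse (h x)"
    using inv[of x] zero by (cases "x = 0") (simp_all add: inverse_unique)
qed

text \<open>
  An element moved by \<open>\<alpha>\<close> is not in \<open>F\<close>, so \<open>1\<close> and \<open>\<theta>\<close> span \<open>E\<close>. Both \<open>\<theta>\<close> and \<open>\<alpha> \<theta>\<close> are roots of the same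
  monic quadratic polynomial over \<open>F\<close>, whose coefficients are their trace and norm up to sign.
\<close>

lemma quadratic_generator:
  fixes \<iota> :: "'f::field \<Rightarrow> 'e::field"
  assumes "separable_quadratic_extension \<iota>" and \<alpha>: "\<alpha> \<in> galois_group \<iota>" "\<alpha> \<noteq> id"
  obtains \<theta> t d where "\<alpha> \<theta> \<noteq> \<theta>" "\<And>x. \<exists>a b. x = \<iota> a + \<iota> b * \<theta>" "\<theta> + \<alpha> \<theta> = \<iota> t" "\<theta> * \<alpha> \<theta> = \<iota> d"
    "\<And>x. \<alpha> (\<alpha> x) = x"
proof -
  have \<iota>: "\<iota> \<in> Ring.ring_hom ring_of_type_algebra ring_of_type_algebra"
    and dim: "ring.dimension (ring_of_type_algebra :: 'e ring) 2 (range \<iota>) UNIV"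
    using assms(1) by (simp_all add: separable_quadratic_extension_def field_extension_def)
  have \<alpha>_hom: "\<alpha> \<in> Ring.ring_hom ring_of_type_algebra ring_of_type_algebra" and \<alpha>\<iota>: "\<alpha> (\<iota> c) = \<iota> c" for c
    using \<alpha>(1) by (simp_all add: galois_group_def ring_iso_def)
  note \<iota>' = field_hom_simps[OF \<iota>] and \<alpha>' = field_hom_simps[OF \<alpha>_hom]
  have K: "subfield (range \<iota>) ring_of_type_algebra"
  proof (rule subfield_typeI)
    show "1 \<in> range \<iota>" by (rule range_eqI[of _ _ 1]) (simp add: \<iota>')
    fix x assume "x \<in> range \<iota>"
    then obtain a where a: "x = \<iota> a" by blast
    show "- x \<in> range \<iota>" by (rule range_eqI[of _ _ "- a"]) (simp add: a \<iota>')
    show "inverse x \<in> range \<iota>" by (rule range_eqI[of _ _ "inverse a"]) (simp add: a \<iota>')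
    fix y assume "y \<in> range \<iota>"
    then obtain b where b: "y = \<iota> b" by blast
    show "x + y \<in> range \<iota>" by (rule range_eqI[of _ _ "a + b"]) (simp add: a b \<iota>')
    show "x * y \<in> range \<iota>" by (rule range_eqI[of _ _ "a * b"]) (simp add: a b \<iota>')
  qed
  obtain \<theta> where \<theta>: "\<alpha> \<theta> \<noteq> \<theta>" using \<alpha>(2) by (auto simp: fun_eq_iff)
  then have \<theta>_range: "\<theta> \<notin> range \<iota>" using \<alpha>\<iota> by auto
  have basis: "\<exists>a b. x = \<iota> a + \<iota> b * \<theta>" for x
  proof -
    let ?z = "\<lambda>i::nat. if i = 0 then 1 else if i = 1 then \<theta> else x"
    obtain k where k: "\<forall>i\<le>2. k i \<in> range \<iota>" "\<exists>i\<le>2. k i \<noteq> 0" "(\<Sum>i\<le>2. k i * ?z i) = 0"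
      using dimension_dependence[OF K dim, of ?z] by blast
    obtain a b c where abc: "k 0 = \<iota> a" "k 1 = \<iota> b" "k 2 = \<iota> c"
      using k(1) by (metis image_iff one_le_numeral order_refl zero_le)
    have eq: "\<iota> a + \<iota> b * \<theta> + \<iota> c * x = 0"
      using k(3) abc by (simp add: numeral_2_eq_2)
    have "c \<noteq> 0"
    proof
      assume c: "c = 0"
      then have eq': "\<iota> a + \<iota> b * \<theta> = 0" using eq \<iota>'(4) by simp
      have "b \<noteq> 0"
      proof
        assume "b = 0"
        then have "a = 0" using eq' \<iota>'(4,7) by simp
        then show False
          using k(2) abc c \<open>b = 0\<close> \<iota>'(4) by (auto simp: numeral_2_eq_2 le_Suc_eq)
      qed
      then have "\<iota> b \<noteq> 0" by (simp add: \<iota>'(7))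
      moreover have "\<theta> * \<iota> b = - \<iota> a" using eq' by (simp add: eq_neg_iff_add_eq_0 algebra_simps)
      ultimately have "\<theta> = - \<iota> a / \<iota> b" by (rule nonzero_eq_divide_eq[THEN iffD2])
      also have "\<dots> = \<iota> (- a * inverse b)" by (simp add: \<iota>' divide_inverse)
      finally show False using \<theta>_range by blast
    qed
    then have "\<iota> c \<noteq> 0" by (simp add: \<iota>'(7))
    moreover have "x * \<iota> c = - \<iota> a - \<iota> b * \<theta>" using eq by (simp add: eq_diff_eq eq_neg_iff_add_eq_0 algebra_simps)
    ultimately have "x = (- \<iota> a - \<iota> b * \<theta>) / \<iota> c" by (rule nonzero_eq_divide_eq[THEN iffD2])
    also have "\<dots> = \<iota> (- a * inverse c) + \<iota> (- b * inverse c) * \<theta>"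
      by (simp add: \<iota>' divide_inverse algebra_simps)
    finally show ?thesis by blast
  qed
  obtain p q where pq: "\<theta> * \<theta> = \<iota> q + \<iota> p * \<theta>" using basis by blast
  have "\<alpha> \<theta> * \<alpha> \<theta> = \<iota> q + \<iota> p * \<alpha> \<theta>"
    using arg_cong[OF pq, of \<alpha>] by (simp add: \<alpha>' \<alpha>\<iota>)
  then have "(\<alpha> \<theta> - \<theta>) * (\<alpha> \<theta> + \<theta>) = (\<alpha> \<theta> - \<theta>) * \<iota> p"
    using pq by (simp add: algebra_simps)
  then have trace: "\<theta> + \<alpha> \<theta> = \<iota> p" using \<theta> by (simp add: add.commute)
  then have conj: "\<alpha> \<theta> = \<iota> p - \<theta>" by (simp add: algebra_simps)
  have norm: "\<theta> * \<alpha> \<theta> = \<iota> (- q)"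
    unfolding conj using pq by (simp add: \<iota>' algebra_simps)
  have "\<alpha> (\<alpha> \<theta>) = \<theta>" by (simp add: conj \<alpha>' \<alpha>\<iota>)
  then have "\<alpha> (\<alpha> x) = x" for x
    using basis[of x] by (auto simp: \<alpha>' \<alpha>\<iota>)
  then show ?thesis using that \<theta> basis trace norm by blast
qed

section \<open>Star-Euclidean matrix rings over the adeles\<close>

lemma pair_decomposition_length_one:
  assumes "s \<in> sym_elements A star" "r \<in> Units A" "a = s \<otimes>\<^bsub>A\<^esub> c \<oplus>\<^bsub>A\<^esub> r"
  shows "is_pair_decomposition_length A star a c 1"
  unfolding is_pair_decomposition_length_def
proof (intro conjI exI)
  let ?r = "\<lambda>i::int. if i = - 1 then a else if i = 0 then c else r"
  show "\<forall>i. 1 \<le> i \<and> i < int 1 \<longrightarrow> ?r i \<in> carrier A" by auto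
  show "\<forall>k<1. ?r (int k - 1) = (\<lambda>_. s) k \<otimes>\<^bsub>A\<^esub> ?r (int k) \<oplus>\<^bsub>A\<^esub> ?r (int k + 1)"
    using assms(3) by simp
qed (use assms in auto)

lemma (in star_cring) star_euclidean_matrix_ring:
  assumes norms_glue
    and "\<kappa> \<in> carrier B" "star \<kappa> = \<kappa>" "\<kappa> \<otimes> \<kappa> \<ominus> \<kappa> \<in> Units B"
    and "\<theta> \<in> carrier B" "star \<theta> \<ominus> \<theta> \<in> Units B"
  shows "star_euclidean (matrix_ring n B) (matrix_star n star) \<and>
    has_decomposition_length (matrix_ring n B) (matrix_star n star) 1"
proof -
  have "is_pair_decomposition_length (matrix_ring n B) (matrix_star n star) a c 1"
    if "coprime_sym_pair (matrix_ring n B) (matrix_star n star) a c" for a c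
  proof -
    have "\<exists>s\<in>sym_elements (matrix_ring n B) (matrix_star n star). \<exists>r\<in>Units (matrix_ring n B).
        a = s \<otimes>\<^bsub>matrix_ring n B\<^esub> c \<oplus>\<^bsub>matrix_ring n B\<^esub> r"
      by (rule unit_shift[where \<kappa> = \<kappa> and \<theta> = \<theta>]) (fact assms that)+
    then show ?thesis by (elim bexE) (rule pair_decomposition_length_one)
  qed
  then show ?thesis
    using ring_with_involution_matrix
    unfolding star_euclidean_def has_decomposition_length_def is_uniform_decomposition_length_def by blast
qed

theorem theorem3p3p1:
  fixes \<iota> :: "'f::field \<Rightarrow> 'e::field" and \<alpha> :: "'e \<Rightarrow> 'e" and n :: nat
  assumes "global_field TYPE('f)" and "global_field TYPE('e)"
    and "separable_quadratic_extension \<iota>"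
    and "\<alpha> \<in> galois_group \<iota>" and "\<alpha> \<noteq> id"
    and "n \<ge> 1"
  shows "star_euclidean (matrix_ring n (extended_adele_ring \<iota>))
           (matrix_star n (adele_involution \<iota> \<alpha>)) \<and>
         has_decomposition_length (matrix_ring n (extended_adele_ring \<iota>))
           (matrix_star n (adele_involution \<iota> \<alpha>)) 1"
proof -
  let ?E = "ring_of_type_algebra :: 'e ring" and ?F = "ring_of_type_algebra :: 'f ring"
  let ?A = "adele_ring :: (('f \<Rightarrow> real) set \<Rightarrow> (nat \<Rightarrow> 'f) set) ring"
  obtain \<theta> t d where \<theta>: "\<alpha> \<theta> \<noteq> \<theta>" "\<And>x. \<exists>a b. x = \<iota> a + \<iota> b * \<theta>" "\<theta> + \<alpha> \<theta> = \<iota> t" "\<theta> * \<alpha> \<theta> = \<iota> d"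
    and \<alpha>\<alpha>: "\<And>x. \<alpha> (\<alpha> x) = x"
    using quadratic_generator[OF assms(3-5)] by blast
  have \<iota>: "\<iota> \<in> Ring.ring_hom ?F ?E"
    using assms(3) by (simp add: separable_quadratic_extension_def field_extension_def)
  have \<alpha>: "\<alpha> \<in> Ring.ring_hom ?E ?E" "\<And>c. \<alpha> (\<iota> c) = \<iota> c"
    using assms(4) by (simp_all add: galois_group_def ring_iso_def)
  interpret tensor_automorphism ?E ?A ?F \<iota> adele_embed \<alpha>
  proof (intro tensor_automorphism.intro tensor.intro tensor_axioms.intro tensor_automorphism_axioms.intro)
    show "cring ?E" by (rule cring_from_type_algebra)
    show "cring ?A" by (rule cring_adele_ring)
    show "ring ?F" by (rule ring_from_type_algebra)
    show "adele_embed \<in> Ring.ring_hom ?F ?A" by (rule adele_embed_hom[OF assms(1)])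
  qed (use \<iota> \<alpha> \<alpha>\<alpha> in simp_all)
  note star = star_simps star_left star_right
  have left_simps [simp]: "left x \<in> carrier T" "left x \<oplus>\<^bsub>T\<^esub> left y = left (x + y)" "left x \<otimes>\<^bsub>T\<^esub> left y = left (x * y)"
    "left x \<ominus>\<^bsub>T\<^esub> left y = left (x - y)" "left 1 = \<one>\<^bsub>T\<^esub>" for x y
  proof -
    show "left x \<in> carrier T" "left x \<oplus>\<^bsub>T\<^esub> left y = left (x + y)" "left x \<otimes>\<^bsub>T\<^esub> left y = left (x * y)" "left 1 = \<one>\<^bsub>T\<^esub>"
      for x y
      using left.hom_add[of x y] left.hom_mult[of x y] left.hom_one left.hom_closed[of x] by (simp_all add: type_ring_simps)
    show "left x \<ominus>\<^bsub>T\<^esub> left y = left (x - y)"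
      using left.hom_add[of x "\<ominus>\<^bsub>?E\<^esub> y"] left.hom_a_inv[of y] by (simp add: type_ring_simps type_ring_a_inv a_minus_def)
  qed
  have left_unit: "left x \<in> Units T" if "x \<noteq> 0" for x
  proof -
    have "left x \<otimes>\<^bsub>T\<^esub> left (inverse x) = \<one>\<^bsub>T\<^esub>" "left (inverse x) \<otimes>\<^bsub>T\<^esub> left x = \<one>\<^bsub>T\<^esub>"
      using that by simp_all
    then show ?thesis unfolding Units_def by (auto intro!: bexI[of _ "left (inverse x)"] simp del: left_simps(3))
  qed
  have norm: "\<exists>D\<in>carrier ?A. f \<otimes>\<^bsub>T\<^esub> star f = right D" if f: "f \<in> carrier T" for f
  proof -
    have "\<exists>a\<in>carrier ?F. \<exists>b\<in>carrier ?F. x = \<iota> a \<oplus>\<^bsub>?E\<^esub> \<iota> b \<otimes>\<^bsub>?E\<^esub> \<theta>" for x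
      using \<theta>(2)[of x] by (simp add: type_ring_simps)
    then obtain p q where pq: "p \<in> carrier ?A" "q \<in> carrier ?A" "f = right p \<oplus>\<^bsub>T\<^esub> left \<theta> \<otimes>\<^bsub>T\<^esub> right q"
      using quadratic_generation[of \<theta> f] f by (auto simp: type_ring_simps)
    have star_f: "star f = right p \<oplus>\<^bsub>T\<^esub> left (\<alpha> \<theta>) \<otimes>\<^bsub>T\<^esub> right q"
      using pq by (simp add: star type_ring_simps)
    have emb: "adele_embed c \<in> carrier ?A" "left (\<iota> c) = right (adele_embed c)" for c
      using j_closed[of c] left_right[of c] by (simp_all add: type_ring_simps)
    let ?P = "right p" and ?Q = "right q"
    \<comment> \<open>\<open>N (p + \<theta> q) = p\<^sup>2 + t p q + d q\<^sup>2\<close> with the trace \<open>t\<close> and the norm \<open>d\<close> of \<open>\<theta>\<close> in \<open>F\<close>\<close>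
    have "f \<otimes>\<^bsub>T\<^esub> star f = ?P \<otimes>\<^bsub>T\<^esub> ?P \<oplus>\<^bsub>T\<^esub> (left \<theta> \<oplus>\<^bsub>T\<^esub> left (\<alpha> \<theta>)) \<otimes>\<^bsub>T\<^esub> (?P \<otimes>\<^bsub>T\<^esub> ?Q)
        \<oplus>\<^bsub>T\<^esub> (left \<theta> \<otimes>\<^bsub>T\<^esub> left (\<alpha> \<theta>)) \<otimes>\<^bsub>T\<^esub> (?Q \<otimes>\<^bsub>T\<^esub> ?Q)"
    proof -
      have "?P \<in> carrier T" "?Q \<in> carrier T" "left \<theta> \<in> carrier T" "left (\<alpha> \<theta>) \<in> carrier T"
        using pq by simp_all
      moreover have "f \<otimes>\<^bsub>T\<^esub> star f = (?P \<oplus>\<^bsub>T\<^esub> left \<theta> \<otimes>\<^bsub>T\<^esub> ?Q) \<otimes>\<^bsub>T\<^esub> (?P \<oplus>\<^bsub>T\<^esub> left (\<alpha> \<theta>) \<otimes>\<^bsub>T\<^esub> ?Q)"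
        by (subst star_f) (simp only: pq(3))
      ultimately show ?thesis by algebra
    qed
    also have "\<dots> = right (p \<otimes>\<^bsub>?A\<^esub> p \<oplus>\<^bsub>?A\<^esub> adele_embed t \<otimes>\<^bsub>?A\<^esub> (p \<otimes>\<^bsub>?A\<^esub> q) \<oplus>\<^bsub>?A\<^esub> adele_embed d \<otimes>\<^bsub>?A\<^esub> (q \<otimes>\<^bsub>?A\<^esub> q))"
      using pq(1,2) by (simp add: \<theta> emb)
    finally show ?thesis using pq(1,2) emb by blast
  qed
  interpret B: star_cring T star
    by unfold_locales (simp_all add: star)
  obtain \<kappa> :: 'f where \<kappa>: "\<kappa> * \<kappa> - \<kappa> \<noteq> 0"
    using global_field_third_element[OF assms(1)] by blast
  have "star_euclidean (matrix_ring n T) (matrix_star n star) \<and>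
      has_decomposition_length (matrix_ring n T) (matrix_star n star) 1"
  proof (rule B.star_euclidean_matrix_ring[where \<kappa> = "left (\<iota> \<kappa>)" and \<theta> = "left \<theta>"])
    show B.norms_glue
      unfolding B.norms_glue_def Let_def
    proof (intro ballI)
      fix f g assume "f \<in> carrier T" "g \<in> carrier T"
      then obtain D D' where D: "D \<in> carrier ?A" "f \<otimes>\<^bsub>T\<^esub> star f = right D" "D' \<in> carrier ?A" "g \<otimes>\<^bsub>T\<^esub> star g = right D'"
        using norm by metis
      let ?m = "\<lambda>z. z \<otimes>\<^bsub>?A\<^esub> D \<oplus>\<^bsub>?A\<^esub> (\<one>\<^bsub>?A\<^esub> \<ominus>\<^bsub>?A\<^esub> z) \<otimes>\<^bsub>?A\<^esub> D'"
      obtain z u v where z: "z \<in> carrier ?A" "z \<otimes>\<^bsub>?A\<^esub> z = z" and u: "u \<in> carrier ?A" "D = ?m z \<otimes>\<^bsub>?A\<^esub> u"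
        and v: "v \<in> carrier ?A" "D' = ?m z \<otimes>\<^bsub>?A\<^esub> v"
        using adele_patching[OF D(1,3)] by blast
      have m: "right (?m z) = right z \<otimes>\<^bsub>T\<^esub> right D \<oplus>\<^bsub>T\<^esub> (\<one>\<^bsub>T\<^esub> \<ominus>\<^bsub>T\<^esub> right z) \<otimes>\<^bsub>T\<^esub> right D'" "?m z \<in> carrier ?A"
        using z D by (simp_all add: a_minus_def)
      have idem: "right z \<otimes>\<^bsub>T\<^esub> right z = right z" using right.hom_mult[OF z(1,1)] unfolding z(2) by (rule sym)
      have eqs: "right D = right (?m z) \<otimes>\<^bsub>T\<^esub> right u" "right D' = right (?m z) \<otimes>\<^bsub>T\<^esub> right v"
        by (rule trans[OF arg_cong[OF u(2), of right] right.hom_mult[OF m(2) u(1)]],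
            rule trans[OF arg_cong[OF v(2), of right] right.hom_mult[OF m(2) v(1)]])
      show "\<exists>z\<in>carrier T. z \<otimes>\<^bsub>T\<^esub> z = z \<and> star z = z \<and>
          (\<exists>u\<in>carrier T. f \<otimes>\<^bsub>T\<^esub> star f = (z \<otimes>\<^bsub>T\<^esub> (f \<otimes>\<^bsub>T\<^esub> star f) \<oplus>\<^bsub>T\<^esub> (\<one>\<^bsub>T\<^esub> \<ominus>\<^bsub>T\<^esub> z) \<otimes>\<^bsub>T\<^esub> (g \<otimes>\<^bsub>T\<^esub> star g)) \<otimes>\<^bsub>T\<^esub> u) \<and>
          (\<exists>u\<in>carrier T. g \<otimes>\<^bsub>T\<^esub> star g = (z \<otimes>\<^bsub>T\<^esub> (f \<otimes>\<^bsub>T\<^esub> star f) \<oplus>\<^bsub>T\<^esub> (\<one>\<^bsub>T\<^esub> \<ominus>\<^bsub>T\<^esub> z) \<otimes>\<^bsub>T\<^esub> (g \<otimes>\<^bsub>T\<^esub> star g)) \<otimes>\<^bsub>T\<^esub> u)"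
        unfolding D(2,4)
      proof (rule bexI[of _ "right z"], intro conjI)
        show "right z \<otimes>\<^bsub>T\<^esub> right z = right z" by (rule idem)
        show "star (right z) = right z" by (rule star_right[OF z(1)])
        show "\<exists>u\<in>carrier T. right D = (right z \<otimes>\<^bsub>T\<^esub> right D \<oplus>\<^bsub>T\<^esub> (\<one>\<^bsub>T\<^esub> \<ominus>\<^bsub>T\<^esub> right z) \<otimes>\<^bsub>T\<^esub> right D') \<otimes>\<^bsub>T\<^esub> u"
          unfolding m(1)[symmetric] by (rule bexI[of _ "right u"], rule eqs(1), rule right.hom_closed[OF u(1)])
        show "\<exists>u\<in>carrier T. right D' = (right z \<otimes>\<^bsub>T\<^esub> right D \<oplus>\<^bsub>T\<^esub> (\<one>\<^bsub>T\<^esub> \<ominus>\<^bsub>T\<^esub> right z) \<otimes>\<^bsub>T\<^esub> right D') \<otimes>\<^bsub>T\<^esub> u"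
          unfolding m(1)[symmetric] by (rule bexI[of _ "right v"], rule eqs(2), rule right.hom_closed[OF v(1)])
        show "right z \<in> carrier T" by (rule right.hom_closed[OF z(1)])
      qed
    qed
  next
    have "\<iota> \<kappa> * \<iota> \<kappa> - \<iota> \<kappa> = \<iota> (\<kappa> * \<kappa> - \<kappa>)" by (simp add: field_hom_simps[OF \<iota>])
    then have "\<iota> \<kappa> * \<iota> \<kappa> - \<iota> \<kappa> \<noteq> 0" using \<kappa> by (simp add: field_hom_simps(7)[OF \<iota>])
    then show "left (\<iota> \<kappa>) \<otimes>\<^bsub>T\<^esub> left (\<iota> \<kappa>) \<ominus>\<^bsub>T\<^esub> left (\<iota> \<kappa>) \<in> Units T"
      by (simp add: left_unit)
    show "star (left (\<iota> \<kappa>)) = left (\<iota> \<kappa>)" by (simp add: star type_ring_simps \<alpha>)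
    show "star (left \<theta>) \<ominus>\<^bsub>T\<^esub> left \<theta> \<in> Units T"
      using \<theta>(1) by (simp add: star type_ring_simps left_unit)
  qed simp_all
  then show ?thesis
    by (simp add: extended_adele_ring_def adele_involution_def)
qed

end
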